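(* The rule $\gamma\mapsto \mathfrak{Z}_0(\gamma)$ defined in the context induces a function $\mathfrak{Z}_0:G\to\mathcal{D}_0$, where $G=\mathrm{PGL}_2(\mathbb{Q})$, which is an inhomogeneous $1$-cocycle (i.e. $\mathfrak{Z}_0(\gamma\gamma')=\mathfrak{Z}_0(\gamma)+\gamma\cdot\mathfrak{Z}_0(\gamma')$ for all $\gamma,\gamma'\in G$), and whose class in the first cohomology group $H^1(G,\mathcal{D}_0)$ is nonzero. Furthermore, let $$\mathcal{Z}_0:=\mathfrak{Z}_0\begin{pmatrix}0&-1\\1&0\end{pmatrix},\qquad \gamma=\begin{pmatrix}a&b\\c&d\end{pmatrix}\in\mathcal{M},\qquad (x,\omega)\in\mathbb{Q}^2\times \mathrm{M}_{2\times1}^{\mathrm{Irr}}(\mathbb{R}).$$ Then: (i) If both $\omega_1$ and $\omega_2$ are positive, then $$\mathcal{Z}_0(x,\omega)=\zeta_2\big(z(x,\omega),\omega,0\big)+\frac{\mathbf{1}_{\mathbb{Z}}(x_1)}{2}\,\zeta\big(\langle x_2\rangle,0\big)+\frac{\mathbf{1}_{\mathbb{Z}}(x_2)}{2}\,\zeta\big(\langle x_1\rangle,0\big),$$ where, for $\lambda\in\mathbb{R}$, $\langle\lambda\rangle$ is the unique real number in $(0,1]$ with $\langle\lambda\rangle-\lambda\in\mathbb{Z}$, and $z(x,\omega):=\langle x_1\rangle\omega_1+\langle x_2\rangle\omega_2$. (ii) If $c\neq0$, then $$\mathfrak{Z}_0(\gamma)=\begin{pmatrix}1&a\\0&c\end{pmatrix}\cdot\mathcal{Z}_0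 .$$ (iii) Suppose that $\gamma\in\mathrm{SL}_2(\mathbb{Z})$, $c\neq 0$, and there exists $\alpha\in\mathbb{R}$ such that $$\gamma^{\mathrm{T}}\omega=\alpha\omega\qquad\text{and}\qquad \alpha^{-1}v\equiv v \mod \Lambda,$$ where $v:=x_1\omega_1+x_2\omega_2$ and $\Lambda:=\mathbb{Z}\omega_1\oplus\mathbb{Z}\omega_2$. Then $$\mathfrak{Z}_0(\gamma)(x,\omega)=\frac{a+d}{2c}\,\bar B_2(x_2)+\mathrm{sgn}(c)\,S(-a,c;x)-\frac{\mathrm{sgn}(c\alpha)}{4}\,\mathbf{1}_{\mathbb{Z}}(x_1)\mathbf{1}_{\mathbb{Z}}(x_2),$$ so $\mathfrak{Z}_0(\gamma)(x,\omega)$ is a rational number.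
   Context: Notation. Elements $x=(x_1,x_2)$ of $\mathbb{Q}^2$, $\mathbb{Z}^2$, $\mathbb{R}^2$ are row vectors; $\omega=(\omega_1,\omega_2)^{\mathrm{T}}$ is a column vector; $\gamma^{\mathrm T}$ is the transpose and $\gamma^{-\mathrm T}$ the inverse transpose. $\mathbf{1}_X$ is the indicator function of $X\subset\mathbb{R}$; $\{y\}=y-\lfloor y\rfloor$; $\mathrm{sgn}$ is the sign. $\mathcal{M}$ is the set (multiplicative monoid) of $2\times2$ integer matrices with nonzero determinant. $\mathrm{M}_{2\times1}^{\mathrm{Irr}}(\mathbb{R})$ is the set of $2\times1$ real matrices whose two entries are linearly independent over $\mathbb{Q}$, with the Euclidean topology. $G:=\mathrm{PGL}_2(\mathbb{Q})$. The module. $\mathcal{A}_0$ is the additive abelian group of all continuous functions $F:\mathrm{M}_{2\times1}^{\mathrm{Irr}}(\mathbb{R})\to\mathbb{R}$ with $F(\alpha\omega)=F(\omega)$ for all $\alpha\in\mathbb{R}_{>0}$ and all $\omega$. The monoid $\mathcal{M}$ acts on $\mathcal{A}_0$ by $(\gamma\star F)(\omega):=\mathrm{sgn}(\det\gamma)F(\gamma^{\mathrm T}\omega)$. $D_0$ is the additive abelian group of all maps $\nu:\mathbb{Q}^2/\mathbb{Z}^2\to\mathcal{A}_0$ such that $$\nu(x)=\sum_{y\in\mathbb{Q}^2/\mathbb{Z}^2,\ cy=x}\nu(y)\qquad\text{for all }x\in\mathbb{Q}^2/\mathbb{Z}^2,\ c\in\mathbb{Z}_{>0}.$$ $\mathcal{M}$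 acts on $D_0$ by $$(\gamma\cdot\nu)(x):=\gamma\star\sum_{y\in\mathbb{Q}^2/\mathbb{Z}^2,\ y\gamma^{\mathrm T}=x}\nu(y),$$ equivalently $(\gamma\cdot\nu)(x,\omega)=\mathrm{sgn}(\det\gamma)\sum_{\mu\in\mathbb{Z}^2/\mathbb{Z}^2\gamma^{\mathrm T}}\nu\big((x+\mu)\gamma^{-\mathrm T},\gamma^{\mathrm T}\omega\big)$, where $\nu(x,\omega):=\nu(x)(\omega)$. This extends to an action of $\mathrm{GL}_2(\mathbb{Q})$ by $\gamma\cdot\nu:=(c\gamma)\cdot\nu$ for any $c\in\mathbb{Z}_{>0}$ with $c\gamma\in\mathcal{M}$ (well defined). $\mathcal{D}_0:=D_0^{\langle -I_2\rangle}$ is the $\mathrm{GL}_2(\mathbb{Q})$-submodule of elements of $D_0$ fixed by $-I_2$; it is a $G$-module. Bernoulli functions. $\bar B_2(y):=\{y\}^2-\{y\}+1/6$; $\bar B_1(y):=0$ if $y\in\mathbb{Z}$ and $\bar B_1(y):=\{y\}-1/2$ if $y\notin\mathbb{Z}$. Dedekind–Rademacher sum. For $a,c\in\mathbb{Z}$, $c\neq0$, $x\in\mathbb{R}^2$, $$S(a,c;x)=\sum_{m\in\mathbb{Z}/c\mathbb{Z}}\bar B_1\Big(x_1+(x_2+m)\frac ac\Big)\bar B_1\Big((x_2+m)\frac1c\Big).$$ Definition of $\mathfrak{Z}_0$. For $\gamma=\begin{pmatrix}a&b\\c&d\end{pmatrix}\in\mathcal{M}$ and $(x,\omega)\in\mathbb{Q}^2\times\mathrm{M}_{2\times1}^{\mathrm{Irr}}(\mathbb{R})$,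 put $\mathfrak{Z}_0(\gamma)(x,\omega):=0$ if $c=0$, and otherwise, with $\tau:=\omega_2/\omega_1$, $$\mathfrak{Z}_0(\gamma)(x,\omega):=\frac{\gcd(a,c)^2}{2c(a+c\tau)}\bar B_2\Big(\frac{c}{\gcd(a,c)}x_1-\frac{a}{\gcd(a,c)}x_2\Big)+\frac{a+c\tau}{2c}\bar B_2(x_2)+\mathrm{sgn}(c)S(-a,c;x)-\frac{\mathrm{sgn}(c(a+c\tau))}{4}\mathbf{1}_{\mathbb{Z}}(x_1)\mathbf{1}_{\mathbb{Z}}(x_2).$$ The value of $\mathfrak{Z}_0$ at a class in $G$ is computed by any representative in $\mathcal{M}$, and $x$ is read modulo $\mathbb{Z}^2$ (well-definedness is part of the claim). Zeta functions. For $z,\omega_1,\omega_2>0$, $\zeta_2(z,\omega,s)$ is the meromorphic continuation to $s\in\mathbb{C}$ of $\sum_{m=0}^\infty\sum_{n=0}^\infty(z+m\omega_1+n\omega_2)^{-s}$ ($\mathrm{Re}(s)>2$), and for $z>0$, $\zeta(z,s)$ is the meromorphic continuation of $\sum_{n=0}^\infty(z+n)^{-s}$ ($\mathrm{Re}(s)>1$); both are holomorphic at $s=0$. *)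

theory Defs
  imports
    "HOL-Analysis.Analysis"
    "HOL-Complex_Analysis.Complex_Analysis"
    "HOL-Algebra.Coset"
begin

unbundle no fps_syntax

text \<open>
  The module \<open>M\<close> is an abelian group, written multiplicatively as everywhere in HOL-Algebra,
  and \<open>act g m\<close> is the action of \<open>g \<in> carrier G\<close> on \<open>m \<in> carrier M\<close>. Cochains are
  extensional functions on \<open>carrier G\<close>.
\<close>

definition Z1 ::
  "('g, 'x) monoid_scheme \<Rightarrow> ('m, 'y) monoid_scheme \<Rightarrow> ('g \<Rightarrow> 'm \<Rightarrow> 'm) \<Rightarrow> ('g \<Rightarrow> 'm) monoid" where
  "Z1 G M act =
    \<lparr>carrier = {f \<in> carrier G \<rightarrow>\<^sub>E carrier M.
        \<forall>g\<in>carrier G. \<forall>h\<in>carrier G. f (g \<otimes>\<^bsub>G\<^esub> h) = f g \<otimes>\<^bsub>M\<^esub> act g (f h)},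
     mult = (\<lambda>f f'. \<lambda>g\<in>carrier G. f g \<otimes>\<^bsub>M\<^esub> f' g),
     one = (\<lambda>g\<in>carrier G. \<one>\<^bsub>M\<^esub>)\<rparr>"

definition B1 ::
  "('g, 'x) monoid_scheme \<Rightarrow> ('m, 'y) monoid_scheme \<Rightarrow> ('g \<Rightarrow> 'm \<Rightarrow> 'm) \<Rightarrow> ('g \<Rightarrow> 'm) set" where
  "B1 G M act = {\<lambda>g\<in>carrier G. act g m \<otimes>\<^bsub>M\<^esub> inv\<^bsub>M\<^esub> m | m. m \<in> carrier M}"

definition H1 ::
  "('g, 'x) monoid_scheme \<Rightarrow> ('m, 'y) monoid_scheme \<Rightarrow> ('g \<Rightarrow> 'm \<Rightarrow> 'm) \<Rightarrow> ('g \<Rightarrow> 'm) set monoid" where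
  "H1 G M act = Z1 G M act Mod B1 G M act"

definition H1_class ::
  "('g, 'x) monoid_scheme \<Rightarrow> ('m, 'y) monoid_scheme \<Rightarrow> ('g \<Rightarrow> 'm \<Rightarrow> 'm) \<Rightarrow> ('g \<Rightarrow> 'm) \<Rightarrow> ('g \<Rightarrow> 'm) set"
  where "H1_class G M act f = B1 G M act #>\<^bsub>Z1 G M act\<^esub> f"

definition mat2 :: "'a::zero \<Rightarrow> 'a \<Rightarrow> 'a \<Rightarrow> 'a \<Rightarrow> 'a^2^2" where
  "mat2 a b c d = vector [vector [a, b], vector [c, d]]"

definition \<M> :: "(int^2^2) set" where
  "\<M> = {\<gamma>. det \<gamma> \<noteq> 0}"

definition GL2Q :: "(rat^2^2) monoid" where
  "GL2Q = \<lparr>carrier = {g. det g \<noteq> 0}, mult = (**), one = mat 1\<rparr>"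

definition scalarsQ :: "(rat^2^2) set" where
  "scalarsQ = {mat c | c. c \<noteq> 0}"

definition PGL2Q :: "(rat^2^2) set monoid" where
  "PGL2Q = GL2Q Mod scalarsQ"

definition PGL_class :: "int^2^2 \<Rightarrow> (rat^2^2) set" where
  "PGL_class \<gamma> = scalarsQ #>\<^bsub>GL2Q\<^esub> map_matrix of_int \<gamma>"

definition lattice_Z2 :: "(rat^2) set" where
  "lattice_Z2 = {x. \<forall>i. x $ i \<in> \<int>}"

quotient_type QZ2 = "rat^2" / "\<lambda>x y. x - y \<in> lattice_Z2"
  morphisms rep_QZ2 cls
proof (rule equivpI)
  show "reflp (\<lambda>x y. x - y \<in> lattice_Z2)"
    by (simp add: reflp_def lattice_Z2_def)
  show "symp (\<lambda>x y. x - y \<in> lattice_Z2)"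
  proof (rule sympI)
    fix x y :: "rat^2"
    assume "x - y \<in> lattice_Z2"
    then have "- (x $ i - y $ i) \<in> \<int>" for i
      unfolding lattice_Z2_def by (intro Ints_minus) simp
    then show "y - x \<in> lattice_Z2"
      unfolding lattice_Z2_def by simp
  qed
  show "transp (\<lambda>x y. x - y \<in> lattice_Z2)"
  proof (rule transpI)
    fix x y z :: "rat^2"
    assume "x - y \<in> lattice_Z2" "y - z \<in> lattice_Z2"
    then have "(x $ i - y $ i) + (y $ i - z $ i) \<in> \<int>" for i
      unfolding lattice_Z2_def by (intro Ints_add) simp_all
    then show "x - z \<in> lattice_Z2"
      unfolding lattice_Z2_def by simp
  qed
qed

lift_definition nscale :: "nat \<Rightarrow> QZ2 \<Rightarrow> QZ2" is "\<lambda>c x. of_nat c *s x"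
proof -
  fix c :: nat and x y :: "rat^2"
  assume "x - y \<in> lattice_Z2"
  then have "of_nat c * (x $ i - y $ i) \<in> \<int>" for i
    unfolding lattice_Z2_def by (intro Ints_mult) simp_all
  then show "of_nat c *s x - of_nat c *s y \<in> lattice_Z2"
    by (simp add: lattice_Z2_def right_diff_distrib)
qed

lift_definition rmult :: "QZ2 \<Rightarrow> int^2^2 \<Rightarrow> QZ2" is "\<lambda>x A. x v* map_matrix of_int A"
proof -
  fix A :: "int^2^2" and x y :: "rat^2"
  assume "x - y \<in> lattice_Z2"
  then have "(\<Sum>i\<in>UNIV. (x $ i - y $ i) * of_int (A $ i $ j)) \<in> \<int>" for j
    unfolding lattice_Z2_def by (intro Ints_sum Ints_mult) simp_all
  then show "x v* map_matrix of_int A - y v* map_matrix of_int A \<in> lattice_Z2"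
    by (simp add: lattice_Z2_def vector_matrix_mult_def left_diff_distrib sum_subtractf)
qed

definition Mirr :: "(real^2) set" where
  "Mirr = {\<omega>. \<forall>p q :: rat. of_rat p * \<omega> $ 1 + of_rat q * \<omega> $ 2 = 0 \<longrightarrow> p = 0 \<and> q = 0}"

text \<open>
  A function on \<^const>\<open>Mirr\<close> is represented by its extension by zero, so that each function has
  exactly one representative and the pointwise operations on total functions are the operations
  of the module.
\<close>

definition A0 :: "(real^2 \<Rightarrow> real) set" where
  "A0 = {F. continuous_on Mirr F
          \<and> (\<forall>\<alpha>>0. \<forall>\<omega>\<in>Mirr. F (\<alpha> *\<^sub>R \<omega>) = F \<omega>)
          \<and> (\<forall>\<omega>. \<omega> \<notin> Mirr \<longrightarrow> F \<omega> = 0)}"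

definition star :: "int^2^2 \<Rightarrow> (real^2 \<Rightarrow> real) \<Rightarrow> (real^2 \<Rightarrow> real)" (infixr "\<star>" 75) where
  "\<gamma> \<star> F = (\<lambda>\<omega>. of_int (sgn (det \<gamma>)) * F (map_matrix of_int (transpose \<gamma>) *v \<omega>))"

definition D0 :: "(QZ2 \<Rightarrow> real^2 \<Rightarrow> real) set" where
  "D0 = {\<nu>. (\<forall>\<xi>. \<nu> \<xi> \<in> A0)
          \<and> (\<forall>\<xi>. \<forall>c>0. \<nu> \<xi> = (\<lambda>\<omega>. \<Sum>\<eta> | nscale c \<eta> = \<xi>. \<nu> \<eta> \<omega>))}"

definition actM :: "int^2^2 \<Rightarrow> (QZ2 \<Rightarrow> real^2 \<Rightarrow> real) \<Rightarrow> (QZ2 \<Rightarrow> real^2 \<Rightarrow> real)" where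
  "actM \<gamma> \<nu> = (\<lambda>\<xi>. \<gamma> \<star> (\<lambda>\<omega>. \<Sum>\<eta> | rmult \<eta> (transpose \<gamma>) = \<xi>. \<nu> \<eta> \<omega>))"

text \<open>
  On \<^term>\<open>D0\<close> the next action does not depend on the chosen integral multiple of \<open>g\<close>, and on
  the elements of \<^term>\<open>D0\<close> fixed by \<open>- I\<close> the one after it does not depend on the chosen
  representative of the class \<open>K\<close>.
\<close>

definition actGL :: "rat^2^2 \<Rightarrow> (QZ2 \<Rightarrow> real^2 \<Rightarrow> real) \<Rightarrow> (QZ2 \<Rightarrow> real^2 \<Rightarrow> real)" where
  "actGL g \<nu> =
    actM (SOME \<gamma>. \<gamma> \<in> \<M> \<and> (\<exists>c::nat. c > 0 \<and> map_matrix of_int \<gamma> = mat (of_nat c) ** g)) \<nu>"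

definition actPGL :: "(rat^2^2) set \<Rightarrow> (QZ2 \<Rightarrow> real^2 \<Rightarrow> real) \<Rightarrow> (QZ2 \<Rightarrow> real^2 \<Rightarrow> real)" where
  "actPGL K \<nu> = actGL (SOME g. g \<in> K) \<nu>"

definition calD0 :: "(QZ2 \<Rightarrow> real^2 \<Rightarrow> real) monoid" where
  "calD0 = \<lparr>carrier = {\<nu> \<in> D0. actGL (- mat 1) \<nu> = \<nu>},
            mult = (\<lambda>\<nu> \<nu>' \<xi> \<omega>. \<nu> \<xi> \<omega> + \<nu>' \<xi> \<omega>),
            one = (\<lambda>\<xi> \<omega>. 0)\<rparr>"

definition B2bar :: "real \<Rightarrow> real" where
  "B2bar y = (frac y)\<^sup>2 - frac y + 1/6"

definition B1bar :: "real \<Rightarrow> real" where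
  "B1bar y = (if y \<in> \<int> then 0 else frac y - 1/2)"

text \<open>The summand is periodic in \<open>m\<close> with period \<open>c\<close>.\<close>

definition DRsum :: "int \<Rightarrow> int \<Rightarrow> real^2 \<Rightarrow> real" where
  "DRsum a c x =
    (\<Sum>m\<in>{0..<\<bar>c\<bar>}. B1bar (x $ 1 + (x $ 2 + of_int m) * (of_int a / of_int c))
                       * B1bar ((x $ 2 + of_int m) * (1 / of_int c)))"

definition real_vec :: "rat^2 \<Rightarrow> real^2" where
  "real_vec x = (\<chi> i. of_rat (x $ i))"

definition Z0_rule :: "int^2^2 \<Rightarrow> rat^2 \<Rightarrow> real^2 \<Rightarrow> real" where
  "Z0_rule \<gamma> x \<omega> =
    (let a = \<gamma> $ 1 $ 1; c = \<gamma> $ 2 $ 1; \<tau> = \<omega> $ 2 / \<omega> $ 1;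
         x1 = real_of_rat (x $ 1); x2 = real_of_rat (x $ 2)
     in if c = 0 then 0
        else (of_int (gcd a c))\<^sup>2 / (2 * of_int c * (of_int a + of_int c * \<tau>))
               * B2bar (of_int c / of_int (gcd a c) * x1 - of_int a / of_int (gcd a c) * x2)
             + (of_int a + of_int c * \<tau>) / (2 * of_int c) * B2bar x2
             + of_int (sgn c) * DRsum (- a) c (real_vec x)
             - sgn (of_int c * (of_int a + of_int c * \<tau>)) / 4
                 * indicator \<int> x1 * indicator \<int> x2)"

text \<open>
  The induced function on \<^term>\<open>PGL2Q\<close>, evaluated at chosen representatives; that the choices do
  not matter is a claim to be proved.
\<close>

definition frakZ0 :: "(rat^2^2) set \<Rightarrow> QZ2 \<Rightarrow> real^2 \<Rightarrow> real" where
  "frakZ0 = (\<lambda>K\<in>carrier PGL2Q. \<lambda>\<xi> \<omega>.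
     if \<omega> \<in> Mirr then Z0_rule (SOME \<gamma>. \<gamma> \<in> \<M> \<and> PGL_class \<gamma> = K) (SOME x. cls x = \<xi>) \<omega> else 0)"

definition calZ0 :: "QZ2 \<Rightarrow> real^2 \<Rightarrow> real" where
  "calZ0 = frakZ0 (PGL_class (mat2 0 (-1) 1 0))"

text \<open>
  A \<^const>\<open>nicely_meromorphic_on\<close> function is continuous away from its poles and zero at them, so
  the meromorphic continuation is unique as a function.
\<close>

definition zeta1 :: "real \<Rightarrow> complex \<Rightarrow> complex" where
  "zeta1 z = (THE f. f nicely_meromorphic_on UNIV
     \<and> (\<forall>s. Re s > 1 \<longrightarrow> f s = (\<Sum>n. complex_of_real (z + real n) powr (- s))))"

definition zeta2 :: "real \<Rightarrow> real^2 \<Rightarrow> complex \<Rightarrow> complex" where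
  "zeta2 z \<omega> = (THE f. f nicely_meromorphic_on UNIV
     \<and> (\<forall>s. Re s > 2 \<longrightarrow>
          f s = (\<Sum>m. \<Sum>n. complex_of_real (z + real m * \<omega> $ 1 + real n * \<omega> $ 2) powr (- s))))"

definition upper_frac :: "real \<Rightarrow> real" where
  "upper_frac l = (THE t. 0 < t \<and> t \<le> 1 \<and> t - l \<in> \<int>)"

definition zpoint :: "rat^2 \<Rightarrow> real^2 \<Rightarrow> real" where
  "zpoint x \<omega> = upper_frac (of_rat (x $ 1)) * \<omega> $ 1 + upper_frac (of_rat (x $ 2)) * \<omega> $ 2"

definition period_lattice :: "real^2 \<Rightarrow> real set" where
  "period_lattice \<omega> = {of_int m * \<omega> $ 1 + of_int n * \<omega> $ 2 | m n. True}"

end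

theory Submission
  imports Defs
begin

text \<open>
  The whole cocycle is generated by one distribution. Let \<open>S = (0 -1; 1 0)\<close> and let \<open>Z\<close>
  (\<open>Zdist\<close> below) be the value that the rule assigns to \<open>S\<close>. Every matrix \<open>\<gamma>\<close> with lower left
  entry \<open>c \<noteq> 0\<close> factors as \<open>(1 a; 0 c) S \<beta>\<close> with \<open>\<beta>\<close> upper triangular, so a cocycle that
  vanishes on upper triangular matrices and takes the value \<open>Z\<close> at \<open>S\<close> can only be
  \<open>\<gamma> \<mapsto> (1 a; 0 c) \<cdot> Z\<close>. Summing the four terms of \<open>Z\<close> over a fibre of \<open>(1 a; 0 c)\<close>, by the
  distribution relations of the Bernoulli functions, gives precisely the formula of the rule
  (\<open>actM_upper_Zdist\<close>). This is statement (ii), and it replaces all computations with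
  Dedekind sums by three relations for \<open>Z\<close> alone:

  \<^item> \<open>Z\<close> is fixed by all diagonal matrices (\<open>torus_Zdist\<close>), which makes the decomposition
    unambiguous, gives independence of the representative in the projective group, and contains
    the distribution relations of \<open>Z\<close>;
  \<^item> \<open>S \<cdot> Z = - Z\<close> (\<open>Weyl_Zdist\<close>);
  \<^item> \<open>(1 -1; 0 1) \<cdot> Z = Z + (0 -1; 1 1) \<cdot> Z\<close> (\<open>three_term_Zdist\<close>), which rests on a quadratic
    identity between Bernoulli functions, the one behind Dedekind reciprocity.

  The cocycle identity (\<open>cocycle_mult\<close>) follows by distinguishing the Bruhat cells that contain
  \<open>\<gamma>\<close>, \<open>\<gamma>'\<close> and \<open>\<gamma> \<gamma>'\<close>; only the case of three matrices in the big cell uses the three-term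
  relation.

  The class is not zero because a coboundary \<open>\<gamma> \<cdot> \<nu> - \<nu>\<close> with \<open>\<gamma>\<close> hyperbolic in \<open>SL\<^sub>2(\<int>)\<close>
  vanishes at \<open>x = 0\<close> and an eigenvector \<open>\<omega>\<close> of \<open>\<gamma>\<^sup>T\<close> with positive eigenvalue, whereas for
  \<open>\<gamma> = (4 -1; 1 0)\<close> the rule gives \<open>1/12\<close> there. Statement (iii) evaluates the rule at such
  eigenvectors: the eigenvalue \<open>a + c \<tau>\<close> and its inverse add up to the trace, and the
  congruence modulo \<open>\<Lambda>\<close> makes the two values of the second Bernoulli function agree.

  For statement (i) the double zeta function is continued by a difference equation. If
  \<open>Z(s) = \<Sum> w\<^sub>i\<^sup>-\<^sup>s\<close>, then expanding \<open>\<Sum> ((w\<^sub>i + h)\<^sup>1\<^sup>-\<^sup>s - w\<^sub>i\<^sup>1\<^sup>-\<^sup>s)\<close> by Taylor's formula expresses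
  \<open>Z(s)\<close> through \<open>Z(s+1), Z(s+2), \<dots>\<close> and a remainder that converges further to the left
  (\<open>entire_continuation\<close>). For the Hurwitz zeta function the left side telescopes to
  \<open>- z\<^sup>1\<^sup>-\<^sup>s\<close>, for the double zeta function to a Hurwitz zeta function. At integers
  \<open>s \<le> 1\<close> a remainder of sufficiently high order vanishes, so the same equation yields the value at \<open>0\<close>, a quadratic
  polynomial in \<open>z\<close> that is matched with \<open>Z\<close> term by term.
\<close>

unbundle no Formal_Power_Series.fps_syntax

section \<open>Two-by-two matrices\<close>

lemma mat2_nth [simp]:
  "mat2 a b c d $ 1 $ 1 = a" "mat2 a b c d $ 1 $ 2 = b"
  "mat2 a b c d $ 2 $ 1 = c" "mat2 a b c d $ 2 $ 2 = d"
  by (simp_all add: mat2_def)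

lemma mat2_eqI:
  assumes "A $ 1 $ 1 = B $ 1 $ 1" "A $ 1 $ 2 = B $ 1 $ 2" "A $ 2 $ 1 = B $ 2 $ 1" "A $ 2 $ 2 = B $ 2 $ 2"
  shows "A = (B :: 'a^2^2)"
  using assms by (simp add: vec_eq_iff forall_2)

lemma mat2_eta: "mat2 (A $ 1 $ 1) (A $ 1 $ 2) (A $ 2 $ 1) (A $ 2 $ 2) = A"
  by (rule mat2_eqI) simp_all

lemma mat2_cases: obtains a b c d where "A = mat2 a b c d"
  using mat2_eta by metis

lemma mat2_mult:
  "mat2 a b c d ** mat2 a' b' c' d' =
     mat2 (a * a' + b * c') (a * b' + b * d') (c * a' + d * c') (c * b' + d * d' :: 'a::semiring_1)"
  by (rule mat2_eqI) (simp_all add: matrix_matrix_mult_def sum_2)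

lemma mat_eq_mat2: "mat k = mat2 k 0 0 k"
  by (rule mat2_eqI) (simp_all add: mat_def)

lemma det_mat2: "det (mat2 a b c d) = a * d - b * (c :: 'a::comm_ring_1)"
  by (simp add: det_2)

lemma transpose_mat2: "transpose (mat2 a b c d) = mat2 a c b d"
  by (rule mat2_eqI) (simp_all add: transpose_def)

lemma map_matrix_mat2: "map_matrix f (mat2 a b c d) = mat2 (f a) (f b) (f c) (f d)"
  by (rule mat2_eqI) simp_all

lemma uminus_mat2: "- mat2 a b c d = mat2 (- a) (- b) (- c) (- d :: 'a::group_add)"
  by (rule mat2_eqI) simp_all

lemma mat2_vector: "mat2 a b c d *v vector [x, y] = vector [a * x + b * y, c * x + d * y :: 'a::semiring_1]"
  by (simp add: vec_eq_iff forall_2 matrix_vector_mult_def sum_2)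

lemma vector_mat2: "vector [x, y] v* mat2 a b c d = vector [x * a + y * c, x * b + y * d :: 'a::semiring_1]"
  by (simp add: vec_eq_iff forall_2 vector_matrix_mult_def sum_2)

lemmas mat2_simps = mat2_mult det_mat2 transpose_mat2 map_matrix_mat2 mat2_vector vector_mat2

lemma mat2_eq_iff: "mat2 a b c d = mat2 a' b' c' d' \<longleftrightarrow> a = a' \<and> b = b' \<and> c = c' \<and> d = d'"
  by (metis mat2_nth)

lemma map_matrix_mult:
  "map_matrix of_int (A ** B) = map_matrix of_int A ** (map_matrix of_int B :: 'a::ring_1^'n^'m)"
  by (simp add: vec_eq_iff matrix_matrix_mult_def)

lemma mem_\<M>: "mat2 a b c d \<in> \<M> \<longleftrightarrow> a * d \<noteq> b * c"
  by (simp add: \<M>_def det_mat2)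

lemma \<M>_mult: "\<gamma> \<in> \<M> \<Longrightarrow> \<gamma>' \<in> \<M> \<Longrightarrow> \<gamma> ** \<gamma>' \<in> \<M>"
  by (simp add: \<M>_def det_mul)

lemma transpose_\<M>: "transpose \<gamma> \<in> \<M> \<longleftrightarrow> \<gamma> \<in> \<M>"
  by (simp add: \<M>_def)

lemma mat_\<M>: "mat c \<in> \<M> \<longleftrightarrow> c \<noteq> 0"
  by (simp add: mat_eq_mat2 mem_\<M>)

lemma mat_commute: "mat c ** A = A ** mat c" for A :: "'a::comm_semiring_1^2^2"
  by (cases A rule: mat2_cases) (simp add: mat_eq_mat2 mat2_simps mult.commute)

section \<open>The action of integral matrices\<close>

lemma cls_eq_iff: "cls x = cls y \<longleftrightarrow> x $ 1 - y $ 1 \<in> \<int> \<and> x $ 2 - y $ 2 \<in> \<int>"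
  by (simp add: QZ2.abs_eq_iff lattice_Z2_def forall_2)

lemma rep_vector2: "vector [x $ 1, x $ 2] = (x :: 'a::zero^2)"
  by (simp add: vec_eq_iff forall_2)

lemma vec2_cases: obtains x1 x2 where "x = (vector [x1, x2] :: 'a::zero^2)"
  using rep_vector2 by metis

lemma cls_cases: obtains x1 x2 where "\<xi> = cls (vector [x1, x2])"
proof -
  have "\<exists>x. \<xi> = cls x" by (induction \<xi> rule: QZ2.abs_induct) blast
  then show ?thesis using that rep_vector2 by metis
qed

lemma rmult_cls: "rmult (cls (vector [x1, x2])) (mat2 a b c d) =
    cls (vector [x1 * of_int a + x2 * of_int c, x1 * of_int b + x2 * of_int d])"
  by (simp add: rmult.abs_eq mat2_simps)

lemma nscale_cls: "nscale n (cls (vector [x1, x2])) = cls (vector [of_nat n * x1, of_nat n * x2])"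
proof -
  have "of_nat n *s (vector [x1, x2] :: rat^2) = vector [of_nat n * x1, of_nat n * x2]"
    by (simp add: vec_eq_iff forall_2)
  then show ?thesis by (simp add: nscale.abs_eq)
qed

lemma nscale_eq_rmult: "nscale n \<xi> = rmult \<xi> (mat (int n))"
  by (cases \<xi> rule: cls_cases) (simp add: nscale_cls rmult_cls mat_eq_mat2 mult.commute)

lemma rmult_rmult: "rmult (rmult \<xi> A) B = rmult \<xi> (A ** B)"
  by transfer (simp add: vector_matrix_mul_assoc map_matrix_mult lattice_Z2_def)

text \<open>For lifts \<open>x\<close> of \<open>\<xi>\<close> and \<open>y\<close> of a solution, \<open>n y - x\<close> is an integral vector, and the
  solution depends on it modulo \<open>n\<close> only.\<close>

lemma finite_nscale_fibre:
  assumes "n > 0"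
  shows "finite {\<eta>. nscale n \<eta> = \<xi>}"
proof (cases \<xi> rule: cls_cases)
  case (1 x1 x2)
  let ?f = "\<lambda>(i, j). cls (vector [(x1 + of_int i) / of_nat n, (x2 + of_int j) / of_nat n])"
  have "{\<eta>. nscale n \<eta> = \<xi>} \<subseteq> ?f ` ({0..<int n} \<times> {0..<int n})"
  proof
    fix \<eta> assume "\<eta> \<in> {\<eta>. nscale n \<eta> = \<xi>}"
    then have e: "nscale n \<eta> = \<xi>" by simp
    obtain y1 y2 where y: "\<eta> = cls (vector [y1, y2])" by (rule cls_cases)
    from e y 1 obtain k l where k: "of_nat n * y1 - x1 = of_int k" and l: "of_nat n * y2 - x2 = of_int l"
      by (auto simp: nscale_cls cls_eq_iff elim!: Ints_cases)
    have *: "z - (t + of_int (k mod int n)) / of_nat n \<in> \<int>" if "of_nat n * z - t = of_int k"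
      for z t :: rat and k :: int
    proof -
      have "z = (t + of_int k) / of_nat n" using that assms by (simp add: field_simps)
      moreover have "of_int k = (of_nat n * of_int (k div int n) + of_int (k mod int n) :: rat)"
        by (metis mult_div_mod_eq of_int_add of_int_mult of_int_of_nat_eq)
      ultimately have "z - (t + of_int (k mod int n)) / of_nat n = of_int (k div int n)"
        using assms by (simp add: field_simps)
      then show ?thesis by simp
    qed
    have "\<eta> = ?f (k mod int n, l mod int n)"
      using *[OF k] *[OF l] by (simp add: y cls_eq_iff)
    moreover have "(k mod int n, l mod int n) \<in> {0..<int n} \<times> {0..<int n}" using assms by simp
    ultimately show "\<eta> \<in> ?f ` ({0..<int n} \<times> {0..<int n})" by blast
  qed
  then show ?thesis by (rule finite_subset) simp
qed

text \<open>Multiplying by the adjugate turns \<open>A\<close> into the scalar \<open>det A\<close>, so each fibre lies in a fibre of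
  a nonzero integer multiple. Finiteness is what gives the sums over fibres their meaning: a sum
  over an infinite set is \<open>0\<close> by convention.\<close>

lemma finite_rmult_fibre:
  assumes "A \<in> \<M>"
  shows "finite {\<eta>. rmult \<eta> A = \<xi>}"
proof (cases A rule: mat2_cases)
  case (1 a b c d)
  define e where "e = a * d - b * c"
  have "e \<noteq> 0" using assms 1 by (simp add: e_def mem_\<M>)
  \<comment> \<open>the adjugate, with its sign changed so that the scalar is positive\<close>
  define B where "B = mat2 (sgn e * d) (- sgn e * b) (- sgn e * c) (sgn e * a)"
  have "A ** B = mat2 (sgn e * e) 0 0 (sgn e * e)"
    by (simp add: 1 B_def mat2_simps mat2_eq_iff e_def algebra_simps)
  moreover have "sgn e * e = int (nat \<bar>e\<bar>)" by (simp add: sgn_mult_abs sgn_if)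
  ultimately have AB: "A ** B = mat (int (nat \<bar>e\<bar>))"
    by (simp add: mat_eq_mat2)
  have "{\<eta>. rmult \<eta> A = \<xi>} \<subseteq> {\<eta>. nscale (nat \<bar>e\<bar>) \<eta> = rmult \<xi> B}"
    by (auto simp: nscale_eq_rmult rmult_rmult AB)
  then show ?thesis
    using finite_nscale_fibre[of "nat \<bar>e\<bar>"] \<open>e \<noteq> 0\<close> finite_subset by (metis zero_less_abs_iff zero_less_nat_eq)
qed

lemma actM_apply:
  "actM \<gamma> \<nu> \<xi> \<omega> = of_int (sgn (det \<gamma>)) *
     (\<Sum>\<eta> | rmult \<eta> (transpose \<gamma>) = \<xi>. \<nu> \<eta> (map_matrix of_int (transpose \<gamma>) *v \<omega>))"
  by (simp add: actM_def star_def)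

text \<open>Multiplication by \<open>\<gamma>'\<^sup>T\<close> maps the fibre of \<open>(\<gamma> \<gamma>')\<^sup>T\<close> over \<open>\<xi>\<close> into the fibre of \<open>\<gamma>\<^sup>T\<close>, and the
  pieces of this partition are the fibres of \<open>\<gamma>'\<^sup>T\<close> that occur in the iterated sum.\<close>

lemma actM_mult:
  assumes "\<gamma> \<in> \<M>" "\<gamma>' \<in> \<M>"
  shows "actM (\<gamma> ** \<gamma>') \<nu> = actM \<gamma> (actM \<gamma>' \<nu>)"
proof (intro ext)
  fix \<xi> \<omega>
  let ?\<omega> = "map_matrix of_int (transpose (\<gamma> ** \<gamma>')) *v \<omega> :: real^2"
  let ?A = "transpose \<gamma>" and ?B = "transpose \<gamma>'"
  let ?T = "{\<zeta>. rmult \<zeta> ?A = \<xi>}"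
  have fin: "finite {\<eta>. rmult \<eta> ?A = \<xi>'}" "finite {\<eta>. rmult \<eta> ?B = \<xi>'}" 
    "finite {\<eta>. rmult \<eta> (?B ** ?A) = \<xi>'}" for \<xi>'
    using assms by (auto intro!: finite_rmult_fibre \<M>_mult simp: transpose_\<M>)
  have "(\<Sum>\<eta> | rmult \<eta> (?B ** ?A) = \<xi>. \<nu> \<eta> ?\<omega>) =
        (\<Sum>\<zeta>\<in>?T. \<Sum>\<eta> | \<eta> \<in> {\<eta>. rmult \<eta> (?B ** ?A) = \<xi>} \<and> rmult \<eta> ?B = \<zeta>. \<nu> \<eta> ?\<omega>)"
    using fin by (intro sum.group[symmetric]) (auto simp: rmult_rmult)
  also have "\<dots> = (\<Sum>\<zeta>\<in>?T. \<Sum>\<eta> | rmult \<eta> ?B = \<zeta>. \<nu> \<eta> ?\<omega>)"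
    by (intro sum.cong refl) (auto simp: rmult_rmult[symmetric])
  finally have sums: "(\<Sum>\<eta> | rmult \<eta> (?B ** ?A) = \<xi>. \<nu> \<eta> ?\<omega>) = (\<Sum>\<zeta>\<in>?T. \<Sum>\<eta> | rmult \<eta> ?B = \<zeta>. \<nu> \<eta> ?\<omega>)" .
  have "?\<omega> = map_matrix of_int ?B *v (map_matrix of_int ?A *v \<omega>)"
    by (simp add: matrix_transpose_mul map_matrix_mult matrix_vector_mul_assoc)
  then show "actM (\<gamma> ** \<gamma>') \<nu> \<xi> \<omega> = actM \<gamma> (actM \<gamma>' \<nu>) \<xi> \<omega>"
    using sums
    by (simp add: actM_apply det_mul sgn_mult matrix_transpose_mul sum_distrib_left mult.assoc)
qed

lemma actM_add: "actM \<gamma> (\<lambda>\<xi> \<omega>. \<nu> \<xi> \<omega> + \<nu>' \<xi> \<omega>) = (\<lambda>\<xi> \<omega>. actM \<gamma> \<nu> \<xi> \<omega> + actM \<gamma> \<nu>' \<xi> \<omega>)"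
  by (simp add: fun_eq_iff actM_apply sum.distrib distrib_left)

lemma actM_uminus: "actM \<gamma> (\<lambda>\<xi> \<omega>. - \<nu> \<xi> \<omega>) = (\<lambda>\<xi> \<omega>. - actM \<gamma> \<nu> \<xi> \<omega>)"
  by (simp add: fun_eq_iff actM_apply sum_negf)

lemma actM_zero: "actM \<gamma> (\<lambda>\<xi> \<omega>. 0) = (\<lambda>\<xi> \<omega>. 0)"
  by (simp add: fun_eq_iff actM_apply)

text \<open>A matrix that is invertible over \<open>\<int>\<close> permutes \<open>\<rat>\<^sup>2/\<int>\<^sup>2\<close>, so its fibres are single points.\<close>

lemma actM_unimodular:
  assumes "transpose \<gamma> ** B = mat 1" "B ** transpose \<gamma> = mat 1"
  shows "actM \<gamma> \<nu> \<xi> \<omega> = of_int (sgn (det \<gamma>)) * \<nu> (rmult \<xi> B) (map_matrix of_int (transpose \<gamma>) *v \<omega>)"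
proof -
  have id: "rmult \<zeta> (mat 1) = \<zeta>" for \<zeta>
    by (cases \<zeta> rule: cls_cases) (simp add: mat_eq_mat2 rmult_cls)
  have "{\<eta>. rmult \<eta> (transpose \<gamma>) = \<xi>} = {rmult \<xi> B}"
    using assms by (auto simp: rmult_rmult id)
  then show ?thesis by (simp add: actM_apply)
qed

lemma Mirr_iff: "vector [\<omega>1, \<omega>2] \<in> Mirr \<longleftrightarrow> (\<forall>p q. of_rat p * \<omega>1 + of_rat q * \<omega>2 = 0 \<longrightarrow> p = 0 \<and> q = 0)"
  by (simp add: Mirr_def)

lemma Mirr_nonzero: "\<omega> \<in> Mirr \<Longrightarrow> \<omega> $ 1 \<noteq> 0" "\<omega> \<in> Mirr \<Longrightarrow> \<omega> $ 2 \<noteq> 0"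
proof -
  assume *: "\<omega> \<in> Mirr"
  show "\<omega> $ 1 \<noteq> 0"
    using * unfolding Mirr_def mem_Collect_eq
    by (metis mult_eq_0_iff add_0_right of_rat_0 zero_neq_one)
  show "\<omega> $ 2 \<noteq> 0"
    using * unfolding Mirr_def mem_Collect_eq
    by (metis mult_eq_0_iff add_0 of_rat_0 zero_neq_one)
qed

lemma Mirr_int:
  assumes "vector [\<omega>1, \<omega>2] \<in> Mirr" "of_int m * \<omega>1 + of_int n * \<omega>2 = 0"
  shows "m = 0 \<and> n = 0"
  using assms(1)[unfolded Mirr_iff, rule_format, of "of_int m" "of_int n"] assms(2) by simp

text \<open>A rational relation between the entries of \<open>A \<omega>\<close> is one between the entries of \<open>\<omega>\<close> with
  coefficients transformed by \<open>A\<^sup>T\<close>, which is invertible over \<open>\<rat>\<close>; the converse uses the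
  adjugate in the same way.\<close>

lemma Mirr_matrix_iff:
  assumes "A \<in> \<M>"
  shows "map_matrix of_int A *v \<omega> \<in> Mirr \<longleftrightarrow> \<omega> \<in> Mirr"
proof -
  obtain a b c d where A: "A = mat2 a b c d" by (rule mat2_cases)
  obtain u v where \<omega>: "\<omega> = vector [u, v]" by (rule vec2_cases)
  define e :: rat where "e = of_int (a * d - b * c)"
  have "a * d - b * c \<noteq> 0" using assms A by (simp add: mem_\<M>)
  then have e: "e \<noteq> 0" unfolding e_def of_int_eq_0_iff .
  have 1: "p = 0 \<and> q = 0"
    if "vector [u', v'] \<in> Mirr" "of_rat p * (of_int a * u' + of_int b * v') + of_rat q * (of_int c * u' + of_int d * v') = 0"
      "of_int (a * d - b * c) \<noteq> (0::rat)"
    for a b c d p q and u' v' :: real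
  proof -
    have "of_rat (p * of_int a + q * of_int c) * u' + of_rat (p * of_int b + q * of_int d) * v' = 0"
      using that(2) by (simp add: of_rat_add of_rat_mult algebra_simps)
    with that(1) have eqs: "p * of_int a + q * of_int c = 0" "p * of_int b + q * of_int d = 0"
      unfolding Mirr_iff by blast+
    have "p * of_int (a * d - b * c) = (p * of_int a + q * of_int c) * of_int d - (p * of_int b + q * of_int d) * of_int c"
      and "q * of_int (a * d - b * c) = (p * of_int b + q * of_int d) * of_int a - (p * of_int a + q * of_int c) * of_int b"
      by (simp_all add: algebra_simps)
    with that(3) eqs show ?thesis by auto
  qed
  have "map_matrix of_int A *v \<omega> \<in> Mirr" if "\<omega> \<in> Mirr"
    using 1[of u v] that e unfolding A \<omega> mat2_simps Mirr_iff[of "_ + _"] e_def by blast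
  moreover have "\<omega> \<in> Mirr" if "map_matrix of_int A *v \<omega> \<in> Mirr"
  proof -
    let ?u = "of_int a * u + of_int b * v" and ?v = "of_int c * u + of_int d * v"
    have m: "vector [?u, ?v] \<in> Mirr" using that by (simp add: A \<omega> mat2_simps)
    show ?thesis unfolding \<omega> Mirr_iff
    proof (intro allI impI)
      fix p q assume 0: "of_rat p * u + of_rat q * v = 0"
      have "of_rat p * (of_int d * ?u + of_int (- b) * ?v) + of_rat q * (of_int (- c) * ?u + of_int a * ?v)
          = of_int (a * d - b * c) * (of_rat p * u + of_rat q * v)"
        by (simp add: algebra_simps)
      also have "\<dots> = 0" using 0 by simp
      finally show "p = 0 \<and> q = 0"
        by (rule 1[OF m]) (use e in \<open>simp add: e_def mult.commute\<close>)
    qed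
  qed
  ultimately show ?thesis by blast
qed

lemma sum_A0:
  assumes "\<And>i. i \<in> I \<Longrightarrow> F i \<in> A0"
  shows "(\<lambda>\<omega>. \<Sum>i\<in>I. F i \<omega>) \<in> A0"
  using assms unfolding A0_def by (auto intro!: continuous_on_sum sum.cong sum.neutral)

lemma star_A0:
  assumes "F \<in> A0" "\<gamma> \<in> \<M>"
  shows "\<gamma> \<star> F \<in> A0"
proof -
  let ?L = "\<lambda>\<omega>. map_matrix of_int (transpose \<gamma>) *v \<omega> :: real^2"
  have L: "?L \<omega> \<in> Mirr \<longleftrightarrow> \<omega> \<in> Mirr" for \<omega>
    using Mirr_matrix_iff assms(2) transpose_\<M> by blast
  have "continuous_on Mirr (F \<circ> ?L)"
  proof (rule continuous_on_compose)
    show "continuous_on Mirr ?L"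
      by (intro linear_continuous_on linear_conv_bounded_linear[THEN iffD1]) simp
    show "continuous_on (?L ` Mirr) F"
      using assms(1) L unfolding A0_def by (auto elim!: continuous_on_subset)
  qed
  then have "continuous_on Mirr (\<gamma> \<star> F)"
    by (simp add: star_def o_def continuous_on_mult_left)
  then show ?thesis
    using assms(1) L by (auto simp: A0_def star_def matrix_vector_mult_scaleR)
qed

text \<open>A scalar matrix \<open>c > 0\<close> acts by the sum in the distribution relation, since homogeneity absorbs
  the factor \<open>c\<close> in \<open>c \<omega>\<close>. Hence the distribution relations say that positive integers act
  trivially, and they are inherited along any action that commutes with scalars.\<close>

lemma mat_action:
  assumes "\<And>\<xi>. \<nu> \<xi> \<in> A0" "c > 0"
  shows "actM (mat (int c)) \<nu> = (\<lambda>\<xi> \<omega>. \<Sum>\<eta> | nscale c \<eta> = \<xi>. \<nu> \<eta> \<omega>)"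
proof (intro ext)
  fix \<xi> and \<omega> :: "real^2"
  have M: "mat (int c) \<in> \<M>" using assms(2) by (simp add: mat_\<M>)
  have v: "map_matrix of_int (mat (int c)) *v \<omega> = real c *\<^sub>R \<omega>"
    by (simp add: vec_eq_iff forall_2 matrix_vector_mult_def sum_2 mat_def)
  have "\<nu> \<eta> (real c *\<^sub>R \<omega>) = \<nu> \<eta> \<omega>" for \<eta>
    using assms Mirr_matrix_iff[OF M, of \<omega>] v unfolding A0_def
    by (cases "\<omega> \<in> Mirr") (auto dest!: spec[of _ \<eta>])
  moreover have "sgn (det (mat (int c) :: int^2^2)) = 1"
    using assms(2) by (simp add: mat_eq_mat2 det_mat2)
  moreover have "transpose (mat (int c) :: int^2^2) = mat (int c)"
    by (simp add: mat_eq_mat2 transpose_mat2)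
  ultimately show "actM (mat (int c)) \<nu> \<xi> \<omega> = (\<Sum>\<eta> | nscale c \<eta> = \<xi>. \<nu> \<eta> \<omega>)"
    by (simp add: actM_apply v nscale_eq_rmult)
qed

lemma D0_iff: "\<nu> \<in> D0 \<longleftrightarrow> (\<forall>\<xi>. \<nu> \<xi> \<in> A0) \<and> (\<forall>c>0. actM (mat (int c)) \<nu> = \<nu>)"
  unfolding D0_def mem_Collect_eq
  by (intro conj_cong refl) (auto simp: mat_action fun_eq_iff)

lemma actM_A0:
  assumes "\<And>\<xi>. \<nu> \<xi> \<in> A0" "\<gamma> \<in> \<M>"
  shows "actM \<gamma> \<nu> \<xi> \<in> A0"
  unfolding actM_def by (intro star_A0 sum_A0 assms)

lemma actM_mat_commute:
  assumes "\<gamma> \<in> \<M>" "c \<noteq> 0"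
  shows "actM (mat c) (actM \<gamma> \<nu>) = actM \<gamma> (actM (mat c) \<nu>)"
  using assms by (simp add: actM_mult[symmetric] mat_\<M> mat_commute)

text \<open>Two integral multiples of \<open>g\<close> have a common multiple by positive integers, and those act
  trivially on \<^term>\<open>D0\<close>; so any multiple may replace the chosen one.\<close>

lemma actGL_eq:
  assumes "\<nu> \<in> D0" "\<gamma> \<in> \<M>" "n > 0" "map_matrix of_int \<gamma> = mat (of_nat n) ** g"
  shows "actGL g \<nu> = actM \<gamma> \<nu>"
proof -
  let ?P = "\<lambda>\<gamma>. \<gamma> \<in> \<M> \<and> (\<exists>c::nat. c > 0 \<and> map_matrix of_int \<gamma> = mat (of_nat c) ** g)"
  define \<delta> where "\<delta> = (SOME \<gamma>. ?P \<gamma>)"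
  have "?P \<delta>" unfolding \<delta>_def by (rule someI[of ?P \<gamma>]) (use assms in blast)
  then obtain m where \<delta>: "\<delta> \<in> \<M>" "m > 0" "map_matrix of_int \<delta> = mat (of_nat m) ** g" by blast
  have "map_matrix of_int (mat (int m) ** \<gamma>) = (map_matrix of_int (mat (int n) ** \<delta>) :: rat^2^2)"
    by (cases g rule: mat2_cases)
       (simp add: map_matrix_mult assms \<delta> mat_eq_mat2 mat2_simps mult.left_commute)
  then have "mat (int m) ** \<gamma> = mat (int n) ** \<delta>"
    by (simp add: vec_eq_iff)
  then have "actM (mat (int m)) (actM \<gamma> \<nu>) = actM (mat (int n)) (actM \<delta> \<nu>)"
    using assms \<delta> by (metis actM_mult mat_\<M> of_nat_eq_0_iff less_irrefl)
  then have "actM \<gamma> \<nu> = actM \<delta> \<nu>"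
    using assms \<delta> by (simp add: actM_mat_commute D0_iff)
  then show ?thesis by (simp add: actGL_def \<delta>_def)
qed

text \<open>Together with the distribution relations, invariance under \<open>- I\<close> means that every nonzero
  integer acts trivially. This is the form in which membership is verified and used.\<close>

lemma carrier_calD0:
  "carrier calD0 = {\<nu>. (\<forall>\<xi>. \<nu> \<xi> \<in> A0) \<and> (\<forall>c. c \<noteq> 0 \<longrightarrow> actM (mat c) \<nu> = \<nu>)}"
proof -
  have GL: "actGL (- mat 1) \<nu> = actM (mat (- 1)) \<nu>" if "\<nu> \<in> D0" for \<nu>
    by (rule actGL_eq[OF that, of _ 1])
       (simp_all only: mat_\<M>, simp_all add: mat_eq_mat2 map_matrix_mat2 uminus_mat2 mat2_mult)
  have "actM (mat c) \<nu> = \<nu>" if "\<nu> \<in> D0" "actM (mat (- 1)) \<nu> = \<nu>" "c \<noteq> 0" for \<nu> c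
  proof (cases "c > 0")
    case True
    with that(1) show ?thesis by (metis D0_iff zero_less_imp_eq_int)
  next
    case False
    then have "- c > 0" using that(3) by simp
    then have "actM (mat (- c)) \<nu> = \<nu>" using that(1) by (metis D0_iff zero_less_imp_eq_int)
    moreover have "mat c = mat (- 1) ** (mat (- c) :: int^2^2)"
      by (simp add: mat_eq_mat2 mat2_mult)
    ultimately show ?thesis using that by (simp add: actM_mult mat_\<M>)
  qed
  then have "\<nu> \<in> D0 \<and> actGL (- mat 1) \<nu> = \<nu> \<longleftrightarrow> (\<forall>\<xi>. \<nu> \<xi> \<in> A0) \<and> (\<forall>c. c \<noteq> 0 \<longrightarrow> actM (mat c) \<nu> = \<nu>)" for \<nu>
    using GL[of \<nu>] D0_iff[of \<nu>] by (metis less_irrefl of_nat_eq_0_iff zero_neq_neg_one)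
  then show ?thesis by (simp add: calD0_def)
qed

lemma calD0_D0: "\<nu> \<in> carrier calD0 \<Longrightarrow> \<nu> \<in> D0"
  by (simp add: calD0_def)

lemma actM_calD0: "\<nu> \<in> carrier calD0 \<Longrightarrow> \<gamma> \<in> \<M> \<Longrightarrow> actM \<gamma> \<nu> \<in> carrier calD0"
  by (simp add: carrier_calD0 actM_A0 actM_mat_commute)

section \<open>The projective linear group\<close>

lemma PGL_class_eq: "PGL_class \<gamma> = {mat q ** map_matrix of_int \<gamma> | q. q \<noteq> 0}"
  by (auto simp: PGL_class_def r_coset_def scalarsQ_def GL2Q_def)

lemma mat_mult_mat: "mat p ** mat q = (mat (p * q) :: 'a::semiring_1^2^2)"
  by (simp add: mat_eq_mat2 mat2_mult)

lemma map_matrix_of_int_inj: "map_matrix of_int A = (map_matrix of_int B :: rat^2^2) \<longleftrightarrow> A = B"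
  by (simp add: vec_eq_iff)

lemma map_matrix_of_int_mat: "map_matrix of_int (mat k) = (mat (of_int k) :: 'a::ring_1^2^2)"
  by (simp add: mat_eq_mat2 map_matrix_mat2)

lemma det_map_matrix: "det (map_matrix of_int A :: rat^2^2) = of_int (det (A :: int^2^2))"
  by (simp add: det_2)

lemma rat_common_denominator:
  "\<exists>n::nat. n > 0 \<and> (\<exists>\<gamma> :: int^2^2. map_matrix of_int \<gamma> = mat (of_nat n) ** (g :: rat^2^2))"
proof -
  obtain p q r s where g: "g = mat2 p q r s" by (rule mat2_cases)
  have den: "\<exists>n m. n > 0 \<and> of_int n * x = of_int m" for x :: rat
  proof (cases x)
    case (Fract a b)
    then show ?thesis by (intro exI[of _ b] exI[of _ a]) (simp add: Fract_of_int_quotient)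
  qed
  obtain n1 m1 n2 m2 n3 m3 n4 m4 where
    n: "n1 > 0" "of_int n1 * p = of_int m1" "n2 > 0" "of_int n2 * q = of_int m2"
       "n3 > 0" "of_int n3 * r = of_int m3" "n4 > 0" "of_int n4 * s = of_int m4"
    using den[of p] den[of q] den[of r] den[of s] by blast
  define n where "n = nat (n1 * n2 * n3 * n4)"
  have N: "(of_nat n :: rat) = of_int n1 * of_int n2 * of_int n3 * of_int n4" "n > 0"
    using n by (simp_all add: n_def of_nat_nat)
  have "map_matrix of_int (mat2 (m1 * n2 * n3 * n4) (m2 * n1 * n3 * n4) (m3 * n1 * n2 * n4) (m4 * n1 * n2 * n3))
      = mat (of_nat n) ** g"
    by (simp add: g mat_eq_mat2 mat2_simps N n(2,4,6,8)[symmetric] mat2_eq_iff)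
  with N(2) show ?thesis by blast
qed

lemma map_matrix_in_PGL_class: "map_matrix of_int \<gamma> \<in> PGL_class \<gamma>"
  unfolding PGL_class_eq by (rule CollectI, rule exI[of _ 1]) simp

lemma rat_quotient_nonzero:
  assumes "q \<noteq> (0 :: rat)"
  obtains a b where "q = of_int a / of_int b" "b > 0" "a \<noteq> 0"
proof (cases q)
  case (Fract a b)
  then have "a \<noteq> 0" using assms by (auto simp: Fract_of_int_quotient)
  then show ?thesis by (rule that[OF Fract(1)[unfolded Fract_of_int_quotient] Fract(2)])
qed

lemma PGL_class_eqD:
  assumes "PGL_class \<gamma> = PGL_class \<gamma>'"
  obtains m n where "m \<noteq> 0" "n \<noteq> 0" "mat m ** \<gamma> = mat n ** \<gamma>'"
proof -
  have "map_matrix of_int \<gamma> \<in> PGL_class \<gamma>'"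
    using map_matrix_in_PGL_class[of \<gamma>] by (simp add: assms)
  then obtain q where q: "q \<noteq> 0" "map_matrix of_int \<gamma> = mat q ** (map_matrix of_int \<gamma>' :: rat^2^2)"
    unfolding PGL_class_eq by (elim CollectE exE conjE)
  obtain a b where ab: "q = of_int a / of_int b" "b > 0" "a \<noteq> 0"
    by (rule rat_quotient_nonzero[OF q(1)])
  have "of_int b * q = of_int a" using ab by simp
  then have "map_matrix of_int (mat b ** \<gamma>) = (map_matrix of_int (mat a ** \<gamma>') :: rat^2^2)"
    by (simp only: map_matrix_mult map_matrix_of_int_mat q(2) matrix_mul_assoc mat_mult_mat)
  then show ?thesis using that[of b a] ab by (simp add: map_matrix_of_int_inj)
qed

lemma PGL_class_carrier: "\<gamma> \<in> \<M> \<Longrightarrow> PGL_class \<gamma> \<in> carrier PGL2Q"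
  by (auto simp: PGL2Q_def FactGroup_def RCOSETS_def PGL_class_def GL2Q_def \<M>_def det_map_matrix
      intro!: exI[of _ "map_matrix rat_of_int \<gamma>"])

lemma PGL_carrier_cases:
  assumes "K \<in> carrier PGL2Q"
  obtains \<gamma> where "\<gamma> \<in> \<M>" "K = PGL_class \<gamma>"
proof -
  from assms obtain g where g: "det g \<noteq> 0" "K = scalarsQ #>\<^bsub>GL2Q\<^esub> g"
    by (auto simp: PGL2Q_def FactGroup_def RCOSETS_def GL2Q_def)
  obtain n \<gamma> where n: "n > 0" "map_matrix of_int \<gamma> = mat (of_nat n) ** g"
    using rat_common_denominator by blast
  have "det (map_matrix of_int \<gamma> :: rat^2^2) \<noteq> 0"
    using n g by (simp add: det_mul mat_eq_mat2 det_mat2)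
  then have "\<gamma> \<in> \<M>" by (simp add: det_map_matrix \<M>_def)
  moreover have "K = PGL_class \<gamma>"
  proof -
    have "mat q ** map_matrix of_int \<gamma> = mat (q * of_nat n) ** g" for q :: rat
      by (simp add: n matrix_mul_assoc mat_mult_mat)
    moreover have "\<exists>p. mat q ** g = mat (p * of_nat n) ** g \<and> p \<noteq> 0" if "q \<noteq> 0" for q :: rat
      using n(1) that by (intro exI[of _ "q / of_nat n"]) simp
    moreover have "K = {mat q ** g | q. q \<noteq> 0}"
      by (auto simp: g r_coset_def scalarsQ_def GL2Q_def)
    ultimately show ?thesis
      unfolding PGL_class_eq using n(1) by auto
  qed
  ultimately show ?thesis by (rule that)
qed

text \<open>The scalar factors of two elements of the cosets can be collected because scalars are central.\<close>

lemma PGL_class_mult: "PGL_class \<gamma> \<otimes>\<^bsub>PGL2Q\<^esub> PGL_class \<gamma>' = PGL_class (\<gamma> ** \<gamma>')"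
proof -
  have *: "(mat p ** map_matrix of_int \<gamma>) ** (mat q ** map_matrix of_int \<gamma>') =
      mat (p * q) ** map_matrix of_int (\<gamma> ** \<gamma>')" for p q :: rat
    unfolding map_matrix_mult mat_mult_mat[symmetric]
    using mat_commute[of q "map_matrix of_int \<gamma>"] by (metis matrix_mul_assoc)
  have "\<exists>p' q'. mat r ** map_matrix of_int (\<gamma> ** \<gamma>') =
      (mat p' ** map_matrix of_int \<gamma>) ** (mat q' ** map_matrix of_int \<gamma>') \<and> p' \<noteq> 0 \<and> q' \<noteq> 0"
    if "r \<noteq> 0" for r :: rat
    using that by (intro exI[of _ r] exI[of _ 1]) (simp only: *, simp)
  moreover have "PGL_class \<gamma> \<otimes>\<^bsub>PGL2Q\<^esub> PGL_class \<gamma>' =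
      {(mat p ** map_matrix of_int \<gamma>) ** (mat q ** map_matrix of_int \<gamma>') | p q. p \<noteq> 0 \<and> q \<noteq> 0}"
    unfolding PGL2Q_def FactGroup_def PGL_class_eq set_mult_def
    by (simp add: GL2Q_def) blast
  ultimately show ?thesis
    unfolding PGL_class_eq using * by auto
qed

text \<open>The chosen element of the class is \<open>(a/b) \<gamma>\<close>; it acts through its integral multiple \<open>a \<gamma>\<close>, and
  the possibly negative integer \<open>a\<close> acts trivially.\<close>

lemma actPGL_eq:
  assumes "\<nu> \<in> carrier calD0" "\<gamma> \<in> \<M>"
  shows "actPGL (PGL_class \<gamma>) \<nu> = actM \<gamma> \<nu>"
proof -
  define g where "g = (SOME g. g \<in> PGL_class \<gamma>)"
  have "g \<in> PGL_class \<gamma>" unfolding g_def by (rule someI) (rule map_matrix_in_PGL_class)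
  then obtain q where q: "q \<noteq> 0" "g = mat q ** map_matrix of_int \<gamma>"
    unfolding PGL_class_eq by (elim CollectE exE conjE)
  obtain a b where ab: "q = of_int a / of_int b" "b > 0" "a \<noteq> 0"
    by (rule rat_quotient_nonzero[OF q(1)])
  have "actGL g \<nu> = actM (mat a ** \<gamma>) \<nu>"
  proof (rule actGL_eq)
    show "\<nu> \<in> D0" using assms calD0_D0 by blast
    show "mat a ** \<gamma> \<in> \<M>" using ab assms by (simp add: \<M>_mult mat_\<M>)
    show "nat b > 0" using ab by simp
    show "map_matrix of_int (mat a ** \<gamma>) = mat (of_nat (nat b)) ** g"
      using ab by (simp add: q map_matrix_mult map_matrix_of_int_mat matrix_mul_assoc mat_mult_mat of_nat_nat)
  qed
  also have "\<dots> = actM \<gamma> (actM (mat a) \<nu>)"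
    using assms ab by (simp add: actM_mult mat_\<M> actM_mat_commute)
  also have "actM (mat a) \<nu> = \<nu>" using assms(1) ab by (simp add: carrier_calD0)
  finally show ?thesis by (simp add: actPGL_def g_def)
qed

lemma calD0_group:
  "\<nu> \<in> carrier calD0 \<Longrightarrow> \<nu>' \<in> carrier calD0 \<Longrightarrow> (\<lambda>\<xi> \<omega>. \<nu> \<xi> \<omega> + \<nu>' \<xi> \<omega>) \<in> carrier calD0"
  "\<nu> \<in> carrier calD0 \<Longrightarrow> (\<lambda>\<xi> \<omega>. - \<nu> \<xi> \<omega>) \<in> carrier calD0"
  "(\<lambda>\<xi> \<omega>. 0) \<in> carrier calD0"
  by (auto simp: carrier_calD0 actM_add actM_uminus actM_zero A0_def intro!: continuous_on_add continuous_on_minus)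

lemma calD0_inv:
  assumes "\<nu> \<in> carrier calD0"
  shows "inv\<^bsub>calD0\<^esub> \<nu> = (\<lambda>\<xi> \<omega>. - \<nu> \<xi> \<omega>)"
  unfolding m_inv_def
proof (rule the_equality)
  show "(\<lambda>\<xi> \<omega>. - \<nu> \<xi> \<omega>) \<in> carrier calD0 \<and>
    \<nu> \<otimes>\<^bsub>calD0\<^esub> (\<lambda>\<xi> \<omega>. - \<nu> \<xi> \<omega>) = \<one>\<^bsub>calD0\<^esub> \<and> (\<lambda>\<xi> \<omega>. - \<nu> \<xi> \<omega>) \<otimes>\<^bsub>calD0\<^esub> \<nu> = \<one>\<^bsub>calD0\<^esub>"
    using calD0_group(2)[OF assms] by (simp add: calD0_def)
next
  fix y assume "y \<in> carrier calD0 \<and> \<nu> \<otimes>\<^bsub>calD0\<^esub> y = \<one>\<^bsub>calD0\<^esub> \<and> y \<otimes>\<^bsub>calD0\<^esub> \<nu> = \<one>\<^bsub>calD0\<^esub>"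
  then have "y \<xi> \<omega> + \<nu> \<xi> \<omega> = 0" for \<xi> \<omega> by (simp add: calD0_def fun_eq_iff)
  then show "y = (\<lambda>\<xi> \<omega>. - \<nu> \<xi> \<omega>)" by (simp add: fun_eq_iff eq_neg_iff_add_eq_0)
qed

section \<open>Bernoulli functions\<close>

lemma B2bar_of_int_add [simp]: "B2bar (of_int k + y) = B2bar y" "B2bar (y + of_int k) = B2bar y"
  and B1bar_of_int_add [simp]: "B1bar (of_int k + y) = B1bar y" "B1bar (y + of_int k) = B1bar y"
  by (simp_all add: B2bar_def B1bar_def frac_def add.commute)

lemma frac_uminus: "y \<notin> \<int> \<Longrightarrow> frac (- y) = 1 - frac y" for y :: real
  by (simp add: frac_neg)

lemma B2bar_uminus [simp]: "B2bar (- y) = B2bar y"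
proof (cases "y \<in> \<int>")
  case True
  then obtain k where "y = of_int k" by (elim Ints_cases)
  then show ?thesis by (simp add: B2bar_def flip: of_int_minus)
next
  case False
  then show ?thesis by (simp add: B2bar_def frac_uminus power2_eq_square algebra_simps)
qed

lemma B1bar_uminus [simp]: "B1bar (- y) = - B1bar y"
  by (auto simp: B1bar_def frac_uminus)

lemma sum_int_lessThan: "(\<Sum>m\<in>{0..<int n}. f m) = (\<Sum>j<n. f (int j))"
  by (rule sum.reindex_bij_witness[of _ int nat]) auto

lemma periodic_mod:
  fixes f :: "int \<Rightarrow> 'a"
  assumes "\<And>m. f (m + int n) = f m"
  shows "f (m mod int n) = f m"
proof -
  have nat: "f (m + int k * int n) = f m" for m k
  proof (induction k)
    case (Suc k)
    have "m + int (Suc k) * int n = (m + int k * int n) + int n" by (simp add: algebra_simps)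
    with Suc show ?case by (simp only: assms)
  qed simp
  have "f (m + k * int n) = f m" for m k
    using nat[of m "nat k"] nat[of "m + k * int n" "nat (- k)"] by (cases "k \<ge> 0") auto
  from this[of "m mod int n" "m div int n"] show ?thesis by simp
qed

text \<open>The map \<open>m \<mapsto> u m + k\<close> permutes the residues modulo \<open>n\<close>.\<close>

lemma sum_periodic_affine:
  fixes f :: "int \<Rightarrow> 'a::comm_monoid_add"
  assumes per: "\<And>m. f (m + int n) = f m" and "coprime u (int n)"
  shows "(\<Sum>m\<in>{0..<int n}. f (u * m + k)) = (\<Sum>m\<in>{0..<int n}. f m)"
proof (cases "n = 0")
  case False
  let ?A = "{0..<int n}" and ?h = "\<lambda>m. (u * m + k) mod int n"
  have "inj_on ?h ?A"
  proof (rule inj_onI)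
    fix x y assume xy: "x \<in> ?A" "y \<in> ?A" "?h x = ?h y"
    then have "int n dvd (u * x + k) - (u * y + k)" by (simp add: mod_eq_dvd_iff)
    then have "int n dvd u * (x - y)" by (simp add: algebra_simps)
    then have "int n dvd x - y" using assms(2) by (simp add: coprime_commute coprime_dvd_mult_right_iff)
    then show "x = y" using xy by (metis atLeastLessThan_iff mod_eq_dvd_iff mod_pos_pos_trivial)
  qed
  moreover have "?h ` ?A \<subseteq> ?A" using False by auto
  ultimately have bij: "bij_betw ?h ?A ?A"
    by (simp add: bij_betw_def endo_inj_surj)
  have "(\<Sum>m\<in>?A. f (u * m + k)) = (\<Sum>m\<in>?A. f (?h m))"
    by (simp add: periodic_mod[where f = f, OF per])
  also have "\<dots> = (\<Sum>m\<in>?A. f m)" by (rule sum.reindex_bij_betw[OF bij])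
  finally show ?thesis .
qed simp

lemma sum_periodic_multiple:
  fixes f :: "int \<Rightarrow> real"
  assumes per: "\<And>m. f (m + int n) = f m"
  shows "(\<Sum>m\<in>{0..<int (g * n)}. f m) = real g * (\<Sum>m\<in>{0..<int n}. f m)"
proof -
  have per': "f (m + int k * int n) = f m" for m k
    using periodic_mod[where f = f and n = n, of "m + int k * int n"] periodic_mod[where f = f and n = n, of m] per by simp
  have "(\<Sum>m\<in>{0..<int (g * n)}. f m) = (\<Sum>k<g. \<Sum>j=k*n..<k*n+n. f (int j))"
    by (simp only: sum_int_lessThan sum.nat_group)
  also have "\<dots> = (\<Sum>k<g. \<Sum>j<n. f (int j))"
  proof (rule sum.cong[OF refl])
    fix k
    have "(\<Sum>j=k*n..<k*n+n. f (int j)) = (\<Sum>j=0..<n. f (int (j + k * n)))"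
      using sum.shift_bounds_nat_ivl[of "\<lambda>j. f (int j)" 0 "k * n" n] by (simp add: add.commute)
    then show "(\<Sum>j=k*n..<k*n+n. f (int j)) = (\<Sum>j<n. f (int j))"
      by (simp add: per' atLeast0LessThan)
  qed
  finally show ?thesis by (simp add: sum_int_lessThan)
qed

text \<open>Replacing \<open>y\<close> by its fractional part \<open>t\<close> only shifts the summation index. Then all arguments
  \<open>(t + j) / n\<close> lie in \<open>[0, 1)\<close>, where the function is a polynomial, and the sum is elementary.\<close>

lemma B2bar_distribution:
  assumes "n > 0"
  shows "(\<Sum>m\<in>{0..<int n}. B2bar ((y + of_int m) / real n)) = B2bar y / real n"
proof -
  define t where "t = frac y"
  have t: "0 \<le> t" "t < 1" by (simp_all add: t_def frac_lt_1)
  define f where "f m = B2bar ((t + of_int m) / real n)" for m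
  have per: "f (m + int n) = f m" for m
    using assms B2bar_of_int_add(2)[of "(t + of_int m) / real n" 1]
    by (simp add: f_def add_divide_distrib add.assoc)
  have "(\<Sum>m\<in>{0..<int n}. B2bar ((y + of_int m) / real n)) = (\<Sum>m\<in>{0..<int n}. f (1 * m + \<lfloor>y\<rfloor>))"
    by (intro sum.cong refl) (simp add: f_def t_def frac_def algebra_simps)
  also have "\<dots> = (\<Sum>m\<in>{0..<int n}. f m)"
    by (rule sum_periodic_affine) (simp_all add: per)
  also have "\<dots> = (\<Sum>j<n. ((t + real j)\<^sup>2 - (t + real j) * real n + (real n)\<^sup>2 / 6) / (real n)\<^sup>2)"
    unfolding sum_int_lessThan
  proof (intro sum.cong refl)
    fix j assume "j \<in> {..<n}"
    then have "real j + 1 \<le> real n" by simp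
    then have "(t + real j) / real n < 1" "0 \<le> (t + real j) / real n"
      using t assms by simp_all
    then have "frac ((t + of_int (int j)) / real n) = (t + real j) / real n"
      by (simp only: of_int_of_nat_eq frac_eq)
    then show "f (int j) = ((t + real j)\<^sup>2 - (t + real j) * real n + (real n)\<^sup>2 / 6) / (real n)\<^sup>2"
      using assms unfolding f_def B2bar_def \<open>frac _ = _\<close> by (simp add: field_simps power2_eq_square)
  qed
  also have "\<dots> = (\<Sum>j<n. (t + real j)\<^sup>2 - (t + real j) * real n + (real n)\<^sup>2 / 6) / (real n)\<^sup>2"
    by (simp add: sum_divide_distrib)
  also have "(\<Sum>j<n. (t + real j)\<^sup>2 - (t + real j) * N + N\<^sup>2 / 6) =
      real n * t\<^sup>2 + t * (real n * (real n - 1)) + (real n - 1) * real n * (2 * real n - 1) / 6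
      - N * (real n * t + real n * (real n - 1) / 2) + real n * N\<^sup>2 / 6" for N
    by (induction n) (simp_all add: field_simps power2_eq_square)
  also have "(real n * t\<^sup>2 + t * (real n * (real n - 1)) + (real n - 1) * real n * (2 * real n - 1) / 6
      - real n * (real n * t + real n * (real n - 1) / 2) + real n * (real n)\<^sup>2 / 6) / (real n)\<^sup>2 = (t\<^sup>2 - t + 1 / 6) / real n"
    using assms by (simp add: field_simps power2_eq_square)
  finally show ?thesis by (simp add: B2bar_def t_def)
qed

text \<open>The argument is the same as for the second Bernoulli function, except that the value at an
  integer is \<open>0\<close> instead of \<open>- 1/2\<close>. This affects the term \<open>j = 0\<close> for integral \<open>y\<close>, and it makes
  up for the value of the right-hand side at such \<open>y\<close>.\<close>

lemma B1bar_distribution: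
  assumes "n > 0"
  shows "(\<Sum>m\<in>{0..<int n}. B1bar ((y + of_int m) / real n)) = B1bar y"
proof -
  define t where "t = frac y"
  have t: "0 \<le> t" "t < 1" by (simp_all add: t_def frac_lt_1)
  define f where "f m = B1bar ((t + of_int m) / real n)" for m
  have per: "f (m + int n) = f m" for m
    using assms B1bar_of_int_add(2)[of "(t + of_int m) / real n" 1]
    by (simp add: f_def add_divide_distrib add.assoc)
  have "(\<Sum>m\<in>{0..<int n}. B1bar ((y + of_int m) / real n)) = (\<Sum>m\<in>{0..<int n}. f (1 * m + \<lfloor>y\<rfloor>))"
    by (intro sum.cong refl) (simp add: f_def t_def frac_def algebra_simps)
  also have "\<dots> = (\<Sum>m\<in>{0..<int n}. f m)"
    by (rule sum_periodic_affine) (simp_all add: per)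
  also have "\<dots> = (\<Sum>j<n. ((t + real j) / real n - 1 / 2) + (if j = 0 \<and> t = 0 then 1 / 2 else 0))"
    unfolding sum_int_lessThan
  proof (intro sum.cong refl)
    fix j assume "j \<in> {..<n}"
    then have "real j + 1 \<le> real n" by simp
    then have "(t + real j) / real n < 1" "0 \<le> (t + real j) / real n"
      using t assms by simp_all
    then have fr: "frac ((t + real j) / real n) = (t + real j) / real n"
      by (simp add: frac_eq)
    then have "(t + real j) / real n \<in> \<int> \<longleftrightarrow> j = 0 \<and> t = 0"
      using frac_eq_0_iff[of "(t + real j) / real n"] t assms by (auto simp: add_nonneg_eq_0_iff)
    then show "f (int j) = ((t + real j) / real n - 1 / 2) + (if j = 0 \<and> t = 0 then 1 / 2 else 0)"
      using fr by (auto simp: f_def B1bar_def)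
  qed
  also have "\<dots> = (\<Sum>j<n. (t + real j) / real n - 1 / 2) + (if t = 0 then 1 / 2 else 0)"
    using assms by (cases "t = 0") (simp_all add: sum.distrib)
  also have "(\<Sum>j<n. (t + real j) / real n - 1 / 2) = t - 1 / 2"
  proof -
    have "(\<Sum>j<n. (t + real j) * c - 1 / 2) = (real n * t + real n * (real n - 1) / 2) * c - real n / 2" for c
      by (induction n) (simp_all add: algebra_simps add_divide_distrib diff_divide_distrib)
    also have "(real n * t + real n * (real n - 1) / 2) * (1 / real n) - real n / 2 = t - 1 / 2"
      using assms by (simp add: field_simps)
    finally show ?thesis by simp
  qed
  finally show ?thesis
    by (auto simp: B1bar_def t_def frac_eq_0_iff)
qed

text \<open>In terms of the fractional parts \<open>p\<close>, \<open>q\<close>, \<open>r\<close> of \<open>x\<close>, \<open>y\<close>, \<open>x + y\<close> the left-hand side, with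
  polynomials in place of periodic functions, vanishes both for \<open>r = p + q\<close> and for
  \<open>r = p + q - 1\<close>. The default value of the first Bernoulli function at integers changes nothing
  if exactly one of \<open>x\<close>, \<open>y\<close>, \<open>x + y\<close> is an integer, and contributes \<open>1/4\<close> if all of them are.\<close>

lemma Bernoulli_three_term:
  "(B2bar x + B2bar y + B2bar (x + y)) / 2 + B1bar x * B1bar y - B1bar (x + y) * (B1bar x + B1bar y)
     = indicator \<int> x * indicator \<int> y / 4"
proof -
  have B1: "B1bar z = (if frac z = 0 then 0 else frac z - 1/2)" for z by (simp add: B1bar_def)
  have ind: "indicator \<int> z = (if frac z = 0 then 1 else 0 :: real)" for z :: real
    by (simp add: indicator_def)
  define p q where "p = frac x" and "q = frac y"
  have pq: "0 \<le> p" "p < 1" "0 \<le> q" "q < 1" by (simp_all add: p_def q_def frac_lt_1)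
  define r where "r = frac (x + y)"
  have poly_generic: "(p\<^sup>2 - p + 1 / 6 + (q\<^sup>2 - q + 1 / 6) + (r\<^sup>2 - r + 1 / 6)) / 2 + (p - 1 / 2) * (q - 1 / 2)
      - (r - 1 / 2) * ((p - 1 / 2) + (q - 1 / 2)) = 0" if "r = p + q \<or> r = p + q - 1"
    using that by (elim disjE; simp only:; simp add: power2_eq_square field_simps)
  have poly_one: "((p\<^sup>2 - p + 1 / 6) + (q\<^sup>2 - q + 1 / 6) + 1 / 6) / 2 + (p - 1 / 2) * (q - 1 / 2) = 0"
    if "q = 1 - p"
    unfolding that by (simp add: power2_eq_square field_simps)
  have poly_zero: "(1 / 6 + (q\<^sup>2 - q + 1 / 6) + (q\<^sup>2 - q + 1 / 6)) / 2 - (q - 1 / 2) * (q - 1 / 2) = 0" for q :: real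
    by (simp add: power2_eq_square field_simps)
  have "r = (if p + q < 1 then p + q else p + q - 1)"
    by (simp add: frac_add p_def q_def r_def)
  then consider (zero) "p = 0" "q = 0" "r = 0"
    | (below) "p \<noteq> 0 \<or> q \<noteq> 0" "r \<noteq> 0" "r = p + q"
    | (above) "p \<noteq> 0" "q \<noteq> 0" "r \<noteq> 0" "r = p + q - 1"
    | (one) "p \<noteq> 0" "q \<noteq> 0" "q = 1 - p" "r = 0"
    using pq by (smt (verit))
  then have "(p\<^sup>2 - p + 1 / 6 + (q\<^sup>2 - q + 1 / 6) + (r\<^sup>2 - r + 1 / 6)) / 2 +
      (if p = 0 then 0 else p - 1 / 2) * (if q = 0 then 0 else q - 1 / 2) -
      (if r = 0 then 0 else r - 1 / 2) * ((if p = 0 then 0 else p - 1 / 2) + (if q = 0 then 0 else q - 1 / 2)) =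
      (if p = 0 then 1 else 0) * (if q = 0 then 1 else 0) / 4"
  proof cases
    case zero
    then show ?thesis by simp
  next
    case below
    with poly_generic poly_zero[of p] poly_zero[of q] show ?thesis by (cases "p = 0"; cases "q = 0"; simp)
  next
    case above
    with poly_generic show ?thesis by simp
  next
    case one
    with poly_one show ?thesis by simp
  qed
  then show ?thesis
    unfolding B1 ind B2bar_def p_def[symmetric] q_def[symmetric] r_def[symmetric] .
qed

section \<open>The distribution attached to the Weyl element\<close>

text \<open>The rule for the matrix \<open>(0 -1; 1 0)\<close>, as a function of \<open>\<tau> = \<omega>\<^sub>2/\<omega>\<^sub>1\<close> and of the real
  coordinates of \<open>x\<close>.\<close>

definition Zrep :: "real \<Rightarrow> real \<Rightarrow> real \<Rightarrow> real" where
  "Zrep \<tau> x1 x2 = B2bar x1 / (2 * \<tau>) + \<tau> / 2 * B2bar x2 + B1bar x1 * B1bar x2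
     - sgn \<tau> / 4 * indicator \<int> x1 * indicator \<int> x2"

lemma indicator_Ints_add_of_int [simp]:
  "indicator \<int> (x + of_int k) = (indicator \<int> x :: real)" for x :: real
proof -
  have "x + of_int k \<in> \<int> \<longleftrightarrow> x \<in> \<int>"
    by (metis Ints_add Ints_diff Ints_of_int add_diff_cancel_right')
  then show ?thesis by (simp add: indicator_def)
qed

lemma indicator_Ints_uminus [simp]: "indicator \<int> (- x) = (indicator \<int> x :: real)" for x :: real
  by (simp add: indicator_def)

lemma Zrep_shift [simp]: "Zrep \<tau> (x1 + of_int k) (x2 + of_int l) = Zrep \<tau> x1 x2"
  by (simp add: Zrep_def)

lemma indicator_Ints_of_rat: "indicator \<int> (real_of_rat x) = (indicator \<int> x :: 'a::zero_neq_one)"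
proof -
  have "real_of_rat x \<in> \<int> \<longleftrightarrow> x \<in> \<int>"
  proof
    assume "real_of_rat x \<in> \<int>"
    then obtain k where "real_of_rat x = of_int k" by (elim Ints_cases)
    then have "real_of_rat x = of_rat (of_int k)" by simp
    then have "x = of_int k" unfolding of_rat_eq_iff .
    then show "x \<in> \<int>" by simp
  qed (auto elim!: Ints_cases)
  then show ?thesis by (simp add: indicator_def)
qed

lemma Zrep_cong_Ints:
  assumes "x1 - y1 \<in> \<int>" "x2 - y2 \<in> \<int>"
  shows "Zrep \<tau> (of_rat x1) (of_rat x2) = Zrep \<tau> (of_rat y1) (of_rat y2)"
proof -
  obtain k l where "x1 - y1 = of_int k" "x2 - y2 = of_int l"
    using assms by (auto elim!: Ints_cases)
  then have "x1 = y1 + of_int k" "x2 = y2 + of_int l" by (simp_all add: algebra_simps)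
  then show ?thesis by (simp add: of_rat_add)
qed

lift_definition Zdist :: "QZ2 \<Rightarrow> real^2 \<Rightarrow> real" is
  "\<lambda>x \<omega>. if \<omega> \<in> Mirr then Zrep (\<omega> $ 2 / \<omega> $ 1) (of_rat (x $ 1)) (of_rat (x $ 2)) else 0"
proof -
  fix x y :: "rat^2"
  assume "x - y \<in> lattice_Z2"
  then have "x $ 1 - y $ 1 \<in> \<int>" "x $ 2 - y $ 2 \<in> \<int>"
    by (simp_all add: lattice_Z2_def)
  note eq = Zrep_cong_Ints[OF this]
  show "(\<lambda>\<omega>. if \<omega> \<in> Mirr then Zrep (\<omega> $ 2 / \<omega> $ 1) (of_rat (x $ 1)) (of_rat (x $ 2)) else 0) =
      (\<lambda>\<omega>. if \<omega> \<in> Mirr then Zrep (\<omega> $ 2 / \<omega> $ 1) (of_rat (y $ 1)) (of_rat (y $ 2)) else 0)"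
  proof
    fix \<omega> :: "real^2"
    show "(if \<omega> \<in> Mirr then Zrep (\<omega> $ 2 / \<omega> $ 1) (of_rat (x $ 1)) (of_rat (x $ 2)) else 0) =
        (if \<omega> \<in> Mirr then Zrep (\<omega> $ 2 / \<omega> $ 1) (of_rat (y $ 1)) (of_rat (y $ 2)) else 0)"
      unfolding eq[of "\<omega> $ 2 / \<omega> $ 1"] ..
  qed
qed

lemma Zdist_cls: "Zdist (cls (vector [x1, x2])) (vector [\<omega>1, \<omega>2]) =
    (if vector [\<omega>1, \<omega>2] \<in> Mirr then Zrep (\<omega>2 / \<omega>1) (of_rat x1) (of_rat x2) else 0)"
  by (simp add: Zdist.abs_eq)

lemma Zdist_A0: "Zdist \<xi> \<in> A0"
proof (cases \<xi> rule: cls_cases)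
  case (1 x1 x2)
  have nz: "\<omega> $ 2 / \<omega> $ 1 \<noteq> 0" if "\<omega> \<in> Mirr" for \<omega>
    using that Mirr_nonzero by simp
  have "continuous_on Mirr (\<lambda>\<omega>. Zrep (\<omega> $ 2 / \<omega> $ 1) (of_rat x1) (of_rat x2))"
    unfolding Zrep_def using nz Mirr_nonzero by (intro continuous_intros continuous_on_sgn) auto
  then have "continuous_on Mirr (Zdist \<xi>)"
    by (rule continuous_on_eq) (simp add: 1 Zdist.abs_eq)
  moreover have "Zdist \<xi> (\<alpha> *\<^sub>R \<omega>) = Zdist \<xi> \<omega>" if "\<alpha> > 0" "\<omega> \<in> Mirr" for \<alpha> \<omega>
  proof -
    have "\<alpha> *\<^sub>R \<omega> \<in> Mirr"
    proof -
      have "of_rat p * (\<alpha> * \<omega> $ 1) + of_rat q * (\<alpha> * \<omega> $ 2) = \<alpha> * (of_rat p * \<omega> $ 1 + of_rat q * \<omega> $ 2)" for p q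
        by (simp add: algebra_simps)
      then show ?thesis using that by (simp add: Mirr_def)
    qed
    with that show ?thesis by (simp add: 1 Zdist.abs_eq)
  qed
  moreover have "Zdist \<xi> \<omega> = 0" if "\<omega> \<notin> Mirr" for \<omega>
    using that by (simp add: 1 Zdist.abs_eq)
  ultimately show ?thesis by (simp add: A0_def)
qed

section \<open>Fibres of upper triangular matrices\<close>

text \<open>For \<open>\<beta> = (1 a; 0 c)\<close> the vectors \<open>(0, m)\<close> with \<open>0 \<le> m < |c|\<close> represent \<open>\<int>\<^sup>2/\<int>\<^sup>2\<beta>\<^sup>T\<close>, and the
  points listed here are \<open>(x + (0, m)) \<beta>\<^sup>-\<^sup>T\<close>.\<close>

lemma upper_fibre:
  fixes a c :: int and x1 x2 :: rat
  assumes c: "c \<noteq> 0"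
  defines "f m \<equiv> cls (vector [x1 - of_int a * ((x2 + of_int m) / of_int c), (x2 + of_int m) / of_int c])"
  shows "bij_betw f {0..<\<bar>c\<bar>} {\<eta>. rmult \<eta> (transpose (mat2 1 a 0 c)) = cls (vector [x1, x2])}"
  unfolding bij_betw_def
proof
  show "inj_on f {0..<\<bar>c\<bar>}"
  proof (rule inj_onI)
    fix m m' assume m: "m \<in> {0..<\<bar>c\<bar>}" "m' \<in> {0..<\<bar>c\<bar>}" and "f m = f m'"
    then have "(x2 + of_int m) / of_int c - (x2 + of_int m') / of_int c \<in> \<int>"
      by (simp add: f_def cls_eq_iff)
    then obtain k where "(x2 + of_int m) / of_int c - (x2 + of_int m') / of_int c = of_int k"
      by (elim Ints_cases)
    then have "(of_int (m - m') :: rat) / of_int c = of_int k" by (simp add: diff_divide_distrib[symmetric])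
    then have "(of_int (m - m') :: rat) = of_int (k * c)" using c by (simp add: divide_eq_eq)
    then have "m - m' = k * c" unfolding of_int_eq_iff .
    then have "\<bar>c\<bar> dvd m - m'" by simp
    then show "m = m'" using m by (metis atLeastLessThan_iff mod_eq_dvd_iff mod_pos_pos_trivial)
  qed
  show "f ` {0..<\<bar>c\<bar>} = {\<eta>. rmult \<eta> (transpose (mat2 1 a 0 c)) = cls (vector [x1, x2])}"
  proof (intro equalityI subsetI)
    fix \<eta> assume "\<eta> \<in> f ` {0..<\<bar>c\<bar>}"
    then show "\<eta> \<in> {\<eta>. rmult \<eta> (transpose (mat2 1 a 0 c)) = cls (vector [x1, x2])}"
      using c by (auto simp: f_def transpose_mat2 rmult_cls cls_eq_iff)
  next
    fix \<eta> assume "\<eta> \<in> {\<eta>. rmult \<eta> (transpose (mat2 1 a 0 c)) = cls (vector [x1, x2])}"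
    then have r: "rmult \<eta> (mat2 1 0 a c) = cls (vector [x1, x2])" by (simp add: transpose_mat2)
    obtain y1 y2 where y: "\<eta> = cls (vector [y1, y2])" by (rule cls_cases)
    obtain k l where k: "y2 * of_int c - x2 = of_int k" and l: "y1 + y2 * of_int a - x1 = of_int l"
      using r by (auto simp: y rmult_cls cls_eq_iff elim!: Ints_cases)
    \<comment> \<open>division of \<open>k\<close> by \<open>c\<close> with remainder in \<open>[0, |c|)\<close>, for either sign of \<open>c\<close>\<close>
    define m q where "m = k mod \<bar>c\<bar>" and "q = sgn c * (k div \<bar>c\<bar>)"
    have "c * q = \<bar>c\<bar> * (k div \<bar>c\<bar>)" by (simp add: q_def abs_sgn algebra_simps)
    then have "k = c * q + m" by (simp add: m_def)
    then have K: "of_int k = (of_int c * of_int q + of_int m :: rat)" by simp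
    have y2: "y2 = (x2 + of_int m) / of_int c + of_int q"
      using k c unfolding K by (simp add: field_simps)
    have y1: "y1 = x1 - of_int a * ((x2 + of_int m) / of_int c) + of_int (l - a * q)"
      using l unfolding y2 by (simp add: algebra_simps)
    have "\<eta> = f m" unfolding y f_def cls_eq_iff vector_2 unfolding y1 y2 by simp
    moreover have "m \<in> {0..<\<bar>c\<bar>}" using c by (simp add: m_def)
    ultimately show "\<eta> \<in> f ` {0..<\<bar>c\<bar>}" by blast
  qed
qed

text \<open>With \<open>a = g a'\<close>, \<open>c = g c'\<close> for \<open>g = gcd a c\<close>, the summand has period \<open>|c'|\<close>, so each residue
  modulo \<open>|c'|\<close> is met \<open>g\<close> times. As \<open>a'\<close> is prime to \<open>c'\<close>, the distribution relation of level
  \<open>|c'|\<close> applies; one factor \<open>g\<close> comes from the repetition, the other from \<open>1/|c'| = g/|c|\<close>.\<close>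

lemma sum_B2bar_gcd:
  assumes c: "c \<noteq> 0"
  shows "(\<Sum>m\<in>{0..<\<bar>c\<bar>}. B2bar (x1 - of_int a * ((x2 + of_int m) / of_int c))) =
     (of_int (gcd a c))\<^sup>2 / of_int \<bar>c\<bar> * B2bar (of_int c / of_int (gcd a c) * x1 - of_int a / of_int (gcd a c) * x2)"
proof -
  define g :: int where "g = gcd a c"
  have g: "g > 0" using c by (simp add: g_def)
  define a' c' where "a' = a div g" and "c' = c div g"
  have ac: "a = g * a'" "c = g * c'" "coprime a' c'"
    using c by (simp_all add: g_def a'_def c'_def div_gcd_coprime)
  have c': "c' \<noteq> 0" using c ac by auto
  define n s where "n = nat \<bar>c'\<bar>" and "s = sgn c'"
  have n: "n > 0" "int n = \<bar>c'\<bar>" "s * c' = int n" "s * s = 1"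
    using c' by (simp_all add: n_def s_def abs_sgn mult.commute sgn_if)
  define w where "w = of_int c' * x1 - of_int a' * x2"
  define f where "f m = B2bar ((of_int s * w + of_int m) / real n)" for m
  have per: "f (m + int n) = f m" for m
  proof -
    have "(of_int s * w + of_int (m + int n)) / real n = (of_int s * w + of_int m) / real n + of_int 1"
      using n(1) by (simp add: field_simps)
    then show ?thesis by (simp only: f_def B2bar_of_int_add)
  qed
  have abs: "\<bar>c\<bar> = int (nat g * n)" using g n ac by (simp add: abs_mult)
  have ev: "B2bar (of_int s * z) = B2bar z" for z
    using c' by (simp add: s_def sgn_if)
  have cn: "of_int c' = of_int s * real n" 
  proof -
    have "c' = s * int n" using n by (metis mult.assoc mult_1)
    then show ?thesis by simp
  qed
  have "(\<Sum>m\<in>{0..<\<bar>c\<bar>}. B2bar (x1 - of_int a * ((x2 + of_int m) / of_int c))) =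
      (\<Sum>m\<in>{0..<int (nat g * n)}. f ((- s * a') * m + 0))"
    unfolding abs
  proof (intro sum.cong refl)
    fix m
    have s1: "s = 1 \<or> s = - 1" using c' by (simp add: s_def sgn_if)
    have "x1 - of_int a * ((x2 + of_int m) / of_int c) = (w - of_int a' * of_int m) / of_int c'"
      using g c' by (simp add: ac w_def field_simps)
    also have "\<dots> = (of_int s * w + of_int (- s * a' * m)) / real n"
      using n(1) s1 unfolding cn by (auto simp: field_simps)
    finally show "B2bar (x1 - of_int a * ((x2 + of_int m) / of_int c)) = f ((- s * a') * m + 0)"
      by (simp add: f_def)
  qed
  also have "\<dots> = real (nat g) * (\<Sum>m\<in>{0..<int n}. f ((- s * a') * m + 0))"
  proof (rule sum_periodic_multiple)
    fix m
    have "f (z + k * int n) = f z" for z k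
      using periodic_mod[where f = f and n = n, of "z + k * int n"] periodic_mod[where f = f and n = n, of z] per by simp
    from this[of "- s * a' * m" "- s * a'"]
    show "f (- s * a' * (m + int n) + 0) = f (- s * a' * m + 0)" by (simp add: algebra_simps)
  qed
  also have "(\<Sum>m\<in>{0..<int n}. f ((- s * a') * m + 0)) = (\<Sum>m\<in>{0..<int n}. f m)"
  proof (rule sum_periodic_affine)
    show "coprime (- s * a') (int n)" using ac(3) c' by (simp add: n s_def sgn_if)
  qed (rule per)
  also have "\<dots> = B2bar (of_int s * w) / real n"
    unfolding f_def by (rule B2bar_distribution) (rule n)
  also have "\<dots> = B2bar w / real n" by (simp add: ev)
  also have "real (nat g) * (B2bar w / real n) = (of_int g)\<^sup>2 / of_int \<bar>c\<bar> * B2bar w"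
    using g n(1) by (simp add: abs power2_eq_square)
  finally have main: "(\<Sum>m\<in>{0..<\<bar>c\<bar>}. B2bar (x1 - of_int a * ((x2 + of_int m) / of_int c))) =
      (of_int g)\<^sup>2 / of_int \<bar>c\<bar> * B2bar w" .
  have "of_int c / of_int g * x1 - of_int a / of_int g * x2 = w"
    using g by (simp add: ac w_def)
  with main show ?thesis by (simp only: g_def)
qed

text \<open>The distribution relations extended to negative \<open>c\<close> by the parity of the Bernoulli functions.\<close>

lemma sum_sgn_distribution:
  assumes c: "c \<noteq> 0"
  shows "(\<Sum>m\<in>{0..<\<bar>c\<bar>}. B2bar ((x + of_int m) / of_int c)) = B2bar x / of_int \<bar>c\<bar>"
    and "(\<Sum>m\<in>{0..<\<bar>c\<bar>}. B1bar ((x + of_int m) / of_int c)) = of_int (sgn c) * B1bar x"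
proof -
  define n where "n = nat \<bar>c\<bar>"
  have n: "n > 0" "\<bar>c\<bar> = int n" using c by (simp_all add: n_def)
  have pos: "sum f {0..<\<bar>c\<bar>} = sum f {0..<int n}" for f :: "int \<Rightarrow> real" by (simp add: n)
  have per: "B (y + 1) = B y" if "B \<in> {B2bar, B1bar}" for B y
    using that B2bar_of_int_add(2)[of y 1] B1bar_of_int_add(2)[of y 1] by auto
  have neg: "(\<Sum>m\<in>{0..<int n}. B (- ((x + of_int m) / real n))) = (\<Sum>m\<in>{0..<int n}. B ((- x + of_int m) / real n))"
    if B: "B \<in> {B2bar, B1bar}" for B
  proof -
    have "(\<Sum>m\<in>{0..<int n}. B (- ((x + of_int m) / real n))) = (\<Sum>m\<in>{0..<int n}. (\<lambda>m. B ((- x + of_int m) / real n)) ((- 1) * m + 0))"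
      by (intro sum.cong refl) (simp add: minus_divide_left)
    also have "\<dots> = (\<Sum>m\<in>{0..<int n}. B ((- x + of_int m) / real n))"
    proof (rule sum_periodic_affine)
      fix m show "B ((- x + of_int (m + int n)) / real n) = B ((- x + of_int m) / real n)"
      proof -
        have "(- x + of_int (m + int n)) / real n = (- x + of_int m) / real n + 1"
          using n(1) by (simp add: field_simps)
        then show ?thesis by (simp only: per[OF B])
      qed
    qed simp
    finally show ?thesis .
  qed
  have cc: "c = int n \<or> c = - int n" using n by auto
  show "(\<Sum>m\<in>{0..<\<bar>c\<bar>}. B2bar ((x + of_int m) / of_int c)) = B2bar x / of_int \<bar>c\<bar>"
    unfolding pos using cc neg[of B2bar] B2bar_distribution[OF n(1), of x] by auto
  show "(\<Sum>m\<in>{0..<\<bar>c\<bar>}. B1bar ((x + of_int m) / of_int c)) = of_int (sgn c) * B1bar x"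
    unfolding pos using cc neg[of B1bar] B1bar_distribution[OF n(1), of x] B1bar_distribution[OF n(1), of "- x"] n(1)
    by auto
qed

text \<open>If \<open>x2\<close> is an integer, exactly one \<open>m\<close> makes \<open>(x2 + m) / c\<close> integral, and for it the other
  argument differs from \<open>x1\<close> by an integer; otherwise all terms vanish.\<close>

lemma sum_indicator_fibre:
  fixes x1 x2 :: real
  assumes c: "c \<noteq> 0"
  shows "(\<Sum>m\<in>{0..<\<bar>c\<bar>}. indicator \<int> (x1 - of_int a * ((x2 + of_int m) / of_int c)) * indicator \<int> ((x2 + of_int m) / of_int c))
      = (indicator \<int> x1 * indicator \<int> x2 :: real)" (is "(\<Sum>m\<in>_. ?f m) = _")
proof (cases "x2 \<in> \<int>")
  case False
  have "?f m = 0" for m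
  proof -
    have "(x2 + of_int m) / of_int c \<notin> \<int>"
    proof
      assume "(x2 + of_int m) / of_int c \<in> \<int>"
      then obtain k where "(x2 + of_int m) / of_int c = of_int k" by (elim Ints_cases)
      then have "x2 + of_int m = of_int k * of_int c" using c by (simp add: divide_eq_eq)
      then have "x2 = of_int (k * c - m)" by (simp add: algebra_simps)
      with False show False by (metis Ints_of_int)
    qed
    then show ?thesis by simp
  qed
  then have "(\<Sum>m\<in>{0..<\<bar>c\<bar>}. ?f m) = 0" by (intro sum.neutral ballI)
  with False show ?thesis by simp
next
  case True
  then obtain k where k: "x2 = of_int k" by (elim Ints_cases)
  define m0 where "m0 = (- k) mod \<bar>c\<bar>"
  have m0: "m0 \<in> {0..<\<bar>c\<bar>}" using c by (simp add: m0_def)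
  have int: "(x2 + of_int m) / of_int c \<in> \<int> \<longleftrightarrow> c dvd k + m" for m
  proof
    assume "(x2 + of_int m) / of_int c \<in> \<int>"
    then obtain l where "(x2 + of_int m) / of_int c = of_int l" by (elim Ints_cases)
    then have "real_of_int (k + m) = of_int (l * c)" using c by (simp add: k divide_eq_eq)
    then show "c dvd k + m" unfolding of_int_eq_iff by simp
  next
    assume "c dvd k + m"
    then obtain l where "k + m = c * l" by (elim dvdE)
    then have "x2 + of_int m = of_int c * of_int l" by (simp add: k flip: of_int_add of_int_mult)
    then show "(x2 + of_int m) / of_int c \<in> \<int>" using c by simp
  qed
  have "?f m = (if m = m0 then indicator \<int> x1 else 0)" if m: "m \<in> {0..<\<bar>c\<bar>}" for m
  proof (cases "c dvd k + m")
    case False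
    have "\<bar>c\<bar> dvd k + (- k) mod \<bar>c\<bar>" by (simp add: mod_eq_dvd_iff[symmetric] dvd_eq_mod_eq_0 mod_simps)
    then have "m \<noteq> m0" using False by (auto simp: m0_def)
    then show ?thesis using False int by simp
  next
    case True
    then have "\<bar>c\<bar> dvd m - (- k)" by (simp add: add.commute)
    then have "m mod \<bar>c\<bar> = (- k) mod \<bar>c\<bar>" by (simp add: mod_eq_dvd_iff)
    then have "m = m0" using m by (simp add: m0_def)
    moreover obtain l where l: "(x2 + of_int m) / of_int c = of_int l"
      using True int[of m] by (auto elim!: Ints_cases)
    have "?f m = indicator \<int> x1"
      unfolding l using indicator_Ints_add_of_int[of x1 "- a * l"] by simp
    ultimately show ?thesis by simp
  qed
  then have "(\<Sum>m\<in>{0..<\<bar>c\<bar>}. ?f m) = (\<Sum>m\<in>{0..<\<bar>c\<bar>}. if m = m0 then indicator \<int> x1 else 0)"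
    by (intro sum.cong) auto
  also have "\<dots> = indicator \<int> x1" using m0 by simp
  finally show ?thesis using True by simp
qed

text \<open>The source of the formula for the cocycle: each of the four terms of \<^const>\<open>Zrep\<close> is summed over
  the fibre. The products of first Bernoulli functions do not simplify and form the
  Dedekind--Rademacher sum; the other terms collapse by the preceding three lemmas.\<close>

lemma actM_upper_Zdist:
  assumes c: "c \<noteq> 0" and \<omega>: "vector [\<omega>1, \<omega>2] \<in> Mirr"
  shows "actM (mat2 1 a 0 c) Zdist (cls (vector [x1, x2])) (vector [\<omega>1, \<omega>2]) =
           Z0_rule (mat2 a b c d) (vector [x1, x2]) (vector [\<omega>1, \<omega>2])"
proof -
  define \<tau> where "\<tau> = of_int a + of_int c * (\<omega>2 / \<omega>1)"
  define y1 y2 where "y1 = real_of_rat x1" and "y2 = real_of_rat x2"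
  have \<omega>1: "\<omega>1 \<noteq> 0" using Mirr_nonzero[OF \<omega>] by simp
  have \<tau>: "(of_int a * \<omega>1 + of_int c * \<omega>2) / \<omega>1 = \<tau>" using \<omega>1 by (simp add: \<tau>_def field_simps)
  have M: "mat2 1 0 a c \<in> \<M>" using c by (simp add: mem_\<M>)
  have mirr: "vector [\<omega>1, of_int a * \<omega>1 + of_int c * \<omega>2] \<in> Mirr"
    using Mirr_matrix_iff[OF M, of "vector [\<omega>1, \<omega>2]"] \<omega> by (simp add: mat2_simps)
  let ?u = "\<lambda>m. y1 - of_int a * ((y2 + of_int m) / of_int c)" and ?v = "\<lambda>m. (y2 + of_int m) / of_int c"
  have "actM (mat2 1 a 0 c) Zdist (cls (vector [x1, x2])) (vector [\<omega>1, \<omega>2]) =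
      of_int (sgn c) * (\<Sum>\<eta> | rmult \<eta> (transpose (mat2 1 a 0 c)) = cls (vector [x1, x2]).
         Zdist \<eta> (vector [\<omega>1, of_int a * \<omega>1 + of_int c * \<omega>2]))"
    by (simp add: actM_apply mat2_simps)
  also have "\<dots> = of_int (sgn c) * (\<Sum>m\<in>{0..<\<bar>c\<bar>}. Zrep \<tau> (?u m) (?v m))"
    unfolding sum.reindex_bij_betw[OF upper_fibre[OF c], symmetric]
    by (simp add: Zdist_cls mirr \<tau> y1_def y2_def of_rat_add of_rat_diff of_rat_mult of_rat_divide)
  also have "(\<Sum>m\<in>{0..<\<bar>c\<bar>}. Zrep \<tau> (?u m) (?v m)) =
     (\<Sum>m\<in>{0..<\<bar>c\<bar>}. B2bar (?u m)) / (2 * \<tau>) + \<tau> / 2 * (\<Sum>m\<in>{0..<\<bar>c\<bar>}. B2bar (?v m))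
     + (\<Sum>m\<in>{0..<\<bar>c\<bar>}. B1bar (?u m) * B1bar (?v m))
     - sgn \<tau> / 4 * (\<Sum>m\<in>{0..<\<bar>c\<bar>}. indicator \<int> (?u m) * indicator \<int> (?v m))"
    by (simp only: Zrep_def sum.distrib sum_subtractf sum_distrib_left sum_divide_distrib mult.assoc)
  also have "(\<Sum>m\<in>{0..<\<bar>c\<bar>}. B1bar (?u m) * B1bar (?v m)) = DRsum (- a) c (real_vec (vector [x1, x2]))"
    by (simp add: DRsum_def real_vec_def y1_def y2_def mult.commute)
  also have "of_int (sgn c) * ((\<Sum>m\<in>{0..<\<bar>c\<bar>}. B2bar (?u m)) / (2 * \<tau>) + \<tau> / 2 * (\<Sum>m\<in>{0..<\<bar>c\<bar>}. B2bar (?v m))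
     + DRsum (- a) c (real_vec (vector [x1, x2]))
     - sgn \<tau> / 4 * (\<Sum>m\<in>{0..<\<bar>c\<bar>}. indicator \<int> (?u m) * indicator \<int> (?v m))) =
     (of_int (gcd a c))\<^sup>2 / (2 * of_int c * \<tau>) * B2bar (of_int c / of_int (gcd a c) * y1 - of_int a / of_int (gcd a c) * y2)
     + \<tau> / (2 * of_int c) * B2bar y2 + of_int (sgn c) * DRsum (- a) c (real_vec (vector [x1, x2]))
     - sgn (of_int c * \<tau>) / 4 * indicator \<int> y1 * indicator \<int> y2"
    unfolding sum_B2bar_gcd[OF c] sum_sgn_distribution(1)[OF c] sum_indicator_fibre[OF c] sgn_mult
    using c by (cases "c > 0") (simp_all add: field_simps)
  also have "\<dots> = Z0_rule (mat2 a b c d) (vector [x1, x2]) (vector [\<omega>1, \<omega>2])"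
    using c by (simp add: Z0_rule_def Let_def \<tau>_def y1_def y2_def)
  finally show ?thesis .
qed

section \<open>Torus invariance, inversion and the three-term relation\<close>

lemma distribution_eqI:
  assumes "\<And>x1 x2 \<omega>1 \<omega>2. F (cls (vector [x1, x2])) (vector [\<omega>1, \<omega>2]) = G (cls (vector [x1, x2])) (vector [\<omega>1, \<omega>2])"
  shows "F = (G :: QZ2 \<Rightarrow> real^2 \<Rightarrow> real)"
proof (intro ext)
  fix \<xi> and \<omega> :: "real^2"
  obtain x1 x2 where "\<xi> = cls (vector [x1, x2])" by (rule cls_cases)
  moreover obtain \<omega>1 \<omega>2 where "\<omega> = vector [\<omega>1, \<omega>2]" by (rule vec2_cases[of \<omega>])
  ultimately show "F \<xi> \<omega> = G \<xi> \<omega>" using assms by simp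
qed

lemma actM_Zdist_off_Mirr: "\<gamma> \<in> \<M> \<Longrightarrow> \<omega> \<notin> Mirr \<Longrightarrow> actM \<gamma> Zdist \<xi> \<omega> = 0"
  using actM_A0[where \<nu> = Zdist and \<gamma> = \<gamma> and \<xi> = \<xi>] Zdist_A0 by (simp add: A0_def)

lemma Zrep_Weyl:
  assumes "\<tau> \<noteq> 0"
  shows "Zrep (- 1 / \<tau>) x2 (- x1) = - Zrep \<tau> x1 x2"
proof -
  have "sgn (- 1 / \<tau>) = - sgn \<tau>" by (simp add: sgn_if)
  then show ?thesis
    unfolding Zrep_def by (simp only: B2bar_uminus B1bar_uminus indicator_Ints_uminus) (simp add: field_simps)
qed

text \<open>The matrix exchanges the coordinates up to sign and replaces \<open>\<tau>\<close> by \<open>- 1/\<tau>\<close>. This swaps the two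
  terms with the second Bernoulli function and reverses all signs.\<close>

lemma Weyl_Zdist: "actM (mat2 0 (-1) 1 0) Zdist = (\<lambda>\<xi> \<omega>. - Zdist \<xi> \<omega>)"
proof (rule distribution_eqI)
  fix x1 x2 \<omega>1 \<omega>2
  let ?S = "mat2 0 (-1) 1 0 :: int^2^2"
  show "actM ?S Zdist (cls (vector [x1, x2])) (vector [\<omega>1, \<omega>2]) = - Zdist (cls (vector [x1, x2])) (vector [\<omega>1, \<omega>2])"
  proof (cases "vector [\<omega>1, \<omega>2] \<in> Mirr")
    case True
    have nz: "\<omega>1 \<noteq> 0" "\<omega>2 \<noteq> 0" using Mirr_nonzero[OF True] by simp_all
    have "vector [\<omega>2, - \<omega>1] \<in> Mirr"
      using Mirr_matrix_iff[of "mat2 0 1 (-1) 0" "vector [\<omega>1, \<omega>2]"] True by (simp add: mem_\<M> mat2_simps)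
    moreover have "actM ?S Zdist (cls (vector [x1, x2])) (vector [\<omega>1, \<omega>2]) = Zdist (cls (vector [x2, - x1])) (vector [\<omega>2, - \<omega>1])"
      by (subst actM_unimodular[of _ "mat2 0 (-1) 1 0"]) (simp_all add: mat_eq_mat2 mat2_simps rmult_cls)
    moreover have "- \<omega>1 / \<omega>2 = - 1 / (\<omega>2 / \<omega>1)" by simp
    ultimately show ?thesis
      using True nz Zrep_Weyl[of "\<omega>2 / \<omega>1" "of_rat x2" "of_rat x1"] by (simp add: Zdist_cls of_rat_minus)
  next
    case False
    then show ?thesis by (simp add: actM_Zdist_off_Mirr mem_\<M> Zdist_cls)
  qed
qed

text \<open>The case \<open>a = 0\<close> of the formula above: there the Dedekind--Rademacher sum factors and the
  distribution relation of the first Bernoulli function evaluates it.\<close>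

lemma torus_right_Zdist:
  assumes q: "q \<noteq> 0"
  shows "actM (mat2 1 0 0 q) Zdist = Zdist"
proof (rule distribution_eqI)
  fix x1 x2 \<omega>1 \<omega>2
  show "actM (mat2 1 0 0 q) Zdist (cls (vector [x1, x2])) (vector [\<omega>1, \<omega>2]) = Zdist (cls (vector [x1, x2])) (vector [\<omega>1, \<omega>2])"
  proof (cases "vector [\<omega>1, \<omega>2] \<in> Mirr")
    case True
    define y1 y2 where "y1 = real_of_rat x1" and "y2 = real_of_rat x2"
    have DR: "DRsum 0 q (real_vec (vector [x1, x2])) = B1bar y1 * (of_int (sgn q) * B1bar y2)"
      using sum_sgn_distribution(2)[OF q, of y2]
      by (simp add: DRsum_def real_vec_def y1_def y2_def flip: sum_distrib_left)
    have B2: "B2bar (of_int q / of_int \<bar>q\<bar> * y1) = B2bar y1"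
      using q by (cases "q > 0") simp_all
    have sg: "sgn (of_int q * (of_int q * (\<omega>2 / \<omega>1))) = sgn (\<omega>2 / \<omega>1)"
      using q by (simp add: sgn_mult mult.assoc[symmetric])
    have sq: "real_of_int (sgn q) * of_int (sgn q) = 1" using q by (simp add: sgn_if)
    have "actM (mat2 1 0 0 q) Zdist (cls (vector [x1, x2])) (vector [\<omega>1, \<omega>2]) =
        (of_int \<bar>q\<bar>)\<^sup>2 / (2 * of_int q * (of_int q * (\<omega>2 / \<omega>1))) * B2bar (of_int q / of_int \<bar>q\<bar> * y1)
        + of_int q * (\<omega>2 / \<omega>1) / (2 * of_int q) * B2bar y2
        + of_int (sgn q) * (B1bar y1 * (of_int (sgn q) * B1bar y2))
        - sgn (of_int q * (of_int q * (\<omega>2 / \<omega>1))) / 4 * indicator \<int> y1 * indicator \<int> y2"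
      using actM_upper_Zdist[OF q True, of 0 x1 x2 0 0] q DR
      by (simp add: Z0_rule_def Let_def y1_def y2_def)
    also have "\<dots> = Zrep (\<omega>2 / \<omega>1) y1 y2"
      unfolding sg B2 Zrep_def using q sq by (simp add: power2_eq_square field_simps) (simp add: mult.assoc[symmetric])?
    finally show ?thesis using True by (simp add: Zdist_cls y1_def y2_def)
  next
    case False
    then show ?thesis using q by (simp add: actM_Zdist_off_Mirr mem_\<M> Zdist_cls)
  qed
qed

text \<open>Conjugation by \<open>(0 -1; 1 0)\<close>, under which \<^const>\<open>Zdist\<close> only changes its sign, carries the
  invariance from the lower right entry to the upper left one.\<close>

lemma torus_Zdist:
  assumes "p \<noteq> 0" "q \<noteq> 0"
  shows "actM (mat2 p 0 0 q) Zdist = Zdist"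
proof -
  let ?S = "mat2 0 (-1) 1 0 :: int^2^2" and ?S' = "mat2 0 1 (-1) 0 :: int^2^2"
  have "actM ?S' (actM ?S Zdist) = actM (mat2 1 0 0 1) Zdist"
    by (simp add: actM_mult[symmetric] mem_\<M> mat2_mult)
  then have S': "actM ?S' (\<lambda>\<xi> \<omega>. - Zdist \<xi> \<omega>) = Zdist"
    by (simp add: Weyl_Zdist torus_right_Zdist)
  have "actM (mat2 p 0 0 1) Zdist = actM ?S' (actM (mat2 1 0 0 p) (actM ?S Zdist))"
    using assms by (simp add: actM_mult[symmetric] mem_\<M> mat2_mult)
  also have "\<dots> = Zdist"
    using assms by (simp add: Weyl_Zdist actM_uminus torus_right_Zdist S'[unfolded actM_uminus])
  finally have p: "actM (mat2 p 0 0 1) Zdist = Zdist" .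
  have "actM (mat2 p 0 0 q) Zdist = actM (mat2 p 0 0 1) (actM (mat2 1 0 0 q) Zdist)"
    using assms by (simp add: actM_mult[symmetric] mem_\<M> mat2_mult)
  then show ?thesis using assms p by (simp add: torus_right_Zdist)
qed

lemma Zdist_calD0: "Zdist \<in> carrier calD0"
  by (simp add: carrier_calD0 Zdist_A0 mat_eq_mat2 torus_Zdist)

lemma actM_Zdist_scale:
  assumes "\<gamma> \<in> \<M>" "k \<noteq> 0"
  shows "actM (mat k ** \<gamma>) Zdist = actM \<gamma> Zdist"
  using assms actM_calD0[OF Zdist_calD0 assms(1)] by (simp add: actM_mult mat_\<M> carrier_calD0)

lemma actM_Zdist_torus:
  assumes "\<gamma> \<in> \<M>" "p \<noteq> 0" "q \<noteq> 0"
  shows "actM (\<gamma> ** mat2 p 0 0 q) Zdist = actM \<gamma> Zdist"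
  using assms by (simp add: actM_mult mem_\<M> torus_Zdist)

text \<open>The coefficients of \<open>1/\<tau>\<close>, \<open>1/(\<tau> - 1)\<close> and \<open>\<tau>\<close> match by partial fractions; the constant terms
  are the identity \<open>Bernoulli_three_term\<close>, whose right-hand side is matched because
  \<open>sgn \<tau> + sgn ((\<tau> - 1)/\<tau>) - sgn (\<tau> - 1) = 1\<close> on each of the three intervals into which
  \<open>0\<close> and \<open>1\<close> divide the line.\<close>

lemma Zrep_three_term:
  assumes \<tau>: "\<tau> \<noteq> 0" "\<tau> \<noteq> 1"
  shows "Zrep (\<tau> - 1) (x + y) y = Zrep \<tau> x y + Zrep ((\<tau> - 1) / \<tau>) (x + y) (- x)"
proof -
  have sg: "sgn \<tau> + sgn ((\<tau> - 1) / \<tau>) - sgn (\<tau> - 1) = 1"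
    using \<tau> by (auto simp: sgn_if zero_less_divide_iff)
  define \<delta> b :: real where "\<delta> = indicator \<int> x * indicator \<int> y" and "b = B2bar (x + y)"
  have ind: "indicator \<int> (x + y) * indicator \<int> y = \<delta>" "indicator \<int> (x + y) * indicator \<int> x = \<delta>"
    by (auto simp: \<delta>_def indicator_def)
  have three: "b = 2 * (\<delta> / 4 - B1bar x * B1bar y + B1bar (x + y) * (B1bar x + B1bar y)) - B2bar x - B2bar y"
    using Bernoulli_three_term[of x y] by (simp add: \<delta>_def b_def field_simps)
  have "sgn ((\<tau> - 1) / \<tau>) = 1 + sgn (\<tau> - 1) - sgn \<tau>" using sg by simp
  then have R: "Zrep \<tau> x y + Zrep ((\<tau> - 1) / \<tau>) (x + y) (- x) =
     B2bar x / (2 * \<tau>) + \<tau> / 2 * B2bar y + B1bar x * B1bar y + b / (2 * ((\<tau> - 1) / \<tau>)) + ((\<tau> - 1) / \<tau>) / 2 * B2bar x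
      - B1bar (x + y) * B1bar x - (1 + sgn (\<tau> - 1)) / 4 * \<delta>"
    by (simp add: Zrep_def b_def mult.assoc ind \<delta>_def[symmetric]) (simp add: field_simps)
  have L: "Zrep (\<tau> - 1) (x + y) y = b / (2 * (\<tau> - 1)) + (\<tau> - 1) / 2 * B2bar y + B1bar (x + y) * B1bar y - sgn (\<tau> - 1) / 4 * \<delta>"
    by (simp add: Zrep_def b_def mult.assoc ind)
  define X1 X2 X3 X4 where "X1 = B2bar x / (2 * \<tau>)" and "X2 = ((\<tau> - 1) / \<tau>) / 2 * B2bar x"
    and "X3 = b / (2 * ((\<tau> - 1) / \<tau>))" and "X4 = b / (2 * (\<tau> - 1))"
  have "X3 = X4 + b / 2"
    using \<tau> by (simp add: X3_def X4_def field_simps)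
  moreover have "X1 + X2 = B2bar x / 2"
    using \<tau> by (simp add: X1_def X2_def field_simps)
  moreover have "b / 2 = \<delta> / 4 - B1bar x * B1bar y + B1bar (x + y) * (B1bar x + B1bar y) - B2bar x / 2 - B2bar y / 2"
    using three by simp
  ultimately show ?thesis
    unfolding L R X1_def[symmetric] X2_def[symmetric] X3_def[symmetric] X4_def[symmetric]
    by (simp add: algebra_simps add_divide_distrib diff_divide_distrib)
qed

lemma three_term_Zdist:
  "actM (mat2 1 (-1) 0 1) Zdist = (\<lambda>\<xi> \<omega>. Zdist \<xi> \<omega> + actM (mat2 0 (-1) 1 1) Zdist \<xi> \<omega>)"
proof (rule distribution_eqI)
  fix x1 x2 \<omega>1 \<omega>2
  let ?U = "mat2 1 (-1) 0 1 :: int^2^2" and ?V = "mat2 0 (-1) 1 1 :: int^2^2"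
  let ?\<omega> = "vector [\<omega>1, \<omega>2] :: real^2" and ?\<xi> = "cls (vector [x1, x2])"
  show "actM ?U Zdist ?\<xi> ?\<omega> = Zdist ?\<xi> ?\<omega> + actM ?V Zdist ?\<xi> ?\<omega>"
  proof (cases "?\<omega> \<in> Mirr")
    case True
    have nz: "\<omega>1 \<noteq> 0" "\<omega>2 \<noteq> 0" using Mirr_nonzero[OF True] by simp_all
    have ne: "\<omega>1 \<noteq> \<omega>2" using Mirr_int[OF True, of 1 "-1"] by auto
    have "vector [\<omega>1, \<omega>2 - \<omega>1] \<in> Mirr" "vector [\<omega>2, \<omega>2 - \<omega>1] \<in> Mirr"
      using Mirr_matrix_iff[of "mat2 1 0 (-1) 1" ?\<omega>] Mirr_matrix_iff[of "mat2 0 1 (-1) 1" ?\<omega>] True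
      by (simp_all add: mem_\<M> mat2_simps)
    moreover have "actM ?U Zdist ?\<xi> ?\<omega> = Zdist (cls (vector [x1 + x2, x2])) (vector [\<omega>1, \<omega>2 - \<omega>1])"
      by (subst actM_unimodular[of _ "mat2 1 0 1 1"]) (simp_all add: mat_eq_mat2 mat2_simps rmult_cls)
    moreover have "actM ?V Zdist ?\<xi> ?\<omega> = Zdist (cls (vector [x1 + x2, - x1])) (vector [\<omega>2, \<omega>2 - \<omega>1])"
      by (subst actM_unimodular[of _ "mat2 1 (-1) 1 0"]) (simp_all add: mat_eq_mat2 mat2_simps rmult_cls)
    moreover have "(\<omega>2 - \<omega>1) / \<omega>1 = \<omega>2 / \<omega>1 - 1" "(\<omega>2 - \<omega>1) / \<omega>2 = (\<omega>2 / \<omega>1 - 1) / (\<omega>2 / \<omega>1)"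
      using nz by (simp_all add: field_simps)
    moreover have "\<omega>2 / \<omega>1 \<noteq> 0" "\<omega>2 / \<omega>1 \<noteq> 1" using nz ne by simp_all
    ultimately show ?thesis
      using True Zrep_three_term[of "\<omega>2 / \<omega>1" "of_rat x1" "of_rat x2"] by (simp add: Zdist_cls of_rat_add of_rat_minus)
  next
    case False
    then show ?thesis by (simp add: actM_Zdist_off_Mirr mem_\<M> Zdist_cls)
  qed
qed

text \<open>All three-term relations are transforms of one. Acting by \<open>diag (- D, e)\<close> on the basic
  relation, and multiplying its members on the right by diagonal matrices, which fix
  \<^const>\<open>Zdist\<close>, gives the relation between \<open>(c D; 0 e)\<close>, \<open>I\<close> and \<open>(0 D; c e)\<close>. Acting by \<open>(1 a; 0 c)\<close> on it
  yields the claim up to the scalar \<open>c\<close>.\<close>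

lemma three_term_general:
  assumes c: "c \<noteq> 0" and e: "e \<noteq> 0" and D: "c * f - a * e \<noteq> 0"
  shows "actM (mat2 1 f 0 e) Zdist = (\<lambda>\<xi> \<omega>. actM (mat2 1 a 0 c) Zdist \<xi> \<omega> + actM (mat2 a f c e) Zdist \<xi> \<omega>)"
proof -
  define D where "D = c * f - a * e"
  have D0: "D \<noteq> 0" using D by (simp add: D_def)
  let ?T = "mat2 (- D) 0 0 e" and ?U = "mat2 1 (-1) 0 1 :: int^2^2" and ?V = "mat2 0 (-1) 1 1 :: int^2^2"
  have M: "?T \<in> \<M>" "?U \<in> \<M>" "?V \<in> \<M>" "mat2 c D 0 e \<in> \<M>" "mat2 0 D c e \<in> \<M>" "mat2 1 a 0 c \<in> \<M>" "mat2 1 f 0 e \<in> \<M>"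
    using c e D0 by (simp_all add: mem_\<M>)
  have N: "mat2 a f c e \<in> \<M>" using D by (simp add: mem_\<M> mult.commute)
  \<comment> \<open>the right factors are chosen to make the products integral multiples of the wanted matrices\<close>
  have "actM (?T ** ?U) Zdist = actM ((?T ** ?U) ** mat2 (- c) 0 0 D) Zdist"
    using M c D0 by (simp add: actM_Zdist_torus \<M>_mult)
  also have "(?T ** ?U) ** mat2 (- c) 0 0 D = mat D ** mat2 c D 0 e"
    by (simp add: mat_eq_mat2 mat2_mult mat2_eq_iff)
  also have "actM \<dots> Zdist = actM (mat2 c D 0 e) Zdist"
    using M D0 by (simp add: actM_Zdist_scale)
  finally have 1: "actM (?T ** ?U) Zdist = actM (mat2 c D 0 e) Zdist" .
  have "actM (?T ** ?V) Zdist = actM ((?T ** ?V) ** mat2 c 0 0 e) Zdist"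
    using M c e by (simp add: actM_Zdist_torus \<M>_mult)
  also have "(?T ** ?V) ** mat2 c 0 0 e = mat e ** mat2 0 D c e"
    by (simp add: mat_eq_mat2 mat2_mult mat2_eq_iff)
  also have "actM \<dots> Zdist = actM (mat2 0 D c e) Zdist"
    using M e by (simp add: actM_Zdist_scale)
  finally have 2: "actM (?T ** ?V) Zdist = actM (mat2 0 D c e) Zdist" .
  have "actM (?T ** ?U) Zdist = (\<lambda>\<xi> \<omega>. actM ?T Zdist \<xi> \<omega> + actM (?T ** ?V) Zdist \<xi> \<omega>)"
    using M by (simp add: actM_mult three_term_Zdist actM_add)
  then have 3: "actM (mat2 c D 0 e) Zdist = (\<lambda>\<xi> \<omega>. Zdist \<xi> \<omega> + actM (mat2 0 D c e) Zdist \<xi> \<omega>)"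
    using D0 e by (simp add: 1 2 torus_Zdist)
  have "mat c ** mat2 1 f 0 e = mat2 1 a 0 c ** mat2 c D 0 e" "mat c ** mat2 a f c e = mat2 1 a 0 c ** mat2 0 D c e"
    by (simp_all add: mat_eq_mat2 mat2_mult mat2_eq_iff D_def mult.commute)
  then have "actM (mat2 1 f 0 e) Zdist = actM (mat2 1 a 0 c) (actM (mat2 c D 0 e) Zdist)"
    "actM (mat2 a f c e) Zdist = actM (mat2 1 a 0 c) (actM (mat2 0 D c e) Zdist)"
    using M N c by (metis actM_Zdist_scale actM_mult)+
  then show ?thesis by (simp add: 3 actM_add)
qed

section \<open>The cocycle\<close>

text \<open>The only candidate: on the big Bruhat cell \<open>\<gamma>\<close> equals \<open>(1 a; 0 c) (0 -1; 1 0)\<close> times an upper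
  triangular matrix over \<open>\<rat>\<close>, and the cocycle vanishes on upper triangular matrices.\<close>

definition cocycle :: "int^2^2 \<Rightarrow> QZ2 \<Rightarrow> real^2 \<Rightarrow> real" where
  "cocycle \<gamma> = (if \<gamma> $ 2 $ 1 = 0 then (\<lambda>\<xi> \<omega>. 0) else actM (mat2 1 (\<gamma> $ 1 $ 1) 0 (\<gamma> $ 2 $ 1)) Zdist)"

lemma cocycle_mat2: "cocycle (mat2 a b c d) = (if c = 0 then (\<lambda>\<xi> \<omega>. 0) else actM (mat2 1 a 0 c) Zdist)"
  by (simp add: cocycle_def)

lemma cocycle_calD0: "cocycle \<gamma> \<in> carrier calD0"
  by (simp add: cocycle_def calD0_group(3) actM_calD0 Zdist_calD0 mem_\<M>)

text \<open>Let \<open>(f, e)\<^sup>T\<close> be the first column of \<open>\<gamma> \<gamma>'\<close>. If \<open>\<gamma>\<close> or \<open>\<gamma>'\<close> is upper triangular, the two sides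
  differ by a diagonal matrix only. If both are in the big cell, then \<open>\<gamma> (1 a'; 0 c')\<close> is
  \<open>(a f; c e)\<close>; for \<open>e = 0\<close> this is \<open>(1 a; 0 c) (0 -1; 1 0)\<close> times a diagonal matrix and the two
  terms cancel, and for \<open>e \<noteq> 0\<close> the claim is the general three-term relation.\<close>

lemma cocycle_mult:
  assumes "\<gamma> \<in> \<M>" "\<gamma>' \<in> \<M>"
  shows "cocycle (\<gamma> ** \<gamma>') = (\<lambda>\<xi> \<omega>. cocycle \<gamma> \<xi> \<omega> + actM \<gamma> (cocycle \<gamma>') \<xi> \<omega>)"
proof -
  obtain a b c d where \<gamma>: "\<gamma> = mat2 a b c d" by (rule mat2_cases)
  obtain a' b' c' d' where \<gamma>': "\<gamma>' = mat2 a' b' c' d'" by (rule mat2_cases)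
  define f e where "f = a * a' + b * c'" and "e = c * a' + d * c'"
  have prod: "cocycle (\<gamma> ** \<gamma>') = (if e = 0 then (\<lambda>\<xi> \<omega>. 0) else actM (mat2 1 f 0 e) Zdist)"
    by (simp add: \<gamma> \<gamma>' mat2_mult cocycle_mat2 f_def e_def)
  have det: "a * d - b * c \<noteq> 0" "a' * d' - b' * c' \<noteq> 0" using assms by (simp_all add: \<gamma> \<gamma>' mem_\<M>)
  show ?thesis
  proof (cases "c' = 0")
    case True
    then have "a' \<noteq> 0" using det by auto
    show ?thesis
    proof (cases "c = 0")
      case False
      have "mat2 1 f 0 e = mat2 1 a 0 c ** mat2 1 0 0 a'"
        using True by (simp add: mat2_mult f_def e_def)
      then have "actM (mat2 1 f 0 e) Zdist = actM (mat2 1 a 0 c) Zdist"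
        using False \<open>a' \<noteq> 0\<close> by (simp add: actM_Zdist_torus mem_\<M>)
      moreover have "e \<noteq> 0" using True False \<open>a' \<noteq> 0\<close> by (simp add: e_def)
      ultimately show ?thesis unfolding prod using True False by (simp add: \<gamma> \<gamma>' cocycle_mat2 actM_zero)
    next
      case c: True
      then have "e = 0" using True by (simp add: e_def)
      then show ?thesis unfolding prod using True c by (simp add: \<gamma> \<gamma>' cocycle_mat2 actM_zero)
    qed
  next
    case c': False
    have \<beta>': "mat2 1 a' 0 c' \<in> \<M>" using c' by (simp add: mem_\<M>)
    have "\<gamma> ** mat2 1 a' 0 c' = mat2 a f c e"
      by (simp add: \<gamma> mat2_mult f_def e_def)
    then have act: "actM \<gamma> (cocycle \<gamma>') = actM (mat2 a f c e) Zdist"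
      using c' assms \<beta>' by (simp add: actM_mult[symmetric] \<gamma>' cocycle_mat2)
    have "c * f - a * e = - ((a * d - b * c) * c')"
      by (simp add: f_def e_def algebra_simps)
    then have D: "c * f - a * e \<noteq> 0" using det c' by simp
    show ?thesis
    proof (cases "c = 0")
      case True
      then have "e \<noteq> 0" "a \<noteq> 0" using D by auto
      have "mat2 a f c e = mat2 1 f 0 e ** mat2 a 0 0 1" using True by (simp add: mat2_mult)
      then have "actM (mat2 a f c e) Zdist = actM (mat2 1 f 0 e) Zdist"
        using \<open>e \<noteq> 0\<close> \<open>a \<noteq> 0\<close> by (simp add: actM_Zdist_torus mem_\<M>)
      then show ?thesis using \<open>e \<noteq> 0\<close> True by (simp add: prod act) (simp add: \<gamma> cocycle_mat2)
    next
      case c: False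
      show ?thesis
      proof (cases "e = 0")
        case True
        then have f: "f \<noteq> 0" using D by auto
        have "mat2 a f c e = mat2 1 a 0 c ** (mat2 0 (-1) 1 0 ** mat2 1 0 0 (- f))"
          using True by (simp add: mat2_mult)
        then have "actM (mat2 a f c e) Zdist = actM (mat2 1 a 0 c) (actM (mat2 0 (-1) 1 0 ** mat2 1 0 0 (- f)) Zdist)"
          by (simp only:) (rule actM_mult; use c f in \<open>simp add: mem_\<M> mat2_mult\<close>)
        also have "\<dots> = (\<lambda>\<xi> \<omega>. - actM (mat2 1 a 0 c) Zdist \<xi> \<omega>)"
          using f by (simp add: actM_Zdist_torus mem_\<M> Weyl_Zdist actM_uminus del: mat2_mult)
        finally show ?thesis using True c by (simp add: prod act) (simp add: \<gamma> cocycle_mat2)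
      next
        case False
        then show ?thesis
          using three_term_general[OF c False D] c by (simp add: prod act) (simp add: \<gamma> cocycle_mat2)
      qed
    qed
  qed
qed

text \<open>Scaling \<open>\<gamma>\<close> multiplies \<open>(1 a; 0 c)\<close> by \<open>diag (1, k)\<close> on the right.\<close>

lemma cocycle_scale:
  assumes "k \<noteq> 0"
  shows "cocycle (mat k ** \<gamma>) = cocycle \<gamma>"
proof (cases \<gamma> rule: mat2_cases)
  case (1 a b c d)
  have "actM (mat2 1 (k * a) 0 (k * c)) Zdist = actM (mat2 1 a 0 c) Zdist" if "c \<noteq> 0"
    using actM_Zdist_torus[of "mat2 1 a 0 c" 1 k] that assms by (simp add: mem_\<M> mat2_mult mult.commute)
  then show ?thesis using assms by (simp add: 1 mat_eq_mat2 mat2_mult cocycle_mat2)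
qed

lemma cocycle_cong:
  assumes "PGL_class \<gamma> = PGL_class \<gamma>'"
  shows "cocycle \<gamma> = cocycle \<gamma>'"
  using assms by (metis PGL_class_eqD cocycle_scale)

lemma cocycle_eq_rule:
  assumes "\<omega> \<in> Mirr"
  shows "cocycle \<gamma> (cls x) \<omega> = Z0_rule \<gamma> x \<omega>"
proof -
  obtain a b c d where \<gamma>: "\<gamma> = mat2 a b c d" by (rule mat2_cases)
  obtain x1 x2 where x: "x = vector [x1, x2]" by (rule vec2_cases)
  obtain \<omega>1 \<omega>2 where \<omega>: "\<omega> = vector [\<omega>1, \<omega>2]" by (rule vec2_cases)
  show ?thesis
  proof (cases "c = 0")
    case True
    then show ?thesis by (simp add: \<gamma> cocycle_mat2 Z0_rule_def)
  next
    case False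
    then show ?thesis using actM_upper_Zdist[of c \<omega>1 \<omega>2 a x1 x2 b d] assms by (simp add: \<gamma> x \<omega> cocycle_mat2)
  qed
qed

lemma frakZ0_eq_cocycle:
  assumes "\<gamma> \<in> \<M>"
  shows "frakZ0 (PGL_class \<gamma>) = cocycle \<gamma>"
proof (intro ext)
  fix \<xi> \<omega>
  define \<delta> where "\<delta> = (SOME \<delta>. \<delta> \<in> \<M> \<and> PGL_class \<delta> = PGL_class \<gamma>)"
  have "\<delta> \<in> \<M> \<and> PGL_class \<delta> = PGL_class \<gamma>"
    unfolding \<delta>_def by (rule someI[of _ \<gamma>]) (simp add: assms)
  then have \<delta>: "cocycle \<delta> = cocycle \<gamma>" using cocycle_cong by blast
  define x where "x = (SOME x. cls x = \<xi>)"
  have x: "cls x = \<xi>" unfolding x_def by (rule someI_ex) (metis cls_cases)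
  have "cocycle \<gamma> \<xi> \<omega> = 0" if "\<omega> \<notin> Mirr"
    using cocycle_calD0[of \<gamma>] that by (simp add: carrier_calD0 A0_def)
  then show "frakZ0 (PGL_class \<gamma>) \<xi> \<omega> = cocycle \<gamma> \<xi> \<omega>"
    using cocycle_eq_rule[of \<omega> \<delta> x] by (simp add: frakZ0_def PGL_class_carrier assms \<delta>_def[symmetric] x_def[symmetric] \<delta> x)
qed

lemma calZ0_eq: "calZ0 = Zdist"
proof -
  have "calZ0 = cocycle (mat2 0 (-1) 1 0)"
    unfolding calZ0_def by (rule frakZ0_eq_cocycle) (simp add: mem_\<M>)
  then show ?thesis by (simp add: cocycle_mat2 torus_Zdist)
qed

lemma frakZ0_mult:
  assumes "K \<in> carrier PGL2Q" "L \<in> carrier PGL2Q"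
  shows "frakZ0 (K \<otimes>\<^bsub>PGL2Q\<^esub> L) = frakZ0 K \<otimes>\<^bsub>calD0\<^esub> actPGL K (frakZ0 L)"
proof -
  obtain \<gamma> where \<gamma>: "\<gamma> \<in> \<M>" "K = PGL_class \<gamma>" using assms(1) by (rule PGL_carrier_cases)
  obtain \<gamma>' where \<gamma>': "\<gamma>' \<in> \<M>" "L = PGL_class \<gamma>'" using assms(2) by (rule PGL_carrier_cases)
  have "frakZ0 (K \<otimes>\<^bsub>PGL2Q\<^esub> L) = cocycle (\<gamma> ** \<gamma>')"
    using \<gamma> \<gamma>' by (simp add: PGL_class_mult frakZ0_eq_cocycle \<M>_mult)
  moreover have "actPGL K (frakZ0 L) = actM \<gamma> (cocycle \<gamma>')"
    using \<gamma> \<gamma>' by (simp add: frakZ0_eq_cocycle actPGL_eq cocycle_calD0)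
  ultimately show ?thesis
    using \<gamma> \<gamma>' by (simp add: cocycle_mult frakZ0_eq_cocycle calD0_def)
qed

lemma frakZ0_Pi: "frakZ0 \<in> carrier PGL2Q \<rightarrow>\<^sub>E carrier calD0"
proof (rule PiE_I)
  fix K assume "K \<in> carrier PGL2Q"
  then show "frakZ0 K \<in> carrier calD0"
    by (metis PGL_carrier_cases frakZ0_eq_cocycle cocycle_calD0)
next
  fix K assume "K \<notin> carrier PGL2Q"
  then show "frakZ0 K = undefined" by (simp add: frakZ0_def)
qed

lemma frakZ0_Z1: "frakZ0 \<in> carrier (Z1 PGL2Q calD0 actPGL)"
  using frakZ0_Pi frakZ0_mult by (simp add: Z1_def)

section \<open>Non-triviality of the class\<close>

lemma sqrt3_linear_independent:
  assumes "of_rat p * 1 + of_rat q * (sqrt 3 - 2) = 0"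
  shows "p = 0 \<and> q = 0"
proof -
  have sqrt3: "sqrt 3 \<notin> \<rat>"
  proof
    assume "sqrt 3 \<in> \<rat>"
    then obtain m n :: nat where n: "n \<noteq> 0" "\<bar>sqrt 3\<bar> = real m / real n" "coprime m n"
      by (rule Rats_abs_nat_div_natE)
    then have "real m = sqrt 3 * real n" by (simp add: field_simps)
    then have "(real m)\<^sup>2 = 3 * (real n)\<^sup>2" by (simp add: power_mult_distrib)
    then have eq: "m\<^sup>2 = 3 * n\<^sup>2" by (metis of_nat_eq_iff of_nat_mult of_nat_numeral of_nat_power)
    have prime: "prime (3::nat)" by simp
    then have "3 dvd m" using eq by (metis dvd_triv_left prime_dvd_power)
    then obtain k where "m = 3 * k" by (elim dvdE)
    then have "n\<^sup>2 = 3 * k\<^sup>2" using eq by (simp add: power2_eq_square)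
    then have "3 dvd n" using prime by (metis dvd_triv_left prime_dvd_power)
    with \<open>3 dvd m\<close> n(3) show False by (metis coprime_common_divisor_nat numeral_eq_one_iff semiring_norm(86))
  qed
  have "q = 0"
  proof (rule ccontr)
    assume "q \<noteq> 0"
    then have "sqrt 3 = of_rat (2 - p / q)" using assms by (simp add: of_rat_diff of_rat_divide of_rat_mult field_simps)
    with sqrt3 show False by (metis Rats_of_rat)
  qed
  with assms show ?thesis by simp
qed

text \<open>If the cocycle were \<open>\<gamma> \<mapsto> \<gamma> \<cdot> \<nu> - \<nu>\<close>, its value at the point \<open>x = 0\<close> and an eigenvector of
  \<open>\<gamma>\<^sup>T\<close> with eigenvalue \<open>\<alpha> > 0\<close> would be \<open>0\<close> by homogeneity, for every \<open>\<gamma>\<close> in \<open>SL\<^sub>2(\<int>)\<close>. For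
  \<open>\<gamma> = (n -1; 1 0)\<close> the rule gives \<open>(\<alpha> + 1/\<alpha>)/12 - 1/4 = (n - 3)/12\<close>. The least \<open>n\<close> for which
  \<open>\<gamma>\<close> is hyperbolic, \<open>n = 3\<close>, is useless, hence the choice \<open>n = 4\<close>.\<close>

lemma frakZ0_not_coboundary: "frakZ0 \<notin> B1 PGL2Q calD0 actPGL"
proof
  assume "frakZ0 \<in> B1 PGL2Q calD0 actPGL"
  then obtain \<nu> where \<nu>: "\<nu> \<in> carrier calD0"
    and eq: "frakZ0 = (\<lambda>g\<in>carrier PGL2Q. actPGL g \<nu> \<otimes>\<^bsub>calD0\<^esub> inv\<^bsub>calD0\<^esub> \<nu>)"
    unfolding B1_def by blast
  \<comment> \<open>the eigenvector has \<open>\<tau> = \<surd>3 - 2\<close>, and the eigenvalue is \<open>4 + \<tau> = 2 + \<surd>3\<close>\<close>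
  define \<gamma> :: "int^2^2" where "\<gamma> = mat2 4 (-1) 1 0"
  have \<gamma>: "\<gamma> \<in> \<M>" by (simp add: \<gamma>_def mem_\<M>)
  define \<omega> :: "real^2" where "\<omega> = vector [1, sqrt 3 - 2]"
  define \<alpha> where "\<alpha> = 2 + sqrt 3"
  have \<alpha>: "\<alpha> > 0" by (simp add: \<alpha>_def add_pos_nonneg)
  have \<alpha>2: "\<alpha> * \<alpha> = 4 * \<alpha> - 1" by (simp add: \<alpha>_def algebra_simps)
  have mirr: "\<omega> \<in> Mirr" unfolding \<omega>_def Mirr_iff using sqrt3_linear_independent by blast
  have \<xi>: "rmult (cls (vector [0, 0])) (mat2 0 (-1) 1 4) = cls (vector [0, 0])"
    by (simp add: rmult_cls)
  have "map_matrix of_int (transpose \<gamma>) *v \<omega> = \<alpha> *\<^sub>R \<omega>"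
    by (simp add: \<gamma>_def \<omega>_def mat2_simps \<alpha>_def vec_eq_iff forall_2 algebra_simps)
  then have "actM \<gamma> \<nu> (cls (vector [0, 0])) \<omega> = \<nu> (cls (vector [0, 0])) (\<alpha> *\<^sub>R \<omega>)"
    by (subst actM_unimodular[of _ "mat2 0 (-1) 1 4"]) (simp_all add: \<gamma>_def mat_eq_mat2 mat2_simps \<xi>)
  also have "\<dots> = \<nu> (cls (vector [0, 0])) \<omega>"
    using \<nu> \<alpha> mirr by (simp add: carrier_calD0 A0_def)
  finally have "frakZ0 (PGL_class \<gamma>) (cls (vector [0, 0])) \<omega> = 0"
    using \<nu> \<gamma> unfolding eq by (simp add: PGL_class_carrier actPGL_eq calD0_inv) (simp add: calD0_def)
  moreover have "frakZ0 (PGL_class \<gamma>) (cls (vector [0, 0])) \<omega> = 1 / (2 * \<alpha>) * (1 / 6) + \<alpha> / 2 * (1 / 6) - 1 / 4"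
    using cocycle_eq_rule[OF mirr, of \<gamma> "vector [0, 0]"] \<gamma> \<alpha>
    by (simp add: frakZ0_eq_cocycle Z0_rule_def \<gamma>_def \<omega>_def B2bar_def DRsum_def real_vec_def B1bar_def \<alpha>_def)
  moreover have "1 / (2 * \<alpha>) * (1 / 6) + \<alpha> / 2 * (1 / 6) = 1 / 3"
    using \<alpha> \<alpha>2 by (simp add: field_simps)
  ultimately show False by simp
qed

lemma zero_coboundary: "(\<lambda>g\<in>carrier PGL2Q. \<one>\<^bsub>calD0\<^esub>) \<in> B1 PGL2Q calD0 actPGL"
proof -
  have "actPGL K (\<lambda>\<xi> \<omega>. 0) \<otimes>\<^bsub>calD0\<^esub> inv\<^bsub>calD0\<^esub> (\<lambda>\<xi> \<omega>. 0) = \<one>\<^bsub>calD0\<^esub>" if K: "K \<in> carrier PGL2Q" for K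
  proof -
    obtain \<gamma> where \<gamma>: "\<gamma> \<in> \<M>" "K = PGL_class \<gamma>" by (rule PGL_carrier_cases[OF K])
    show ?thesis
      by (simp add: \<gamma> actPGL_eq calD0_group(3) actM_zero calD0_inv) (simp add: calD0_def)
  qed
  then have "(\<lambda>g\<in>carrier PGL2Q. \<one>\<^bsub>calD0\<^esub>) = (\<lambda>g\<in>carrier PGL2Q. actPGL g (\<lambda>\<xi> \<omega>. 0) \<otimes>\<^bsub>calD0\<^esub> inv\<^bsub>calD0\<^esub> (\<lambda>\<xi> \<omega>. 0))"
    by (simp add: fun_eq_iff restrict_def)
  then show ?thesis unfolding B1_def using calD0_group(3) by blast
qed

lemma frakZ0_class_nontrivial:
  "H1_class PGL2Q calD0 actPGL frakZ0 \<noteq> \<one>\<^bsub>H1 PGL2Q calD0 actPGL\<^esub>"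
proof
  assume "H1_class PGL2Q calD0 actPGL frakZ0 = \<one>\<^bsub>H1 PGL2Q calD0 actPGL\<^esub>"
  then have eq: "B1 PGL2Q calD0 actPGL #>\<^bsub>Z1 PGL2Q calD0 actPGL\<^esub> frakZ0 = B1 PGL2Q calD0 actPGL"
    by (simp add: H1_class_def H1_def FactGroup_def)
  have "(\<lambda>g\<in>carrier PGL2Q. \<one>\<^bsub>calD0\<^esub>) \<otimes>\<^bsub>Z1 PGL2Q calD0 actPGL\<^esub> frakZ0 \<in> B1 PGL2Q calD0 actPGL"
    using zero_coboundary eq unfolding r_coset_def by blast
  moreover have "(\<lambda>g\<in>carrier PGL2Q. \<one>\<^bsub>calD0\<^esub>) \<otimes>\<^bsub>Z1 PGL2Q calD0 actPGL\<^esub> frakZ0 = frakZ0"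
    using frakZ0_Pi by (auto simp: Z1_def calD0_def fun_eq_iff restrict_def PiE_def extensional_def)
  ultimately show False using frakZ0_not_coboundary by simp
qed

lemma frakZ0_via_calZ0:
  assumes "mat2 a b c d \<in> \<M>" "c \<noteq> 0"
  shows "frakZ0 (PGL_class (mat2 a b c d)) = actGL (mat2 1 (of_int a) 0 (of_int c)) calZ0"
proof -
  have "actGL (mat2 1 (of_int a) 0 (of_int c)) Zdist = actM (mat2 1 a 0 c) Zdist"
    by (rule actGL_eq[OF calD0_D0[OF Zdist_calD0], of _ 1])
       (use assms in \<open>simp_all add: mem_\<M> map_matrix_mat2 mat_eq_mat2 mat2_mult\<close>)
  then show ?thesis using assms by (simp add: frakZ0_eq_cocycle cocycle_mat2 calZ0_eq)
qed

section \<open>Values at hyperbolic fixed points\<close>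

lemma frac_of_rat_Rats: "frac (real_of_rat x) \<in> \<rat>"
  by (simp add: frac_def)

lemma B2bar_of_rat_Rats: "B2bar (of_rat x) \<in> \<rat>"
  unfolding B2bar_def by (intro Rats_add Rats_diff Rats_power Rats_divide frac_of_rat_Rats) simp_all

lemma B1bar_of_rat_Rats: "B1bar (of_rat x) \<in> \<rat>"
  unfolding B1bar_def using frac_of_rat_Rats[of x] by simp

text \<open>The first eigenvector equation says \<open>\<alpha> = a + c \<tau>\<close>, and \<open>\<alpha> + 1/\<alpha>\<close> is the trace \<open>a + d\<close>. Comparing
  the coefficients of \<open>\<omega>2\<close> in the congruence modulo the lattice gives
  \<open>c x1 - a x2 \<equiv> - x2\<close> modulo \<open>\<int>\<close>, so that the even function \<^const>\<open>B2bar\<close> takes the same value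
  in both terms of the rule.\<close>

lemma fixed_point_value:
  assumes det: "a * d - b * c = 1" and c: "c \<noteq> 0" and \<omega>: "vector [\<omega>1, \<omega>2] \<in> Mirr"
    and fix1: "of_int a * \<omega>1 + of_int c * \<omega>2 = \<alpha> * \<omega>1"
    and fix2: "of_int b * \<omega>1 + of_int d * \<omega>2 = \<alpha> * \<omega>2"
    and v: "inverse \<alpha> * (of_rat x1 * \<omega>1 + of_rat x2 * \<omega>2) - (of_rat x1 * \<omega>1 + of_rat x2 * \<omega>2) \<in> period_lattice (vector [\<omega>1, \<omega>2])"
  shows "Z0_rule (mat2 a b c d) (vector [x1, x2]) (vector [\<omega>1, \<omega>2]) =
          of_int (a + d) / (2 * of_int c) * B2bar (of_rat x2)
          + of_int (sgn c) * DRsum (- a) c (real_vec (vector [x1, x2]))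
          - sgn (of_int c * \<alpha>) / 4 * indicator \<int> x1 * indicator \<int> x2"
proof -
  have nz: "\<omega>1 \<noteq> 0" "\<omega>2 \<noteq> 0" using Mirr_nonzero[OF \<omega>] by simp_all
  have \<alpha>: "of_int a + of_int c * (\<omega>2 / \<omega>1) = \<alpha>" using fix1 nz by (simp add: field_simps)
  have det': "real_of_int a * of_int d - of_int b * of_int c = 1"
    using det by (metis of_int_1 of_int_diff of_int_mult)
  have inv1: "\<alpha> * (of_int d * \<omega>1 - of_int c * \<omega>2) = \<omega>1"
  proof -
    have "\<alpha> * (of_int d * \<omega>1 - of_int c * \<omega>2) = of_int d * (\<alpha> * \<omega>1) - of_int c * (\<alpha> * \<omega>2)" by (simp add: algebra_simps)
    also have "\<dots> = (of_int a * of_int d - of_int b * of_int c) * \<omega>1"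
      unfolding fix1[symmetric] fix2[symmetric] by (simp add: algebra_simps)
    finally show ?thesis using det' by simp
  qed
  have inv2: "\<alpha> * (of_int a * \<omega>2 - of_int b * \<omega>1) = \<omega>2"
  proof -
    have "\<alpha> * (of_int a * \<omega>2 - of_int b * \<omega>1) = of_int a * (\<alpha> * \<omega>2) - of_int b * (\<alpha> * \<omega>1)" by (simp add: algebra_simps)
    also have "\<dots> = (of_int a * of_int d - of_int b * of_int c) * \<omega>2"
      unfolding fix1[symmetric] fix2[symmetric] by (simp add: algebra_simps)
    finally show ?thesis using det' by simp
  qed
  have \<alpha>0: "\<alpha> \<noteq> 0" using inv1 nz by auto
  have i1: "inverse \<alpha> * \<omega>1 = of_int d * \<omega>1 - of_int c * \<omega>2" and i2: "inverse \<alpha> * \<omega>2 = of_int a * \<omega>2 - of_int b * \<omega>1"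
    using inv1 inv2 \<alpha>0 by (simp_all add: field_simps)
  have trace: "inverse \<alpha> + \<alpha> = of_int (a + d)"
  proof -
    have "(inverse \<alpha> + \<alpha>) * \<omega>1 = of_int (a + d) * \<omega>1"
      using i1 fix1 by (simp add: algebra_simps)
    then show ?thesis using nz by simp
  qed
  obtain m n where mn: "inverse \<alpha> * (of_rat x1 * \<omega>1 + of_rat x2 * \<omega>2) - (of_rat x1 * \<omega>1 + of_rat x2 * \<omega>2) = of_int m * \<omega>1 + of_int n * \<omega>2"
    using v by (auto simp: period_lattice_def)
  have "inverse \<alpha> * (of_rat x1 * \<omega>1 + of_rat x2 * \<omega>2) = of_rat x1 * (inverse \<alpha> * \<omega>1) + of_rat x2 * (inverse \<alpha> * \<omega>2)"
    by (simp add: algebra_simps)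
  then have "of_rat (x1 * of_int d - x2 * of_int b - x1 - of_int m) * \<omega>1 + of_rat (x2 * of_int a - x1 * of_int c - x2 - of_int n) * \<omega>2 = 0"
    using mn unfolding i1 i2 by (simp add: of_rat_add of_rat_diff of_rat_mult algebra_simps)
  then have "x2 * of_int a - x1 * of_int c - x2 - of_int n = 0"
    using \<omega> unfolding Mirr_iff by blast
  then have "of_int c * x1 - of_int a * x2 = - x2 + of_int (- n)" by (simp add: algebra_simps)
  then have "of_rat (of_int c * x1 - of_int a * x2) = (of_rat (- x2 + of_int (- n)) :: real)" by (rule arg_cong)
  then have "of_int c * of_rat x1 - of_int a * of_rat x2 = - of_rat x2 + real_of_int (- n)"
    by (simp add: of_rat_diff of_rat_mult of_rat_minus)
  then have B2: "B2bar (of_int c * of_rat x1 - of_int a * of_rat x2) = B2bar (of_rat x2)"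
    by (simp only: B2bar_of_int_add B2bar_uminus)
  have "coprime a c" using det by (metis coprime_iff_gcd_eq_1 gcd.commute dvd_diff dvd_mult dvd_mult2 gcd_dvd1 gcd_dvd2 is_unit_gcd_iff)
  then have g: "gcd a c = 1" by simp
  have "Z0_rule (mat2 a b c d) (vector [x1, x2]) (vector [\<omega>1, \<omega>2]) =
      1 / (2 * of_int c * \<alpha>) * B2bar (of_rat x2) + \<alpha> / (2 * of_int c) * B2bar (of_rat x2)
      + of_int (sgn c) * DRsum (- a) c (real_vec (vector [x1, x2]))
      - sgn (of_int c * \<alpha>) / 4 * indicator \<int> x1 * indicator \<int> x2"
    using c by (simp add: Z0_rule_def Let_def g \<alpha>[simplified] B2 indicator_Ints_of_rat)
  also have "1 / (2 * of_int c * \<alpha>) * B2bar (of_rat x2) + \<alpha> / (2 * of_int c) * B2bar (of_rat x2) =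
      (inverse \<alpha> + \<alpha>) / (2 * of_int c) * B2bar (of_rat x2)"
    using c \<alpha>0 by (simp add: field_simps)
  finally show ?thesis unfolding trace .
qed

lemma fixed_point_value_rational:
  "of_int (a + d) / (2 * of_int c) * B2bar (of_rat x2)
          + of_int (sgn c) * DRsum (- a) c (real_vec (vector [x1, x2]))
          - sgn (of_int c * \<alpha>) / 4 * indicator \<int> x1 * indicator \<int> x2 \<in> \<rat>"
proof -
  have "B1bar (of_rat x1 + (of_rat x2 + of_int m) * (of_int (- a) / of_int c)) * B1bar ((of_rat x2 + of_int m) * (1 / of_int c)) \<in> \<rat>" for m
    using B1bar_of_rat_Rats[of "x1 + (x2 + of_int m) * (of_int (- a) / of_int c)"] B1bar_of_rat_Rats[of "(x2 + of_int m) * (1 / of_int c)"]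
    by (simp add: of_rat_add of_rat_diff of_rat_mult of_rat_divide of_rat_minus)
  then have "DRsum (- a) c (real_vec (vector [x1, x2])) \<in> \<rat>"
    unfolding DRsum_def real_vec_def by (auto intro!: Rats_sum)
  moreover have "sgn (of_int c * \<alpha>) \<in> \<rat>" by (simp add: sgn_if)
  moreover have "(indicator \<int> x1 :: real) \<in> \<rat>" "(indicator \<int> x2 :: real) \<in> \<rat>" by (simp_all add: indicator_def)
  ultimately show ?thesis
    by (intro Rats_add Rats_diff Rats_mult Rats_divide B2bar_of_rat_Rats) simp_all
qed

section \<open>Meromorphic continuation of sums of powers\<close>

lemma gbinomial_Suc_mult_fact: "(u gchoose Suc i) * fact (Suc i) = (u gchoose i) * fact i * (u - of_nat i)"
  for u :: complex
  by (simp add: gbinomial_prod_rev del: fact_Suc)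

lemma holomorphic_gbinomial: "(\<lambda>s. (f s :: complex) gchoose k) holomorphic_on A" if "f holomorphic_on A"
  unfolding gbinomial_prod_rev by (intro holomorphic_intros that) simp_all

lemma norm_of_real_powr: "w > 0 \<Longrightarrow> norm (complex_of_real w powr u) = w powr Re u"
  by (simp add: norm_powr_real_powr)

text \<open>The error of the binomial expansion of \<open>(w + h)\<^sup>u\<close> up to order \<open>N\<close>.\<close>

definition powr_rem :: "nat \<Rightarrow> real \<Rightarrow> complex \<Rightarrow> real \<Rightarrow> complex" where
  "powr_rem N h u w = of_real (w + h) powr u
     - (\<Sum>k\<le>N. (u gchoose k) * of_real h ^ k * of_real w powr (u - of_nat k))"

text \<open>Taylor's formula along the real segment from \<open>w\<close> to \<open>w + h\<close>. There the \<open>(N+1)\<close>-st derivative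
  is largest at \<open>w\<close> because its exponent has non-positive real part.\<close>

lemma norm_powr_rem_le:
  assumes w: "w > 0" and h: "h \<ge> 0" and u: "Re u \<le> real N + 1"
  shows "norm (powr_rem N h u w) \<le>
    norm (u gchoose Suc N) * fact (Suc N) * h ^ Suc N / fact N * w powr (Re u - real (Suc N))"
proof -
  define f where "f i z = (u gchoose i) * fact i * z powr (u - of_nat i)" for i z
  let ?S = "closed_segment (of_real w) (of_real (w + h)) :: complex set"
  let ?B = "norm (u gchoose Suc N) * fact (Suc N) * w powr (Re u - real (Suc N))"
  have S: "\<exists>r. z = of_real r \<and> w \<le> r" if "z \<in> ?S" for z
    using that h unfolding closed_segment_of_real by (auto simp: closed_segment_eq_real_ivl)
  have "norm (f 0 (of_real (w + h)) - (\<Sum>i\<le>N. f i (of_real w) * (of_real (w + h) - of_real w) ^ i / fact i))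
      \<le> ?B * norm (of_real (w + h) - of_real w :: complex) ^ Suc N / fact N"
  proof (rule complex_Taylor)
    show "convex ?S" by simp
    show "(f i has_field_derivative f (Suc i) z) (at z within ?S)" if "z \<in> ?S" for i z
    proof -
      obtain r where r: "z = of_real r" "w \<le> r" using S[OF \<open>z \<in> ?S\<close>] by blast
      then have "z \<notin> \<real>\<^sub>\<le>\<^sub>0" using w by simp
      then have "((\<lambda>z. z powr (u - of_nat i)) has_field_derivative ((u - of_nat i) * z powr (u - of_nat i - 1))) (at z within ?S)"
        by (intro DERIV_subset[OF has_field_derivative_powr]) auto
      from DERIV_cmult[OF this, of "(u gchoose i) * fact i"]
      have "(f i has_field_derivative ((u gchoose i) * fact i * (u - of_nat i)) * z powr (u - of_nat (Suc i))) (at z within ?S)"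
        by (simp add: f_def[abs_def] mult.assoc algebra_simps)
      then show ?thesis by (simp only: f_def[of "Suc i"] gbinomial_Suc_mult_fact)
    qed
    show "norm (f (Suc N) z) \<le> ?B" if "z \<in> ?S" for z
    proof -
      obtain r where r: "z = of_real r" "w \<le> r" using S[OF \<open>z \<in> ?S\<close>] by blast
      have "norm (f (Suc N) z) = norm (u gchoose Suc N) * fact (Suc N) * r powr (Re u - real (Suc N))"
        using r w by (simp add: f_def norm_mult norm_of_real_powr del: fact_Suc of_nat_Suc)
          (simp add: norm_of_real_powr flip: of_nat_Suc)?
      also have "\<dots> \<le> ?B"
        using r w u by (intro mult_left_mono powr_mono2') auto
      finally show ?thesis .
    qed
  qed auto
  moreover have "f i (of_real w) * (of_real (w + h) - of_real w) ^ i / fact i = (u gchoose i) * of_real h ^ i * of_real w powr (u - of_nat i)" for i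
    by (simp add: f_def)
  moreover have "norm (of_real (w + h) - of_real w :: complex) = h" using h by simp
  ultimately show ?thesis
    by (simp add: f_def powr_rem_def mult_ac del: fact_Suc)
qed

lemma powr_rem_of_nat:
  assumes "w > 0" "h \<ge> 0" "m \<le> N"
  shows "powr_rem N h (of_nat m) w = 0"
proof -
  have "of_real w powr (of_nat m - of_nat k) = (of_real w :: complex) ^ (m - k)" if "k \<le> m" for k
    using assms(1) that by (simp flip: of_nat_diff)
  then have "(\<Sum>k\<le>m. (of_nat m gchoose k) * of_real h ^ k * of_real w powr (of_nat m - of_nat k)) =
      (\<Sum>k\<le>m. of_nat (m choose k) * of_real h ^ k * (of_real w :: complex) ^ (m - k))"
    by (intro sum.cong) (auto simp: binomial_gbinomial)
  also have "\<dots> = (of_real h + of_real w) ^ m" by (simp add: binomial_ring)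
  also have "\<dots> = of_real (w + h) powr of_nat m"
    using assms by (simp add: add.commute flip: of_real_add)
  also have "(\<Sum>k\<le>m. (of_nat m gchoose k) * of_real h ^ k * of_real w powr (of_nat m - of_nat k)) =
      (\<Sum>k\<le>N. ((of_nat m :: complex) gchoose k) * of_real h ^ k * of_real w powr (of_nat m - of_nat k))"
    using assms(3) by (intro sum.mono_neutral_left) (auto simp flip: binomial_gbinomial)
  finally show ?thesis by (simp add: powr_rem_def)
qed

text \<open>A bound that is uniform for exponents in an interval, without case distinction on the base.\<close>

lemma powr_le_sum_powr:
  fixes w :: real
  assumes "w > 0" "a \<le> x" "x \<le> b"
  shows "w powr x \<le> w powr a + w powr b"
proof (cases "w \<ge> 1")
  case True
  then have "w powr x \<le> w powr b" using assms by (intro powr_mono) auto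
  then show ?thesis by (simp add: add_increasing)
next
  case False
  then have "w powr x \<le> w powr a" using assms by (intro powr_mono') auto
  then show ?thesis by (simp add: add_increasing2)
qed

lemma has_sum_finite_sum:
  fixes f :: "'j \<Rightarrow> 'i \<Rightarrow> complex"
  assumes "finite J" "\<And>j. j \<in> J \<Longrightarrow> (f j has_sum S j) A"
  shows "((\<lambda>i. \<Sum>j\<in>J. f j i) has_sum (\<Sum>j\<in>J. S j)) A"
  using assms by (induction J rule: finite_induct) (auto intro!: has_sum_add)

text \<open>The Weierstrass M-test with local majorants, for unordered sums.\<close>

lemma holomorphic_on_infsum:
  fixes f :: "'i \<Rightarrow> complex \<Rightarrow> complex"
  assumes hol: "\<And>i. f i holomorphic_on U" and U: "open U"
    and bound: "\<And>z. z \<in> U \<Longrightarrow> \<exists>r>0. cball z r \<subseteq> U \<and>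
      (\<exists>M. M summable_on UNIV \<and> (\<forall>i. \<forall>s\<in>cball z r. norm (f i s) \<le> M i))"
  shows "(\<lambda>s. \<Sum>\<^sub>\<infinity>i. f i s) holomorphic_on U"
proof -
  have "(\<lambda>s. \<Sum>\<^sub>\<infinity>i. f i s) analytic_on {z}" if "z \<in> U" for z
  proof -
    obtain r M where r: "r > 0" "cball z r \<subseteq> U" "M summable_on UNIV"
      and M: "\<And>i s. s \<in> cball z r \<Longrightarrow> norm (f i s) \<le> M i"
      using bound[OF \<open>z \<in> U\<close>] by blast
    have lim: "uniform_limit (cball z r) (\<lambda>X s. \<Sum>i\<in>X. f i s) (\<lambda>s. \<Sum>\<^sub>\<infinity>i. f i s) (finite_subsets_at_top UNIV)"
      by (rule Weierstrass_m_test_general) (use M r in auto)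
    have ball: "ball z r \<subseteq> U" using r(2) ball_subset_cball by blast
    have "(\<lambda>s. \<Sum>\<^sub>\<infinity>i. f i s) holomorphic_on ball z r"
    proof (rule holomorphic_uniform_limit[OF _ lim])
      show "\<forall>\<^sub>F X in finite_subsets_at_top UNIV.
          continuous_on (cball z r) (\<lambda>s. \<Sum>i\<in>X. f i s) \<and> (\<lambda>s. \<Sum>i\<in>X. f i s) holomorphic_on ball z r"
        using holomorphic_on_subset[OF hol r(2)] holomorphic_on_subset[OF hol ball]
        by (intro always_eventually allI conjI continuous_on_sum holomorphic_on_sum holomorphic_on_imp_continuous_on)
    qed auto
    then show ?thesis using r(1) by (meson analytic_at centre_in_ball open_ball)
  qed
  then show ?thesis by (meson analytic_imp_holomorphic analytic_on_analytic_at)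
qed

lemma open_Re_gt: "open {s. Re s > c}"
  using open_halfspace_Re_gt .

lemma connected_Re_gt: "connected {s. Re s > c}"
  using convex_connected[OF convex_halfspace_Re_gt] .

lemma identity_Re_gt:
  assumes "f holomorphic_on {s. Re s > c}" "g holomorphic_on {s. Re s > c}"
    "\<And>s. Re s > c' \<Longrightarrow> f s = g s" "Re s > c" "c' \<ge> c"
  shows "f s = g s"
proof (rule analytic_continuation_open[where s = "{s. Re s > c'}" and s' = "{s. Re s > c}" and f = f and g = g and z = s])
  have "of_real (c' + 1) \<in> {s. c' < Re s}" by simp
  then show "{s. c' < Re s} \<noteq> {}" by blast
  show "f holomorphic_on {s. Re s > c}" "g holomorphic_on {s. Re s > c}" by (rule assms)+
  show "f s = g s" if "s \<in> {s. Re s > c'}" for s using assms(3) that by simp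
qed (use assms(4,5) in \<open>auto simp: open_Re_gt connected_Re_gt\<close>)

text \<open>Dirichlet series \<open>\<Sum> w\<^sub>i\<^sup>-\<^sup>s\<close> that converge absolutely to the right of \<open>p\<close>; the Hurwitz zeta
  function is the case \<open>p = 1\<close> and the double zeta function the case \<open>p = 2\<close>.\<close>

locale power_sum =
  fixes w :: "'i \<Rightarrow> real" and p :: real
  assumes w_pos: "w i > 0" and p_nonneg: "p \<ge> 0"
    and powr_summable: "\<sigma> > p \<Longrightarrow> (\<lambda>i. w i powr (- \<sigma>)) summable_on UNIV"
begin

definition Z :: "complex \<Rightarrow> complex" where
  "Z s = (\<Sum>\<^sub>\<infinity>i. of_real (w i) powr (- s))"

definition R :: "nat \<Rightarrow> real \<Rightarrow> complex \<Rightarrow> complex" where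
  "R N h s = (\<Sum>\<^sub>\<infinity>i. powr_rem N h (1 - s) (w i))"

lemma powr_abs_summable:
  assumes "Re s > p"
  shows "(\<lambda>i. norm (complex_of_real (w i) powr (- s))) summable_on UNIV"
  using powr_summable[OF assms] w_pos by (simp add: norm_of_real_powr)

lemma powr_has_sum:
  assumes "Re s > p"
  shows "((\<lambda>i. of_real (w i) powr (- s)) has_sum Z s) UNIV"
  unfolding Z_def by (rule has_sum_infsum[OF abs_summable_summable[OF powr_abs_summable[OF assms]]])

lemma powr_rem_abs_summable:
  assumes "Re s + real N > p" "h \<ge> 0"
  shows "(\<lambda>i. norm (powr_rem N h (1 - s) (w i))) summable_on UNIV"
proof (rule summable_on_comparison_test)
  let ?C = "norm ((1 - s) gchoose Suc N) * fact (Suc N) * h ^ Suc N / fact N"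
  show "(\<lambda>i. ?C * w i powr (- (Re s + real N))) summable_on UNIV"
    by (intro summable_on_cmult_right powr_summable) (use assms in simp)
  show "norm (powr_rem N h (1 - s) (w i)) \<le> ?C * w i powr (- (Re s + real N))" for i
    using norm_powr_rem_le[OF w_pos assms(2), of "1 - s" N i] assms p_nonneg by (simp add: algebra_simps)
qed simp

lemma powr_rem_has_sum:
  assumes "Re s + real N > p" "h \<ge> 0"
  shows "((\<lambda>i. powr_rem N h (1 - s) (w i)) has_sum R N h s) UNIV"
  unfolding R_def by (rule has_sum_infsum[OF abs_summable_summable[OF powr_rem_abs_summable[OF assms]]])

text \<open>Each further order of the expansion moves the half-plane of convergence one step to the left.\<close>

lemma R_holomorphic:
  assumes "h \<ge> 0"
  shows "R N h holomorphic_on {s. Re s > p - real N}"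
  unfolding R_def[abs_def]
proof (rule holomorphic_on_infsum)
  show "(\<lambda>s. powr_rem N h (1 - s) (w i)) holomorphic_on {s. Re s > p - real N}" for i
    unfolding powr_rem_def using w_pos[of i] assms
    by (intro holomorphic_intros holomorphic_gbinomial) (auto simp flip: of_real_add)
  show "open {s. Re s > p - real N}" by (rule open_Re_gt)
  fix z assume "z \<in> {s. Re s > p - real N}"
  then have z: "Re z + real N > p" by simp
  define r where "r = (Re z + real N - p) / 2"
  have r: "r > 0" using z by (simp add: r_def)
  let ?C = "\<lambda>s. norm ((1 - s) gchoose Suc N) * fact (Suc N) * h ^ Suc N / fact N"
  have "continuous_on (cball z r) (\<lambda>s. (1 - s) gchoose Suc N)"
    by (intro holomorphic_on_imp_continuous_on holomorphic_gbinomial holomorphic_intros)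
  then have "compact ((\<lambda>s. (1 - s) gchoose Suc N) ` cball z r)"
    by (intro compact_continuous_image) auto
  then obtain B where B: "norm ((1 - s) gchoose Suc N) \<le> B" if "s \<in> cball z r" for s
    using compact_imp_bounded[THEN bounded_iff[THEN iffD1]] by (metis imageI)
  have "B \<ge> 0" using order_trans[OF norm_ge_zero B[of z]] r by simp
  define M where "M i = (B * fact (Suc N) * h ^ Suc N / fact N) *
      (w i powr (- (Re z + real N + r)) + w i powr (- (Re z + real N - r)))" for i
  have half: "Re z + real N - r > p" using z by (simp add: r_def field_simps)
  have "M summable_on UNIV"
    unfolding M_def using half r by (intro summable_on_cmult_right summable_on_add powr_summable) auto
  moreover have Re: "\<bar>Re s - Re z\<bar> \<le> r" if "s \<in> cball z r" for s
    using that abs_Re_le_cmod[of "s - z"] by (simp add: dist_norm norm_minus_commute)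
  moreover have "norm (powr_rem N h (1 - s) (w i)) \<le> M i" if s: "s \<in> cball z r" for i s
  proof -
    have s': "Re s + real N > p" using Re[OF s] half by auto
    have "norm (powr_rem N h (1 - s) (w i)) \<le> ?C s * w i powr (- (Re s + real N))"
      using norm_powr_rem_le[OF w_pos assms, of "1 - s" N i] s' p_nonneg by (simp add: algebra_simps)
    also have "\<dots> \<le> M i"
      unfolding M_def using Re[OF s] w_pos[of i] assms \<open>B \<ge> 0\<close>
      by (intro mult_mono powr_le_sum_powr divide_right_mono mult_right_mono B s) auto
    finally show ?thesis .
  qed
  ultimately show "\<exists>r>0. cball z r \<subseteq> {s. Re s > p - real N} \<and>
      (\<exists>M. M summable_on UNIV \<and> (\<forall>i. \<forall>s\<in>cball z r. norm (powr_rem N h (1 - s) (w i)) \<le> M i))"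
    using r half p_nonneg by (intro exI[of _ r] conjI exI[of _ M]) (auto, fastforce)
qed

text \<open>A power with an exponent \<open>m \<le> N\<close> is a polynomial and equals its expansion. So the
  difference equation can be evaluated exactly at such points.\<close>

lemma R_of_nat:
  assumes "1 - s = of_nat m" "m \<le> N" "h \<ge> 0"
  shows "R N h s = 0"
  unfolding R_def using assms by (simp add: powr_rem_of_nat w_pos)

text \<open>Sum the expansions of \<open>(w\<^sub>i + h)\<^sup>1\<^sup>-\<^sup>s\<close> and take away the term of order \<open>0\<close>; the left-hand side,
  the remainder of order \<open>0\<close>, is \<open>\<Sum> ((w\<^sub>i + h)\<^sup>1\<^sup>-\<^sup>s - w\<^sub>i\<^sup>1\<^sup>-\<^sup>s)\<close>.\<close>

lemma difference_expansion:
  assumes s: "Re s > p" and N: "N \<ge> 1" and h: "h \<ge> 0"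
  shows "R 0 h s = (\<Sum>j=1..N. ((1 - s) gchoose j) * of_real h ^ j * Z (s + of_nat j - 1)) + R N h s"
proof -
  have "powr_rem 0 h (1 - s) (w i) =
      (\<Sum>j=1..N. ((1 - s) gchoose j) * of_real h ^ j * of_real (w i) powr (- (s + of_nat j - 1)))
      + powr_rem N h (1 - s) (w i)" for i
  proof -
    have "{..N} = insert 0 {1..N}" by auto
    then have "powr_rem N h (1 - s) (w i) = powr_rem 0 h (1 - s) (w i) -
       (\<Sum>j=1..N. ((1 - s) gchoose j) * of_real h ^ j * of_real (w i) powr (1 - s - of_nat j))"
      by (simp add: powr_rem_def)
    then show ?thesis by (simp add: algebra_simps)
  qed
  moreover have "((\<lambda>i. (\<Sum>j=1..N. ((1 - s) gchoose j) * of_real h ^ j * of_real (w i) powr (- (s + of_nat j - 1)))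
      + powr_rem N h (1 - s) (w i)) has_sum
      (\<Sum>j=1..N. ((1 - s) gchoose j) * of_real h ^ j * Z (s + of_nat j - 1)) + R N h s) UNIV"
    using s h by (intro has_sum_add has_sum_finite_sum has_sum_cmult_right powr_has_sum powr_rem_has_sum) auto
  ultimately have "((\<lambda>i. powr_rem 0 h (1 - s) (w i)) has_sum
      (\<Sum>j=1..N. ((1 - s) gchoose j) * of_real h ^ j * Z (s + of_nat j - 1)) + R N h s) UNIV"
    by simp
  moreover have "((\<lambda>i. powr_rem 0 h (1 - s) (w i)) has_sum R 0 h s) UNIV"
    using s h by (intro powr_rem_has_sum) auto
  ultimately show ?thesis using has_sum_unique by blast
qed

text \<open>In the difference equation the term \<open>j = 1\<close> is \<open>(1 - s) h Z(s)\<close>, so it can be solved for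
  \<open>Z(s)\<close> in terms of \<open>Z(s + 1), Z(s + 2), \<dots>\<close>, and a continuation to a half-plane extends one
  step to the left. To stay among entire functions, the equation is multiplied by \<open>P\<close> and \<open>Z\<close> is
  replaced by \<open>E(s) = (s - 1) P(s) Z(s)\<close>. The factors in \<open>c\<close> say that the binomial
  coefficients \<open>(1 - s choose j)\<close> contain the zeros needed to cancel the poles of
  \<open>Z(s + j - 1)\<close>. The equation itself survives the continuation by the identity theorem.\<close>

theorem entire_continuation:
  fixes c :: "nat \<Rightarrow> complex \<Rightarrow> complex" and P Q :: "complex \<Rightarrow> complex" and h :: real
  assumes h: "h > 0" and hol: "P holomorphic_on UNIV" "Q holomorphic_on UNIV" "\<And>j. c j holomorphic_on UNIV"
    and Q: "\<And>s. Re s > p \<Longrightarrow> P s * R 0 h s = Q s"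
    and c: "\<And>s j. j \<ge> 2 \<Longrightarrow> (1 - s) gchoose j = c j s * ((s + of_nat j - 2) * P (s + of_nat j - 1))"
  obtains E where "E holomorphic_on UNIV" "\<And>s. Re s > p \<Longrightarrow> E s = (s - 1) * P s * Z s"
    "\<And>N s. N \<ge> 1 \<Longrightarrow> Re s > p - real N \<Longrightarrow> of_real h * E s = - Q s +
       (\<Sum>j=2..N. c j s * of_real h ^ j * P s * E (s + of_nat j - 1)) + P s * R N h s"
proof -
  define rhs where "rhs N E s = - Q s +
       (\<Sum>j=2..N. c j s * of_real h ^ j * P s * E (s + of_nat j - 1)) + P s * R N h s" for N E s
  have rhs_hol: "rhs N E holomorphic_on {s. Re s > p - real N}"
    if "E holomorphic_on {s. Re s > q}" "q \<le> p - real N + 1" for N E q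
  proof -
    have "(\<lambda>s. E (s + of_nat j - 1)) holomorphic_on {s. Re s > p - real N}" if "j \<ge> 2" for j
    proof -
      have "(\<lambda>s. s + of_nat j - 1) ` {s. Re s > p - real N} \<subseteq> {s. Re s > q}"
        using that \<open>q \<le> _\<close> by auto
      from holomorphic_on_compose_gen[OF _ \<open>E holomorphic_on _\<close> this] show ?thesis
        by (simp add: o_def holomorphic_intros)
    qed
    then show ?thesis
      unfolding rhs_def[abs_def] using h
      by (intro holomorphic_intros R_holomorphic hol[THEN holomorphic_on_subset]) auto
  qed
  have eq: "of_real h * E s = rhs N E s"
    if EZ: "\<And>s. Re s > p \<Longrightarrow> E s = (s - 1) * P s * Z s" and that: "N \<ge> 1" "Re s > p" for N E s
  proof -
    \<comment> \<open>the term \<open>j = 1\<close> carries the unknown \<open>Z(s)\<close>\<close>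
    have split: "{1..N} = insert 1 {2..N}" using that(1) by auto
    have t: "((1 - s) gchoose j) * of_real h ^ j * Z (s + of_nat j - 1) * P s =
        c j s * of_real h ^ j * P s * E (s + of_nat j - 1)" if "j \<in> {2..N}" for j
    proof -
      have j: "j \<ge> 2" and *: "Re (s + of_nat j - 1) > p" using that \<open>Re s > p\<close> by auto
      have E: "E (s + of_nat j - 1) = (s + of_nat j - 2) * P (s + of_nat j - 1) * Z (s + of_nat j - 1)"
        using EZ[OF *] by simp
      show ?thesis unfolding c[OF j] E by (simp only: mult_ac)
    qed
    have "Q s = P s * R 0 h s" using Q that by simp
    also have "R 0 h s = (1 - s) * of_real h * Z s
        + (\<Sum>j=2..N. ((1 - s) gchoose j) * of_real h ^ j * Z (s + of_nat j - 1)) + R N h s"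
      using difference_expansion[OF that(2,1), of h] h unfolding split by simp
    also have "P s * \<dots> = - of_real h * E s + (\<Sum>j=2..N. c j s * of_real h ^ j * P s * E (s + of_nat j - 1)) + P s * R N h s"
    proof -
      have T: "P s * (\<Sum>j=2..N. ((1 - s) gchoose j) * of_real h ^ j * Z (s + of_nat j - 1)) =
          (\<Sum>j=2..N. c j s * of_real h ^ j * P s * E (s + of_nat j - 1))"
        unfolding sum_distrib_left by (rule sum.cong[OF refl]) (subst mult.commute, rule t)
      show ?thesis unfolding distrib_left T EZ[OF that(2)] by (simp add: algebra_simps)
    qed
    finally show ?thesis by (simp add: rhs_def)
  qed
  have step: "\<exists>E. E holomorphic_on {s. Re s > p - real k} \<and> (\<forall>s. Re s > p \<longrightarrow> E s = (s - 1) * P s * Z s)" for k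
  proof (induction k)
    case 0
    have "(\<lambda>s. (s - 1) * P s * Z s) holomorphic_on {s. Re s > p}"
    proof -
      have "of_real h * ((s - 1) * P s * Z s) = rhs 1 (\<lambda>s. (s - 1) * P s * Z s) s" if "Re s > p" for s
        by (rule eq) (use that in auto)
      then have eq1: "(- Q s + P s * R 1 h s) / of_real h = (s - 1) * P s * Z s" if "Re s > p" for s
        using that h by (simp add: rhs_def field_simps)
      have "(\<lambda>s. (- Q s + P s * R 1 h s) / of_real h) holomorphic_on {s. Re s > p}"
        using h by (intro holomorphic_intros hol[THEN holomorphic_on_subset] R_holomorphic[THEN holomorphic_on_subset]) auto
      then show ?thesis by (rule holomorphic_transform) (use eq1 in auto)
    qed
    then show ?case by auto
  next
    case (Suc k)
    then obtain E where E: "E holomorphic_on {s. Re s > p - real k}"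
      "\<And>s. Re s > p \<Longrightarrow> E s = (s - 1) * P s * Z s" by blast
    have "(\<lambda>s. rhs (Suc k) E s / of_real h) holomorphic_on {s. Re s > p - real (Suc k)}"
      using h by (intro holomorphic_intros rhs_hol[OF E(1)]) auto
    moreover have "rhs (Suc k) E s / of_real h = (s - 1) * P s * Z s" if "Re s > p" for s
    proof -
      have "of_real h * E s = rhs (Suc k) E s" by (rule eq) (use E that in auto)
      then show ?thesis using E(2)[OF that] h by (simp add: field_simps)
    qed
    ultimately show ?case by blast
  qed
  then obtain Ek where Ek: "\<And>k. Ek k holomorphic_on {s. Re s > p - real k}"
    "\<And>k s. Re s > p \<Longrightarrow> Ek k s = (s - 1) * P s * Z s" by metis
  have agree: "Ek k s = Ek l s" if "k \<le> l" "Re s > p - real k" for k l s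
  proof (rule identity_Re_gt[where c' = p, OF Ek(1) _ _ that(2)])
    show "Ek l holomorphic_on {s. p - real k < Re s}"
      using that by (intro holomorphic_on_subset[OF Ek(1)[of l]]) auto
  qed (use Ek(2) in auto)
  \<comment> \<open>the continuations to ever larger half-planes agree, so any index that is large enough serves\<close>
  define E where "E s = Ek (nat \<lceil>p - Re s\<rceil> + 1) s" for s
  have E_eq: "E s = Ek k s" if "Re s > p - real k" for k s
  proof -
    let ?l = "nat \<lceil>p - Re s\<rceil> + 1"
    have "Re s > p - real ?l" by linarith
    then show ?thesis using agree[of k ?l s] agree[of ?l k s] that unfolding E_def by (metis linear)
  qed
  have E_hol: "E holomorphic_on UNIV"
  proof -
    have "E holomorphic_on (\<Union>k. {s. Re s > p - real k})"
    proof (rule holomorphic_on_UN_open)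
      show "E holomorphic_on {s. Re s > p - real k}" for k
        by (rule holomorphic_transform[OF Ek(1)[of k]]) (simp add: E_eq)
    qed (rule open_Re_gt)
    moreover have "(\<Union>k. {s. Re s > p - real k}) = UNIV"
    proof -
      have "\<exists>k. Re s > p - real k" for s
        using reals_Archimedean2[of "p - Re s"] by (auto simp: algebra_simps)
      then show ?thesis by blast
    qed
    ultimately show ?thesis by simp
  qed
  have E_Z: "E s = (s - 1) * P s * Z s" if "Re s > p" for s
    using E_eq[of 0 s] Ek(2)[of s 0] that by simp
  show ?thesis
  proof (rule that[of E])
    show "E holomorphic_on UNIV" by (rule E_hol)
    show "E s = (s - 1) * P s * Z s" if "Re s > p" for s by (rule E_Z[OF that])
    fix N s assume N: "N \<ge> (1::nat)" and s: "Re s > p - real N"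
    have "of_real h * E s = rhs N E s"
    proof (rule identity_Re_gt[where c = "p - real N" and c' = p and f = "\<lambda>s. of_real h * E s" and g = "rhs N E" and s = s])
      show "(\<lambda>s. of_real h * E s) holomorphic_on {s. p - real N < Re s}"
        by (intro holomorphic_intros holomorphic_on_subset[OF E_hol]) auto
      show "rhs N E holomorphic_on {s. p - real N < Re s}"
        by (rule rhs_hol[of _ "p - real N"]) (use E_hol holomorphic_on_subset in auto)
      show "of_real h * E s = rhs N E s" if "Re s > p" for s
        by (rule eq) (use E_Z N that in auto)
    qed (use s in auto)
    then show "of_real h * E s = - Q s +
       (\<Sum>j=2..N. c j s * of_real h ^ j * P s * E (s + of_nat j - 1)) + P s * R N h s"
      by (simp add: rhs_def)
  qed
qed

end

section \<open>The Hurwitz zeta function\<close>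

lemma summable_on_Suc_powr:
  assumes "\<sigma> > 1"
  shows "(\<lambda>n. (real n + 1) powr (- \<sigma>)) summable_on UNIV"
proof -
  have "summable (\<lambda>n. real n powr (- \<sigma>))" using assms by (simp add: summable_real_powr_iff)
  then have "summable (\<lambda>n. real (Suc n) powr (- \<sigma>))" by (rule summable_Suc_iff[THEN iffD2])
  then have "summable (\<lambda>n. (real n + 1) powr (- \<sigma>))" by (simp add: add.commute)
  then show ?thesis by (subst summable_on_UNIV_nonneg_real_iff) auto
qed

lemma hurwitz_powr_summable:
  assumes z: "z > 0" and "\<sigma> > 1"
  shows "(\<lambda>n. (z + real n) powr (- \<sigma>)) summable_on UNIV"
proof (rule summable_on_comparison_test)
  let ?k = "min z 1"
  show "(\<lambda>n. ?k powr (- \<sigma>) * (real n + 1) powr (- \<sigma>)) summable_on UNIV"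
    by (intro summable_on_cmult_right summable_on_Suc_powr assms)
  fix n :: nat
  have k: "?k > 0" using z by simp
  have "?k * real n \<le> 1 * real n" by (intro mult_right_mono) auto
  then have "?k * (real n + 1) \<le> z + real n" by (simp add: distrib_left)
  then have "(z + real n) powr (- \<sigma>) \<le> (?k * (real n + 1)) powr (- \<sigma>)"
    using k assms by (intro powr_mono2') auto
  then show "(z + real n) powr (- \<sigma>) \<le> ?k powr (- \<sigma>) * (real n + 1) powr (- \<sigma>)"
    using k by (simp add: powr_mult)
qed simp

text \<open>The difference of consecutive powers telescopes, and the powers tend to \<open>0\<close>.\<close>

lemma powr_telescope:
  assumes y: "y > 0" and h: "h > 0" and u: "Re u < 0"
  shows "(\<lambda>n. complex_of_real (y + real n * h + h) powr u - of_real (y + real n * h) powr u) sums (- (of_real y powr u))"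
proof -
  have "filterlim (\<lambda>n. h * real n) at_top sequentially"
    by (rule filterlim_tendsto_pos_mult_at_top[OF tendsto_const h filterlim_real_sequentially])
  then have "filterlim (\<lambda>n. y + h * real n) at_top sequentially"
    by (rule filterlim_tendsto_add_at_top[OF tendsto_const])
  then have "(\<lambda>n. complex_of_real (y + h * real n) powr u) \<longlonglongrightarrow> 0"
    by (rule tendsto_neg_powr_complex_of_real) (rule u)
  from telescope_sums[OF this] show ?thesis
    by (simp add: algebra_simps)
qed

lemma hurwitz_power_sum: "z > 0 \<Longrightarrow> power_sum (\<lambda>n. z + real n) 1"
  by unfold_locales (simp_all add: hurwitz_powr_summable add_pos_nonneg)

lemma gbinomial_Suc_mult: "(u gchoose Suc j) * of_nat (Suc j) = (u gchoose j) * (u - of_nat j)" for u :: complex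
proof -
  have "((u gchoose Suc j) * of_nat (Suc j)) * fact j = ((u gchoose j) * (u - of_nat j)) * fact j"
    using gbinomial_Suc_mult_fact[of u j] by (simp add: mult_ac)
  then show ?thesis by simp
qed

text \<open>Here \<open>h = 1\<close> is the step of the progression, so the difference sum telescopes to
  \<open>- z\<^sup>1\<^sup>-\<^sup>s\<close>, and \<open>P = 1\<close>. At \<open>s = 1, 0, -1\<close> the remainder of order \<open>3\<close> vanishes, and the
  equation determines the three values one after the other; the value at \<open>-1\<close> is needed for the
  double zeta function.\<close>

lemma hurwitz_entire:
  assumes z: "z > 0"
  obtains E where "E holomorphic_on UNIV"
    "\<And>s. Re s > 1 \<Longrightarrow> E s = (s - 1) * (\<Sum>\<^sub>\<infinity>n. of_real (z + real n) powr (- s))"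
    "E 1 = 1" "E 0 = of_real z - 1 / 2" "E (- 1) = of_real (z\<^sup>2 - z + 1 / 6)"
proof -
  interpret power_sum "\<lambda>n. z + real n" 1 by (rule hurwitz_power_sum[OF z])
  define c :: "nat \<Rightarrow> complex \<Rightarrow> complex" where "c j s = - ((1 - s) gchoose (j - 1)) / of_nat j" for j s
  define Q :: "complex \<Rightarrow> complex" where "Q s = - (of_real z powr (1 - s))" for s
  have hol: "(\<lambda>s. 1) holomorphic_on UNIV" "Q holomorphic_on UNIV" "c j holomorphic_on UNIV" for j
  proof -
    show "Q holomorphic_on UNIV" unfolding Q_def[abs_def] using z by (intro holomorphic_intros) auto
    show "c j holomorphic_on UNIV"
    proof (cases "j = 0")
      case False
      then show ?thesis unfolding c_def[abs_def] by (intro holomorphic_intros holomorphic_gbinomial) auto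
    qed (simp add: c_def[abs_def])
  qed auto
  have Q: "1 * R 0 1 s = Q s" if "Re s > 1" for s
  proof -
    have "((\<lambda>n. powr_rem 0 1 (1 - s) (z + real n)) has_sum R 0 1 s) UNIV"
      by (rule powr_rem_has_sum) (use that in auto)
    from has_sum_imp_sums[OF this] have "(\<lambda>n. powr_rem 0 1 (1 - s) (z + real n)) sums R 0 1 s" .
    moreover have "(\<lambda>n. powr_rem 0 1 (1 - s) (z + real n)) sums Q s"
      using powr_telescope[OF z, of 1 "1 - s"] that by (simp add: powr_rem_def Q_def)
    ultimately show ?thesis using sums_unique2 by auto
  qed
  have c: "(1 - s) gchoose j = c j s * ((s + of_nat j - 2) * 1)" if j: "j \<ge> 2" for j s
  proof -
    obtain i where i: "j = Suc i" using j by (cases j) auto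
    have "((1 - s) gchoose j) * of_nat j = ((1 - s) gchoose i) * (1 - s - of_nat i)"
      unfolding i by (rule gbinomial_Suc_mult)
    then have "(1 - s) gchoose j = ((1 - s) gchoose i) * (1 - s - of_nat i) / of_nat j"
      using j by (simp add: field_simps)
    moreover have "s + of_nat j - 2 = - (1 - s - of_nat i)" by (simp add: i)
    moreover have "c j s * (- X * 1) = ((1 - s) gchoose i) * X / of_nat j" for X
      by (simp add: c_def i)
    ultimately show ?thesis by (simp only:)
  qed
  obtain E where E: "E holomorphic_on UNIV" "\<And>s. Re s > 1 \<Longrightarrow> E s = (s - 1) * 1 * Z s"
    and eq: "\<And>N s. N \<ge> 1 \<Longrightarrow> Re s > 1 - real N \<Longrightarrow> of_real 1 * E s = - Q s +
       (\<Sum>j=2..N. c j s * of_real 1 ^ j * 1 * E (s + of_nat j - 1)) + 1 * R N 1 s"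
    by (rule entire_continuation[where P = "\<lambda>_. 1", OF zero_less_one hol Q c]) (assumption | (erule that; blast))+
  \<comment> \<open>order \<open>3\<close> reaches \<open>s = -1\<close> and makes the remainder vanish there\<close>
  have set: "{2..3::nat} = {2, 3}" by auto
  have eq3: "E s = - Q s + (c 2 s * E (s + 1) + c 3 s * E (s + 2)) + R 3 1 s" if "Re s > - 2" for s
    using eq[of 3 s] that by (simp add: set algebra_simps)
  have "c 2 1 = 0" "c 3 1 = 0" "c 3 0 = 0" "c 2 0 = - 1 / 2" "c 2 (- 1) = - 1" "c 3 (- 1) = - 1 / 3"
    by (simp_all add: c_def gbinomial_prod_rev numeral_2_eq_2 numeral_3_eq_3)
  moreover have "R 3 1 1 = 0" "R 3 1 0 = 0" "R 3 1 (- 1) = 0"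
    by (rule R_of_nat[of _ 0] R_of_nat[of _ 1] R_of_nat[of _ 2]; simp)+
  moreover have "Q 1 = - 1" "Q 0 = - of_real z" "Q (- 1) = - of_real (z\<^sup>2)"
    using z powr_complexpow[of "of_real z" 2] by (simp_all add: Q_def)
  ultimately have "E 1 = 1" "E 0 = of_real z - E 1 / 2" "E (- 1) = of_real (z\<^sup>2) - E 0 - E 1 / 3"
    using eq3[of 1] eq3[of 0] eq3[of "- 1"] by (simp_all add: algebra_simps)
  then show ?thesis
    using that[OF E(1)] E(2) by (simp add: Z_def)
qed

section \<open>The double zeta function\<close>

text \<open>Since \<open>m + n + 2\<close> dominates the square root of \<open>(m + 1)(n + 1)\<close>, the double series is majorised
  by the square of a series with exponent \<open>\<sigma>/2 > 1\<close>.\<close>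

lemma double_powr_summable:
  assumes z: "z > 0" and \<omega>: "\<omega>1 > 0" "\<omega>2 > 0" and "\<sigma> > 2"
  shows "(\<lambda>i. (z + real (fst i) * \<omega>1 + real (snd i) * \<omega>2) powr (- \<sigma>)) summable_on UNIV"
proof -
  \<comment> \<open>half of \<open>z\<close>, since \<open>p + q\<close> below contains the constant \<open>2\<close>\<close>
  define k where "k = Min {z / 2, \<omega>1, \<omega>2}"
  have k: "k > 0" "2 * k \<le> z" "k \<le> \<omega>1" "k \<le> \<omega>2" using assms by (auto simp: k_def)
  define g where "g = (\<lambda>n. (real n + 1) powr (- (\<sigma> / 2)))"
  have g: "g summable_on UNIV" unfolding g_def by (rule summable_on_Suc_powr) (use assms in simp)
  have "(\<lambda>i. k powr (- \<sigma>) * (g (fst i) * g (snd i))) summable_on Sigma UNIV (\<lambda>_. UNIV)"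
  proof (intro summable_on_cmult_right summable_on_SigmaI)
    show "((\<lambda>n. g (fst (m, n)) * g (snd (m, n))) has_sum g m * infsum g UNIV) UNIV" for m
      using has_sum_cmult_right[OF has_sum_infsum[OF g], of "g m"] by simp
    show "(\<lambda>m. g m * infsum g UNIV) summable_on UNIV" by (intro summable_on_cmult_left g)
  qed (simp add: g_def)
  then have "(\<lambda>i. k powr (- \<sigma>) * (g (fst i) * g (snd i))) summable_on UNIV" by simp
  then show ?thesis
  proof (rule summable_on_comparison_test)
    fix i :: "nat \<times> nat"
    obtain m n where i: "i = (m, n)" by (cases i)
    define p q where "p = real m + 1" and "q = real n + 1"
    have pq: "p > 0" "q > 0" by (simp_all add: p_def q_def)
    have "k * sqrt (p * q) \<le> k * (p + q)"
    proof (rule mult_left_mono)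
      have "p * q \<le> (p + q)\<^sup>2" using pq by (simp add: power2_eq_square algebra_simps)
      then show "sqrt (p * q) \<le> p + q" using pq by (intro real_le_lsqrt) auto
    qed (use k in simp)
    also have "\<dots> = 2 * k + real m * k + real n * k" by (simp add: p_def q_def algebra_simps)
    also have "\<dots> \<le> z + real m * \<omega>1 + real n * \<omega>2"
      using k by (intro add_mono mult_left_mono) auto
    finally have "(z + real m * \<omega>1 + real n * \<omega>2) powr (- \<sigma>) \<le> (k * sqrt (p * q)) powr (- \<sigma>)"
      using k pq assms by (intro powr_mono2') auto
    also have "\<dots> = k powr (- \<sigma>) * (p powr (- (\<sigma> / 2)) * q powr (- (\<sigma> / 2)))"
      using k pq by (simp add: powr_mult real_sqrt_mult powr_half_sqrt[symmetric] powr_powr)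
    finally show "(z + real (fst i) * \<omega>1 + real (snd i) * \<omega>2) powr (- \<sigma>) \<le> k powr (- \<sigma>) * (g (fst i) * g (snd i))"
      by (simp add: i g_def p_def q_def)
  qed simp
qed

lemma double_power_sum:
  assumes "z > 0" "\<omega>1 > 0" "\<omega>2 > 0"
  shows "power_sum (\<lambda>i :: nat \<times> nat. z + real (fst i) * \<omega>1 + real (snd i) * \<omega>2) 2"
  by unfold_locales (use assms in \<open>simp_all add: double_powr_summable add_pos_nonneg\<close>)

text \<open>With \<open>h = \<omega>1\<close> the difference sum telescopes in the first index and leaves a Hurwitz zeta
  function at \<open>s - 1\<close>, whose pole at \<open>s = 2\<close> is removed by \<open>P(s) = s - 2\<close>. The equation at
  \<open>s = 2, 1, 0\<close>, in this order, gives the values of \<open>E\<close> at the two poles and then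
  the value at \<open>0\<close>.\<close>

lemma double_entire:
  assumes z: "z > 0" and \<omega>: "\<omega>1 > 0" "\<omega>2 > 0"
  obtains E where "E holomorphic_on UNIV"
    "\<And>s. Re s > 2 \<Longrightarrow> E s = (s - 1) * (s - 2) *
       (\<Sum>\<^sub>\<infinity>i::nat \<times> nat. of_real (z + real (fst i) * \<omega>1 + real (snd i) * \<omega>2) powr (- s))"
    "E 0 = of_real (z\<^sup>2 / (\<omega>1 * \<omega>2) - z / \<omega>1 - z / \<omega>2 + \<omega>2 / (6 * \<omega>1) + \<omega>1 / (6 * \<omega>2) + 1 / 2)"
proof -
  interpret power_sum "\<lambda>i :: nat \<times> nat. z + real (fst i) * \<omega>1 + real (snd i) * \<omega>2" 2
    by (rule double_power_sum[OF z \<omega>])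
  have z': "z / \<omega>2 > 0" using z \<omega> by simp
  obtain E1 where E1: "E1 holomorphic_on UNIV"
    "\<And>s. Re s > 1 \<Longrightarrow> E1 s = (s - 1) * (\<Sum>\<^sub>\<infinity>n. of_real (z / \<omega>2 + real n) powr (- s))"
    "E1 1 = 1" "E1 0 = of_real (z / \<omega>2) - 1 / 2" "E1 (- 1) = of_real ((z / \<omega>2)\<^sup>2 - z / \<omega>2 + 1 / 6)"
    by (rule hurwitz_entire[OF z']) (erule that; blast)
  define c :: "nat \<Rightarrow> complex \<Rightarrow> complex" where "c j s = ((1 - s) gchoose (j - 2)) / (of_nat j * of_nat (j - 1))" for j s
  define P :: "complex \<Rightarrow> complex" where "P s = s - 2" for s
  define Q :: "complex \<Rightarrow> complex" where "Q s = - (of_real \<omega>2 powr (1 - s)) * E1 (s - 1)" for s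
  have holP: "P holomorphic_on UNIV" unfolding P_def[abs_def] by (intro holomorphic_intros)
  have "(\<lambda>s. E1 (s - 1)) holomorphic_on UNIV"
    using holomorphic_on_compose[of "\<lambda>s. s - 1" UNIV E1] holomorphic_on_subset[OF E1(1)]
    by (simp add: o_def holomorphic_intros)
  then have holQ: "Q holomorphic_on UNIV" unfolding Q_def[abs_def] using \<omega> by (intro holomorphic_intros) auto
  have holc: "c j holomorphic_on UNIV" for j
  proof (cases "j \<ge> 2")
    case True
    then show ?thesis unfolding c_def[abs_def] by (intro holomorphic_intros holomorphic_gbinomial) auto
  next
    case False
    then have "j = 0 \<or> j = 1" by auto
    then show ?thesis by (auto simp: c_def[abs_def])
  qed
  have Q: "P s * R 0 \<omega>1 s = Q s" if s: "Re s > 2" for s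
  proof -
    define f where "f m n = powr_rem 0 \<omega>1 (1 - s) (z + real m * \<omega>1 + real n * \<omega>2)" for m n :: nat
    have "(\<lambda>i. f (fst i) (snd i)) summable_on UNIV"
      unfolding f_def by (rule abs_summable_summable[OF powr_rem_abs_summable]) (use s \<omega> in auto)
    then have sm: "(\<lambda>(m, n). f m n) summable_on UNIV \<times> UNIV" by (simp add: case_prod_unfold)
    then have sm': "(\<lambda>(n, m). f m n) summable_on UNIV \<times> UNIV"
      using summable_on_swap[of "\<lambda>(m, n). f m n" UNIV UNIV] by (simp add: case_prod_unfold)
    have inner: "infsum (\<lambda>m. f m n) UNIV = - (of_real \<omega>2 powr (1 - s) * of_real (z / \<omega>2 + real n) powr (- (s - 1)))" for n
    proof -
      have "(\<lambda>m. f m n) summable_on UNIV"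
        using summable_on_SigmaD1[OF sm', of n] by simp
      then have "(\<lambda>m. f m n) sums infsum (\<lambda>m. f m n) UNIV"
        by (intro has_sum_imp_sums has_sum_infsum)
      moreover have "(\<lambda>m. f m n) sums (- (of_real (z + real n * \<omega>2) powr (1 - s)))"
        using powr_telescope[of "z + real n * \<omega>2" \<omega>1 "1 - s"] z \<omega> s
        by (simp add: f_def powr_rem_def add_pos_nonneg algebra_simps)
      ultimately have "infsum (\<lambda>m. f m n) UNIV = - (of_real (z + real n * \<omega>2) powr (1 - s))"
        using sums_unique2 by blast
      also have "z + real n * \<omega>2 = \<omega>2 * (z / \<omega>2 + real n)" using \<omega> by (simp add: field_simps)
      also have "of_real \<dots> powr (1 - s) = of_real \<omega>2 powr (1 - s) * of_real (z / \<omega>2 + real n) powr (1 - s)"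
        unfolding of_real_mult using \<omega> z by (intro powr_times_real) auto
      finally show ?thesis by simp
    qed
    have "R 0 \<omega>1 s = infsum (\<lambda>(m, n). f m n) (UNIV \<times> UNIV)"
      by (simp add: R_def f_def case_prod_unfold)
    also have "\<dots> = infsum (\<lambda>m. infsum (f m) UNIV) UNIV"
      by (rule infsum_Sigma'_banach[symmetric]) (use sm in simp)
    also have "\<dots> = infsum (\<lambda>n. infsum (\<lambda>m. f m n) UNIV) UNIV"
      by (rule infsum_swap_banach[OF sm])
    also have "\<dots> = - (of_real \<omega>2 powr (1 - s) * (\<Sum>\<^sub>\<infinity>n. of_real (z / \<omega>2 + real n) powr (- (s - 1))))"
      unfolding inner by (simp only: infsum_uminus infsum_cmult_right')
    finally show ?thesis
      using E1(2)[of "s - 1"] s by (simp add: P_def Q_def)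
  qed
  have c: "(1 - s) gchoose j = c j s * ((s + of_nat j - 2) * P (s + of_nat j - 1))" if j: "j \<ge> 2" for j s
  proof -
    obtain i where i: "j = Suc (Suc i)" using j by (metis add_2_eq_Suc le_Suc_ex)
    have "((1 - s) gchoose j) * of_nat j * of_nat (j - 1) = ((1 - s) gchoose i) * (1 - s - of_nat i) * (1 - s - of_nat (Suc i))"
      using gbinomial_Suc_mult[of "1 - s" i] gbinomial_Suc_mult[of "1 - s" "Suc i"] unfolding i
      by (simp add: mult_ac)
    then have "(1 - s) gchoose j = ((1 - s) gchoose i) * (1 - s - of_nat i) * (1 - s - of_nat (Suc i)) / (of_nat j * of_nat (j - 1))"
      using j by (simp add: field_simps)
    moreover have "(s + of_nat j - 2) * P (s + of_nat j - 1) = (1 - s - of_nat i) * (1 - s - of_nat (Suc i))"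
      by (simp add: i P_def algebra_simps)
    ultimately show ?thesis by (simp add: c_def i)
  qed
  obtain E where E: "E holomorphic_on UNIV" "\<And>s. Re s > 2 \<Longrightarrow> E s = (s - 1) * P s * Z s"
    and eq: "\<And>N s. N \<ge> 1 \<Longrightarrow> Re s > 2 - real N \<Longrightarrow> of_real \<omega>1 * E s = - Q s +
       (\<Sum>j=2..N. c j s * of_real \<omega>1 ^ j * P s * E (s + of_nat j - 1)) + P s * R N \<omega>1 s"
    by (rule entire_continuation[OF \<omega>(1) holP holQ holc Q c]) (assumption | (erule that; blast))+
  have set: "{2..3::nat} = {2, 3}" by auto
  have eq3: "of_real \<omega>1 * E s = - Q s + (c 2 s * of_real \<omega>1 ^ 2 * P s * E (s + 1) + c 3 s * of_real \<omega>1 ^ 3 * P s * E (s + 2)) + P s * R 3 \<omega>1 s"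
    if "Re s > - 1" for s
    using eq[of 3 s] that by (simp add: set algebra_simps)
  define b where "b = (z / \<omega>2)\<^sup>2 - z / \<omega>2 + 1 / 6"
  have cv: "c 2 1 = 1 / 2" "c 3 1 = 0" "c 3 0 = 1 / 6" "c 2 0 = 1 / 2"
    by (simp_all add: c_def)
  have Rv: "R 3 \<omega>1 1 = 0" "R 3 \<omega>1 0 = 0"
    by (rule R_of_nat[of _ 0] R_of_nat[of _ 1]; use \<omega> in simp)+
  have Qv: "Q 2 = - 1 / of_real \<omega>2" "Q 1 = - (of_real (z / \<omega>2) - 1 / 2)" "Q 0 = - of_real \<omega>2 * of_real b"
    using \<omega> by (simp_all add: Q_def E1 powr_minus_divide b_def)
  have Pv: "P 2 = 0" "P 1 = - 1" "P 0 = - 2" by (simp_all add: P_def)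
  have E2: "of_real \<omega>1 * E 2 = 1 / of_real \<omega>2"
    using eq3[of 2] by (simp add: Pv Qv)
  have E1': "of_real \<omega>1 * E 1 = of_real (z / \<omega>2) - 1 / 2 - of_real \<omega>1 ^ 2 / 2 * E 2"
    using eq3[of 1] by (simp add: Pv Qv cv Rv)
  have E0: "of_real \<omega>1 * E 0 = of_real \<omega>2 * of_real b - of_real \<omega>1 ^ 2 * E 1 - of_real \<omega>1 ^ 3 / 3 * E 2"
    using eq3[of 0] by (simp add: Pv Qv cv Rv)
  have nz: "complex_of_real \<omega>1 \<noteq> 0" "complex_of_real \<omega>2 \<noteq> 0" using \<omega> by simp_all
  have v2: "E 2 = 1 / (of_real \<omega>1 * of_real \<omega>2)" using E2 nz by (simp add: field_simps)
  have v1: "E 1 = of_real z / (of_real \<omega>1 * of_real \<omega>2) - 1 / (2 * of_real \<omega>1) - 1 / (2 * of_real \<omega>2)"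
  proof -
    have "E 1 = (of_real (z / \<omega>2) - 1 / 2 - of_real \<omega>1 ^ 2 / 2 * E 2) / of_real \<omega>1"
      using E1' nz by (simp add: eq_divide_eq mult.commute)
    show ?thesis unfolding \<open>E 1 = _\<close> v2 using nz by (simp add: field_simps power2_eq_square)
  qed
  have v0: "E 0 = of_real (z\<^sup>2 / (\<omega>1 * \<omega>2) - z / \<omega>1 - z / \<omega>2 + \<omega>2 / (6 * \<omega>1) + \<omega>1 / (6 * \<omega>2) + 1 / 2)"
  proof -
    have "E 0 = (of_real \<omega>2 * of_real b - of_real \<omega>1 ^ 2 * E 1 - of_real \<omega>1 ^ 3 / 3 * E 2) / of_real \<omega>1"
      using E0 nz by (simp add: eq_divide_eq mult.commute)
    show ?thesis unfolding \<open>E 0 = _\<close> v2 v1 b_def using nz by (simp add: field_simps power2_eq_square power3_eq_cube)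
  qed
  show ?thesis
    by (rule that[OF E(1) _ v0]) (simp add: E(2) Z_def P_def)
qed

section \<open>Values of the meromorphic continuations\<close>

text \<open>Outside the two sparse sets of poles, whose complement is connected, the identity theorem
  applies. At a pole both functions are \<open>0\<close>, elsewhere they are limits of their values nearby;
  that is, both agree with their versions without removable singularities.\<close>

lemma nicely_meromorphic_unique:
  assumes f: "f nicely_meromorphic_on UNIV" and g: "g nicely_meromorphic_on UNIV"
    and eq: "\<And>s. Re s > c \<Longrightarrow> f s = g s"
  shows "f = g"
proof
  fix z
  obtain A where A: "A sparse_in UNIV" "f analytic_on UNIV - A"
    using nicely_meromorphic_onE[OF f] by metis
  obtain B where B: "B sparse_in UNIV" "g analytic_on UNIV - B"
    using nicely_meromorphic_onE[OF g] by metis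
  define T where "T = A \<union> B"
  have T: "T sparse_in UNIV" unfolding T_def using A(1) B(1) by (rule sparse_in_union')
  have op: "open (UNIV - T)" using sparse_in_UNIV_imp_closed[OF T] by (simp add: open_Diff)
  have conn: "connected (UNIV - T)"
    by (rule sparse_imp_connected) (use T in auto)
  have fg: "f w = g w" if "w \<notin> T" for w
  proof (rule analytic_continuation_open[where s = "{s. Re s > c} - T" and s' = "UNIV - T" and f = f and g = g and z = w])
    show "open ({s. Re s > c} - T)"
      using open_Re_gt[of c] sparse_in_UNIV_imp_closed[OF T] by (intro open_Diff)
    show "{s. Re s > c} - T \<noteq> {}"
    proof -
      have "of_real (c + 1) \<in> {s. Re s > c}" by simp
      moreover have "eventually (\<lambda>w. w \<notin> T) (at (of_real (c + 1) :: complex))"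
        using sparse_in_UNIV_imp_closed[OF T] T
        by (metis UNIV_I eventually_cosparse_imp_eventually_at eventually_not_in_cosparse)
      moreover have "eventually (\<lambda>w. w \<in> {s. Re s > c}) (at (of_real (c + 1)))"
        using open_Re_gt[of c] by (intro eventually_at_in_open') auto
      ultimately have "eventually (\<lambda>w. w \<in> {s. Re s > c} - T) (at (of_real (c + 1) :: complex))"
        by (auto elim: eventually_elim2)
      then show ?thesis using eventually_happens' at_neq_bot by fastforce
    qed
    show "f holomorphic_on UNIV - T" "g holomorphic_on UNIV - T"
      using A(2) B(2) by (auto simp: T_def intro!: analytic_imp_holomorphic elim: analytic_on_subset)
  qed (use that op conn eq in auto)
  have "eventually (\<lambda>w. w \<notin> T) (at z)"
    using T by (metis UNIV_I eventually_cosparse_imp_eventually_at eventually_not_in_cosparse)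
  then have "eventually (\<lambda>w. f w = g w) (at z)" by (rule eventually_mono) (rule fg)
  then have "remove_sings f z = remove_sings g z" by (rule remove_sings_cong) simp
  moreover have "remove_sings h z = h z" if "h nicely_meromorphic_on UNIV" for h
    using that unfolding nicely_meromorphic_on_def by (metis UNIV_I remove_sings_at_pole remove_sings_eqI)
  ultimately show "f z = g z" using f g by simp
qed

text \<open>If \<open>F\<close> becomes entire after multiplication by \<open>P\<close>, then its unique nicely meromorphic continuation
  is \<open>E / P\<close> with removable singularities filled in, and \<open>E / P\<close> itself is correct wherever \<open>P\<close>
  does not vanish. A zero of \<open>P\<close> need not be a pole, so the naive quotient would not do.\<close>

lemma continuation_value:
  assumes E: "E holomorphic_on UNIV" and P: "P holomorphic_on UNIV" and P0: "P 0 \<noteq> 0" "\<And>s. Re s > c \<Longrightarrow> P s \<noteq> 0"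
    and eq: "\<And>s. Re s > c \<Longrightarrow> E s = P s * F s"
  shows "(THE f. f nicely_meromorphic_on UNIV \<and> (\<forall>s. Re s > c \<longrightarrow> f s = F s)) 0 = E 0 / P 0"
proof -
  define f where "f = remove_sings (\<lambda>s. E s / P s)"
  have an: "(\<lambda>s. E s / P s) analytic_on {s}" if "P s \<noteq> 0" for s
    using E P that by (intro analytic_intros) (auto simp: analytic_on_holomorphic)
  have "(\<lambda>s. E s / P s) meromorphic_on UNIV"
    using E P by (intro meromorphic_intros analytic_on_imp_meromorphic_on) (auto simp: analytic_on_open)
  then have f1: "f nicely_meromorphic_on UNIV" unfolding f_def by (rule remove_sings_nicely_meromorphic)
  have f2: "f s = F s" if "Re s > c" for s
    unfolding f_def using remove_sings_at_analytic[OF an[OF P0(2)[OF that]]] eq[OF that] P0(2)[OF that] by simp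
  have "(THE f. f nicely_meromorphic_on UNIV \<and> (\<forall>s. Re s > c \<longrightarrow> f s = F s)) = f"
  proof (rule the_equality)
    show "f nicely_meromorphic_on UNIV \<and> (\<forall>s. Re s > c \<longrightarrow> f s = F s)" using f1 f2 by blast
    show "g = f" if "g nicely_meromorphic_on UNIV \<and> (\<forall>s. Re s > c \<longrightarrow> g s = F s)" for g
      by (rule nicely_meromorphic_unique[of _ _ c]) (use that f1 f2 in auto)
  qed
  then show ?thesis using remove_sings_at_analytic[OF an[OF P0(1)]] by (simp add: f_def)
qed

lemma zeta1_0:
  assumes "z > 0"
  shows "zeta1 z 0 = of_real (1 / 2 - z)"
proof -
  interpret power_sum "\<lambda>n. z + real n" 1 by (rule hurwitz_power_sum[OF assms])
  obtain E where E: "E holomorphic_on UNIV"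
    "\<And>s. Re s > 1 \<Longrightarrow> E s = (s - 1) * (\<Sum>\<^sub>\<infinity>n. of_real (z + real n) powr (- s))"
    "E 1 = 1" "E 0 = of_real z - 1 / 2" "E (- 1) = of_real (z\<^sup>2 - z + 1 / 6)"
    by (rule hurwitz_entire[OF assms]) (erule that; blast)
  have "(\<Sum>n. complex_of_real (z + real n) powr (- s)) = (\<Sum>\<^sub>\<infinity>n. of_real (z + real n) powr (- s))" if "Re s > 1" for s
    using has_sum_imp_sums[OF powr_has_sum[OF that]] by (simp add: Z_def sums_iff)
  with E(2) have eq: "E s = (s - 1) * (\<Sum>n. complex_of_real (z + real n) powr (- s))" if "Re s > 1" for s
    using that by simp
  have "zeta1 z 0 = E 0 / (0 - 1)"
    unfolding zeta1_def by (rule continuation_value[OF E(1) _ _ _ eq]) (auto intro!: holomorphic_intros)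
  then show ?thesis by (simp add: E(4))
qed

lemma zeta2_0:
  assumes z: "z > 0" and \<omega>: "\<omega>1 > 0" "\<omega>2 > 0"
  shows "zeta2 z (vector [\<omega>1, \<omega>2]) 0 =
    of_real (z\<^sup>2 / (2 * \<omega>1 * \<omega>2) - z / (2 * \<omega>1) - z / (2 * \<omega>2) + \<omega>2 / (12 * \<omega>1) + \<omega>1 / (12 * \<omega>2) + 1 / 4)"
proof -
  interpret power_sum "\<lambda>i :: nat \<times> nat. z + real (fst i) * \<omega>1 + real (snd i) * \<omega>2" 2
    by (rule double_power_sum[OF z \<omega>])
  obtain E where E: "E holomorphic_on UNIV"
    "\<And>s. Re s > 2 \<Longrightarrow> E s = (s - 1) * (s - 2) *
       (\<Sum>\<^sub>\<infinity>i::nat \<times> nat. of_real (z + real (fst i) * \<omega>1 + real (snd i) * \<omega>2) powr (- s))"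
    "E 0 = of_real (z\<^sup>2 / (\<omega>1 * \<omega>2) - z / \<omega>1 - z / \<omega>2 + \<omega>2 / (6 * \<omega>1) + \<omega>1 / (6 * \<omega>2) + 1 / 2)"
    by (rule double_entire[OF z \<omega>]) (erule that; blast)
  have eq: "E s = ((s - 1) * (s - 2)) * (\<Sum>m. \<Sum>n. complex_of_real (z + real m * (vector [\<omega>1, \<omega>2] :: real^2) $ 1 + real n * (vector [\<omega>1, \<omega>2] :: real^2) $ 2) powr (- s))"
    if s: "Re s > 2" for s
  proof -
    define f where "f m n = complex_of_real (z + real m * \<omega>1 + real n * \<omega>2) powr (- s)" for m n
    have sm: "(\<lambda>(m, n). f m n) summable_on UNIV \<times> UNIV"
      using powr_has_sum[OF s] by (auto simp: f_def case_prod_unfold summable_on_def)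
    have "infsum (f m) UNIV = (\<Sum>n. f m n)" for m
      using summable_on_SigmaD1[OF sm, of m] has_sum_imp_sums[OF has_sum_infsum, of "f m"] by (simp add: sums_iff)
    moreover have "infsum (\<lambda>m. infsum (f m) UNIV) UNIV = (\<Sum>m. infsum (f m) UNIV)"
      using summable_on_Sigma_banach[OF sm] has_sum_imp_sums[OF has_sum_infsum, of "\<lambda>m. infsum (f m) UNIV"] by (simp add: sums_iff)
    moreover have "infsum (\<lambda>m. infsum (f m) UNIV) UNIV = infsum (\<lambda>(m, n). f m n) (UNIV \<times> UNIV)"
      by (rule infsum_Sigma'_banach) (rule sm)
    ultimately show ?thesis using E(2)[OF s] by (simp add: f_def case_prod_unfold)
  qed
  have "zeta2 z (vector [\<omega>1, \<omega>2]) 0 = E 0 / ((0 - 1) * (0 - 2))"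
    unfolding zeta2_def by (rule continuation_value[OF E(1) _ _ _ eq]) (auto intro!: holomorphic_intros)
  then show ?thesis unfolding E(3) by (simp add: field_simps)
qed

section \<open>Comparison with the zeta values\<close>

lemma upper_frac_eq: "upper_frac l = (if l \<in> \<int> then 1 else frac l)"
proof -
  let ?t = "if l \<in> \<int> then 1 else frac l"
  have "(THE t. 0 < t \<and> t \<le> 1 \<and> t - l \<in> \<int>) = ?t"
  proof (rule the_equality)
    have "frac l - l \<in> \<int>" by (simp add: frac_def)
    moreover have "0 < frac l" if "l \<notin> \<int>" using that by simp
    ultimately show "0 < ?t \<and> ?t \<le> 1 \<and> ?t - l \<in> \<int>"
      using frac_lt_1[of l] by (auto simp: less_imp_le)
    fix t assume t: "0 < t \<and> t \<le> 1 \<and> t - l \<in> \<int>"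
    then obtain k where k: "t = l + of_int k" by (metis Ints_cases add.commute diff_add_cancel)
    show "t = ?t"
    proof (cases "t = 1")
      case True
      then have "l = of_int (1 - k)" using k by simp
      then show ?thesis using True by (metis Ints_of_int)
    next
      case False
      then have "frac t = t" using t by (simp add: frac_eq)
      moreover have "frac t = frac l" by (simp add: k frac_def)
      ultimately show ?thesis using t by (auto simp: frac_eq_0_iff[symmetric] simp del: frac_eq_0_iff)
    qed
  qed
  then show ?thesis by (simp add: upper_frac_def)
qed

text \<open>The representative in \<open>(0, 1]\<close> differs from the fractional part at the integers only. There
  \<open>t\<^sup>2 - t\<close> takes the same value at \<open>0\<close> and \<open>1\<close>, while \<open>t - 1/2\<close> has to be corrected by \<open>1/2\<close>.\<close>

lemma Bernoulli_upper_frac: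
  "B2bar l = (upper_frac l)\<^sup>2 - upper_frac l + 1 / 6"
  "B1bar l = upper_frac l - 1 / 2 - indicator \<int> l / 2"
  "upper_frac l > 0"
proof -
  have "frac l = 0" if "l \<in> \<int>" using that unfolding frac_eq_0_iff .
  moreover have "0 < frac l" if "l \<notin> \<int>" using that by simp
  ultimately show "B2bar l = (upper_frac l)\<^sup>2 - upper_frac l + 1 / 6"
    "B1bar l = upper_frac l - 1 / 2 - indicator \<int> l / 2" "upper_frac l > 0"
    by (simp_all del: frac_eq_0_iff add: upper_frac_eq B2bar_def B1bar_def indicator_def)
qed

text \<open>For representatives \<open>u, v\<close> in \<open>(0, 1]\<close> the value of the double zeta function at
  \<open>u \<omega>1 + v \<omega>2\<close> is the expression \<^const>\<open>Zrep\<close> with Bernoulli polynomials in \<open>u\<close>, \<open>v\<close>. The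
  corrections of the first Bernoulli function at integers are the two Hurwitz zeta values, and
  their product, \<open>1/4\<close> if both coordinates are integers, is cancelled by the last term of
  \<^const>\<open>Zrep\<close>.\<close>

lemma calZ0_zeta:
  assumes \<omega>: "vector [\<omega>1, \<omega>2] \<in> Mirr" and pos: "\<omega>1 > 0" "\<omega>2 > 0"
  shows "complex_of_real (calZ0 (cls (vector [x1, x2])) (vector [\<omega>1, \<omega>2])) =
          zeta2 (zpoint (vector [x1, x2]) (vector [\<omega>1, \<omega>2])) (vector [\<omega>1, \<omega>2]) 0
          + indicator \<int> x1 / 2 * zeta1 (upper_frac (of_rat x2)) 0
          + indicator \<int> x2 / 2 * zeta1 (upper_frac (of_rat x1)) 0"
proof -
  define u v where "u = upper_frac (of_rat x1)" and "v = upper_frac (of_rat x2)"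
  define i j :: real where "i = indicator \<int> x1" and "j = indicator \<int> x2"
  have uv: "u > 0" "v > 0" by (simp_all add: u_def v_def Bernoulli_upper_frac)
  have ij: "complex_of_real i = indicator \<int> x1" "complex_of_real j = indicator \<int> x2"
    by (simp_all add: i_def j_def indicator_def)
  have ii: "i = 0 \<or> u = 1" "j = 0 \<or> v = 1"
    using indicator_Ints_of_rat[of x1, where 'a = real] indicator_Ints_of_rat[of x2, where 'a = real]
    by (auto simp: i_def j_def u_def v_def upper_frac_eq indicator_def split: if_splits)
  have z: "zpoint (vector [x1, x2]) (vector [\<omega>1, \<omega>2]) = u * \<omega>1 + v * \<omega>2"
    by (simp add: zpoint_def u_def v_def)
  have zpos: "u * \<omega>1 + v * \<omega>2 > 0" using uv pos by (simp add: add_pos_pos)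
  have "calZ0 (cls (vector [x1, x2])) (vector [\<omega>1, \<omega>2]) =
      (u\<^sup>2 - u + 1 / 6) / (2 * (\<omega>2 / \<omega>1)) + \<omega>2 / \<omega>1 / 2 * (v\<^sup>2 - v + 1 / 6)
      + ((u - 1 / 2 - i / 2) * (v - 1 / 2 - j / 2) - 1 / 4 * i * j)"
    using \<omega> pos by (simp add: calZ0_eq Zdist_cls Zrep_def Bernoulli_upper_frac u_def v_def i_def j_def indicator_Ints_of_rat)
  also have "(u - 1 / 2 - i / 2) * (v - 1 / 2 - j / 2) - 1 / 4 * i * j =
      (u - 1 / 2) * (v - 1 / 2) + i / 2 * (1 / 2 - v) + j / 2 * (1 / 2 - u)"
    by (simp add: field_simps)
  also have "(u\<^sup>2 - u + 1 / 6) / (2 * (\<omega>2 / \<omega>1)) + \<omega>2 / \<omega>1 / 2 * (v\<^sup>2 - v + 1 / 6) +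
      ((u - 1 / 2) * (v - 1 / 2) + i / 2 * (1 / 2 - v) + j / 2 * (1 / 2 - u)) =
      ((u * \<omega>1 + v * \<omega>2)\<^sup>2 / (2 * \<omega>1 * \<omega>2) - (u * \<omega>1 + v * \<omega>2) / (2 * \<omega>1) - (u * \<omega>1 + v * \<omega>2) / (2 * \<omega>2)
        + \<omega>2 / (12 * \<omega>1) + \<omega>1 / (12 * \<omega>2) + 1 / 4)
      + i / 2 * (1 / 2 - v) + j / 2 * (1 / 2 - u)"
    using pos by (simp add: field_simps power2_eq_square)
  finally have main: "calZ0 (cls (vector [x1, x2])) (vector [\<omega>1, \<omega>2]) = \<dots>" .
  show ?thesis
    unfolding main z u_def[symmetric] v_def[symmetric] zeta2_0[OF zpos pos] zeta1_0[OF uv(1)] zeta1_0[OF uv(2)] ij[symmetric]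
    by simp
qed

theorem theorem1:
  shows
    "(\<forall>\<gamma>\<in>\<M>. \<forall>x. \<forall>\<omega>\<in>Mirr. frakZ0 (PGL_class \<gamma>) (cls x) \<omega> = Z0_rule \<gamma> x \<omega>)
   \<and> frakZ0 \<in> carrier PGL2Q \<rightarrow>\<^sub>E carrier calD0
   \<and> frakZ0 \<in> carrier (Z1 PGL2Q calD0 actPGL)
   \<and> H1_class PGL2Q calD0 actPGL frakZ0 \<noteq> \<one>\<^bsub>H1 PGL2Q calD0 actPGL\<^esub>
   \<and> (\<forall>x x1 x2 \<omega> \<omega>1 \<omega>2.
        x = vector [x1, x2] \<longrightarrow> \<omega> = vector [\<omega>1, \<omega>2] \<longrightarrow> \<omega> \<in> Mirr \<longrightarrow> \<omega>1 > 0 \<longrightarrow> \<omega>2 > 0 \<longrightarrow>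
        complex_of_real (calZ0 (cls x) \<omega>) =
          zeta2 (zpoint x \<omega>) \<omega> 0
          + indicator \<int> x1 / 2 * zeta1 (upper_frac (of_rat x2)) 0
          + indicator \<int> x2 / 2 * zeta1 (upper_frac (of_rat x1)) 0)
   \<and> (\<forall>a b c d.
        mat2 a b c d \<in> \<M> \<longrightarrow> c \<noteq> 0 \<longrightarrow>
        frakZ0 (PGL_class (mat2 a b c d)) = actGL (mat2 1 (of_int a) 0 (of_int c)) calZ0)
   \<and> (\<forall>a b c d x x1 x2 \<omega> \<omega>1 \<omega>2 \<gamma> v. \<forall>\<alpha>::real.
        \<gamma> = mat2 a b c d \<longrightarrow> det \<gamma> = 1 \<longrightarrow> c \<noteq> 0 \<longrightarrow>
        x = vector [x1, x2] \<longrightarrow> \<omega> = vector [\<omega>1, \<omega>2] \<longrightarrow> \<omega> \<in> Mirr \<longrightarrow>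
        v = of_rat x1 * \<omega>1 + of_rat x2 * \<omega>2 \<longrightarrow>
        map_matrix of_int (transpose \<gamma>) *v \<omega> = \<alpha> *\<^sub>R \<omega> \<longrightarrow>
        inverse \<alpha> * v - v \<in> period_lattice \<omega> \<longrightarrow>
        frakZ0 (PGL_class \<gamma>) (cls x) \<omega> =
          of_int (a + d) / (2 * of_int c) * B2bar (of_rat x2)
          + of_int (sgn c) * DRsum (- a) c (real_vec x)
          - sgn (of_int c * \<alpha>) / 4 * indicator \<int> x1 * indicator \<int> x2
        \<and> frakZ0 (PGL_class \<gamma>) (cls x) \<omega> \<in> \<rat>)"
proof (intro conjI)
  show rule: "\<forall>\<gamma>\<in>\<M>. \<forall>x. \<forall>\<omega>\<in>Mirr. frakZ0 (PGL_class \<gamma>) (cls x) \<omega> = Z0_rule \<gamma> x \<omega>"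
    by (simp add: frakZ0_eq_cocycle cocycle_eq_rule)
  show "frakZ0 \<in> carrier PGL2Q \<rightarrow>\<^sub>E carrier calD0" by (rule frakZ0_Pi)
  show "frakZ0 \<in> carrier (Z1 PGL2Q calD0 actPGL)" by (rule frakZ0_Z1)
  show "H1_class PGL2Q calD0 actPGL frakZ0 \<noteq> \<one>\<^bsub>H1 PGL2Q calD0 actPGL\<^esub>"
    by (rule frakZ0_class_nontrivial)
  show "\<forall>x x1 x2 \<omega> \<omega>1 \<omega>2.
        x = vector [x1, x2] \<longrightarrow> \<omega> = vector [\<omega>1, \<omega>2] \<longrightarrow> \<omega> \<in> Mirr \<longrightarrow> \<omega>1 > 0 \<longrightarrow> \<omega>2 > 0 \<longrightarrow>
        complex_of_real (calZ0 (cls x) \<omega>) =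
          zeta2 (zpoint x \<omega>) \<omega> 0
          + indicator \<int> x1 / 2 * zeta1 (upper_frac (of_rat x2)) 0
          + indicator \<int> x2 / 2 * zeta1 (upper_frac (of_rat x1)) 0"
    using calZ0_zeta by blast
  show "\<forall>a b c d.
        mat2 a b c d \<in> \<M> \<longrightarrow> c \<noteq> 0 \<longrightarrow>
        frakZ0 (PGL_class (mat2 a b c d)) = actGL (mat2 1 (of_int a) 0 (of_int c)) calZ0"
    using frakZ0_via_calZ0 by blast
  show "\<forall>a b c d x x1 x2 \<omega> \<omega>1 \<omega>2 \<gamma> v. \<forall>\<alpha>::real.
        \<gamma> = mat2 a b c d \<longrightarrow> det \<gamma> = 1 \<longrightarrow> c \<noteq> 0 \<longrightarrow>
        x = vector [x1, x2] \<longrightarrow> \<omega> = vector [\<omega>1, \<omega>2] \<longrightarrow> \<omega> \<in> Mirr \<longrightarrow>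
        v = of_rat x1 * \<omega>1 + of_rat x2 * \<omega>2 \<longrightarrow>
        map_matrix of_int (transpose \<gamma>) *v \<omega> = \<alpha> *\<^sub>R \<omega> \<longrightarrow>
        inverse \<alpha> * v - v \<in> period_lattice \<omega> \<longrightarrow>
        frakZ0 (PGL_class \<gamma>) (cls x) \<omega> =
          of_int (a + d) / (2 * of_int c) * B2bar (of_rat x2)
          + of_int (sgn c) * DRsum (- a) c (real_vec x)
          - sgn (of_int c * \<alpha>) / 4 * indicator \<int> x1 * indicator \<int> x2
        \<and> frakZ0 (PGL_class \<gamma>) (cls x) \<omega> \<in> \<rat>"
  proof (intro allI impI)
    fix a b c d and x :: "rat^2" and x1 x2 and \<omega> :: "real^2" and \<omega>1 \<omega>2 and \<gamma> :: "int^2^2" and v \<alpha> :: real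
    assume \<gamma>: "\<gamma> = mat2 a b c d" and det: "det \<gamma> = 1" and c: "c \<noteq> 0"
      and x: "x = vector [x1, x2]" and \<omega>: "\<omega> = vector [\<omega>1, \<omega>2]" and mirr: "\<omega> \<in> Mirr"
      and v: "v = of_rat x1 * \<omega>1 + of_rat x2 * \<omega>2"
      and eigen: "map_matrix of_int (transpose \<gamma>) *v \<omega> = \<alpha> *\<^sub>R \<omega>"
      and lattice: "inverse \<alpha> * v - v \<in> period_lattice \<omega>"
    have ad: "a * d - b * c = 1" using det by (simp add: \<gamma> det_mat2)
    have "of_int a * \<omega>1 + of_int c * \<omega>2 = \<alpha> * \<omega>1" "of_int b * \<omega>1 + of_int d * \<omega>2 = \<alpha> * \<omega>2"
      using eigen by (simp_all add: \<gamma> \<omega> mat2_simps vec_eq_iff forall_2)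
    note val = fixed_point_value[OF ad c mirr[unfolded \<omega>] this lattice[unfolded v \<omega>]]
    have "\<gamma> \<in> \<M>" using det by (simp add: \<M>_def)
    then have eq: "frakZ0 (PGL_class \<gamma>) (cls x) \<omega> =
          of_int (a + d) / (2 * of_int c) * B2bar (of_rat x2)
          + of_int (sgn c) * DRsum (- a) c (real_vec x)
          - sgn (of_int c * \<alpha>) / 4 * indicator \<int> x1 * indicator \<int> x2"
      using rule mirr val by (simp add: \<gamma> x \<omega>)
    moreover have "\<dots> \<in> \<rat>" unfolding x by (rule fixed_point_value_rational)
    ultimately show "frakZ0 (PGL_class \<gamma>) (cls x) \<omega> =
          of_int (a + d) / (2 * of_int c) * B2bar (of_rat x2)
          + of_int (sgn c) * DRsum (- a) c (real_vec x)
          - sgn (of_int c * \<alpha>) / 4 * indicator \<int> x1 * indicator \<int> x2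
        \<and> frakZ0 (PGL_class \<gamma>) (cls x) \<omega> \<in> \<rat>" by simp
  qed
qed

end
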